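(* Let $\alpha>0$, $b\in(0,1]$, $\beta=1/\alpha$, and let $f:[0,1]\to[0,1]$, $f(x)=x(1+bx^\alpha)\bmod 1$. With $Y=[e_0,1]$, the first return time $\tau$, the general return time $\varphi$, the reinduce time $\rho$ and the measures $\mu_0,\mu_\tau$ defined in the context, and $\bar\rho=\int_Y\rho\,d\mu_0$, one has $$\Big|\frac1{\bar\rho}\,\mu_0(\varphi>n)-\mu_\tau(\tau>n)\Big|=O(n^{-(1+\beta)}),$$ and there exists $C>0$ such that $$\int_{\{\varphi>n\}}\rho\,d\mu_0\le C\,\mu_0(\varphi>n)\qquad\text{for all }n\ge0.$$
   Context: $e_0\in(0,1)$ is the point with $e_0(1+be_0^\alpha)=1$, i.e. the discontinuity of $f$, $f(e_0)=0$, and $Y=[e_0,1]$. $\tau(y)=\min\{n\ge1:f^n(y)\in Y\}$ is the first return time to $Y$; $\tau_0=0$ and $\tau_{k+1}(y)=\tau_k(y)+\tau(f^{\tau_k(y)}(y))$ is the $(k+1)$-st return time. Null sets are ignored throughout. For $k\ge1$, $e_k>e_{k-1}$ denotes the right-most point of $Y$ such that $f^{\tau_k(e_k)}(e_k)=e_0$ (if $e_k=1$ for some $k$, the construction stops there). Then $f^{\tau_k}$ maps $[e_k,1)$ monotonically, but in general not surjectively, into $Y$. The general return time is $$\varphi(y)=\tau_k(y)+\tau(f^{\tau_k(y)}(y))=\tau_{k+1}(y)\qquad\text{for }y\in[e_k,e_{k+1}),\ k\ge0,$$ so the reinduce time $\rho$, defined by $\varphi(y)=\tau_{\rho(y)}(y)$,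 equals $k+1$ on $[e_k,e_{k+1})$. The map $f^\varphi:Y\to Y$, $y\mapsto f^{\varphi(y)}(y)$, has only onto branches and is a Gibbs Markov map; $\mu_0$ is its absolutely continuous invariant probability measure. $\mu_\tau$ is the absolutely continuous invariant probability measure of the first return map $f^\tau:Y\to Y$. Sets such as $\{\varphi>n\}$ and $\{\tau>n\}$ are subsets of $Y$. *)

theory Defs
  imports "HOL-Probability.Probability" "HOL-Library.Landau_Symbols"
begin

text \<open>
  Return times live in \<^typ>\<open>enat\<close>: a point that never returns has return time \<open>\<infinity>\<close>
  (\<open>Inf {} = \<infinity>\<close>), so the Lebesgue-null set of such points needs no artificial finite value.
\<close>

definition first_return :: "('a \<Rightarrow> 'a) \<Rightarrow> 'a set \<Rightarrow> 'a \<Rightarrow> enat" where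
  "first_return f Y y = (INF n \<in> {n. 1 \<le> n \<and> (f ^^ n) y \<in> Y}. enat n)"

primrec kth_return :: "('a \<Rightarrow> 'a) \<Rightarrow> 'a set \<Rightarrow> nat \<Rightarrow> 'a \<Rightarrow> enat" where
  "kth_return f Y 0 y = 0"
| "kth_return f Y (Suc k) y =
     (case kth_return f Y k y of
        enat m \<Rightarrow> enat m + first_return f Y ((f ^^ m) y)
      | \<infinity> \<Rightarrow> \<infinity>)"

text \<open>The map \<open>f\<^sup>t : y \<mapsto> f\<^sup>t\<^sup>(\<^sup>y\<^sup>)(y)\<close>; where the time is infinite it is set to the identity,
  which keeps it a self-map of the base.\<close>

definition induced_map :: "('a \<Rightarrow> 'a) \<Rightarrow> ('a \<Rightarrow> enat) \<Rightarrow> 'a \<Rightarrow> 'a" where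
  "induced_map f t y = (case t y of enat n \<Rightarrow> (f ^^ n) y | \<infinity> \<Rightarrow> y)"

text \<open>\<open>\<mu>\<close> is a \<open>T\<close>-invariant Borel probability measure on \<open>Y\<close>, absolutely continuous with
  respect to Lebesgue measure.\<close>

definition acip :: "real set \<Rightarrow> (real \<Rightarrow> real) \<Rightarrow> real measure \<Rightarrow> bool" where
  "acip Y T \<mu> \<longleftrightarrow>
     prob_space \<mu> \<and>
     sets \<mu> = sets (restrict_space borel Y) \<and>
     absolutely_continuous (restrict_space lborel Y) \<mu> \<and>
     T \<in> measurable \<mu> \<mu> \<and>
     distr \<mu> \<mu> T = \<mu>"

definition pm_map :: "real \<Rightarrow> real \<Rightarrow> real \<Rightarrow> real" where
  "pm_map \<alpha> b x = frac (x * (1 + b * x powr \<alpha>))"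

definition pm_disc :: "real \<Rightarrow> real \<Rightarrow> real" where
  "pm_disc \<alpha> b = (THE x. 0 < x \<and> x < 1 \<and> x * (1 + b * x powr \<alpha>) = 1)"

definition pm_base :: "real \<Rightarrow> real \<Rightarrow> real set" where
  "pm_base \<alpha> b = {pm_disc \<alpha> b..1}"

definition pm_tau :: "real \<Rightarrow> real \<Rightarrow> real \<Rightarrow> enat" where
  "pm_tau \<alpha> b = first_return (pm_map \<alpha> b) (pm_base \<alpha> b)"

definition pm_tau_k :: "real \<Rightarrow> real \<Rightarrow> nat \<Rightarrow> real \<Rightarrow> enat" where
  "pm_tau_k \<alpha> b = kth_return (pm_map \<alpha> b) (pm_base \<alpha> b)"

text \<open>The points \<open>e\<^sub>k\<close>. If the construction stops at \<open>e\<^sub>k = 1\<close>, the sequence is continued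
  constantly, so that all later intervals \<open>[e\<^sub>k, e\<^sub>k\<^sub>+\<^sub>1)\<close> are empty.\<close>

primrec pm_e :: "real \<Rightarrow> real \<Rightarrow> nat \<Rightarrow> real" where
  "pm_e \<alpha> b 0 = pm_disc \<alpha> b"
| "pm_e \<alpha> b (Suc k) =
     (if pm_e \<alpha> b k = 1 then 1
      else (GREATEST y. y \<in> pm_base \<alpha> b \<and>
              (\<exists>m. pm_tau_k \<alpha> b (Suc k) y = enat m \<and> (pm_map \<alpha> b ^^ m) y = pm_disc \<alpha> b)))"

text \<open>The intervals \<open>[e\<^sub>k, e\<^sub>k\<^sub>+\<^sub>1)\<close> partition \<open>[e\<^sub>0, 1)\<close>; the value at the single point \<open>1\<close> is
  left unspecified.\<close>

definition pm_rho :: "real \<Rightarrow> real \<Rightarrow> real \<Rightarrow> nat" where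
  "pm_rho \<alpha> b y = (THE k. pm_e \<alpha> b k \<le> y \<and> y < pm_e \<alpha> b (Suc k)) + 1"

definition pm_phi :: "real \<Rightarrow> real \<Rightarrow> real \<Rightarrow> enat" where
  "pm_phi \<alpha> b y = pm_tau_k \<alpha> b (pm_rho \<alpha> b y) y"

end

theory Submission
  imports Defs
begin

text \<open>
  All inverse branches of \<open>f\<^sup>\<tau>\<close> and \<open>f\<^sup>\<phi>\<close> are compositions of the inverse branches of
  \<open>x (1 + b x\<^sup>\<alpha>)\<close> and \<open>x (1 + b x\<^sup>\<alpha>) - 1\<close>, which are increasing and concave on \<open>(0, \<infinity>)\<close>.
  Concavity replaces distortion estimates: on every cylinder of the full-branch map \<open>f\<^sup>\<phi>\<close> the
  push-forward of Lebesgue measure has decreasing density, and comparing each branch with its left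
  neighbour, which is again a branch, bounds this density. Approximating an absolutely continuous
  measure by measures that are constant on long cylinders yields that every absolutely continuous
  invariant measure of \<open>f\<^sup>\<phi>\<close> has bounded density, gives mass at least proportional to the length to
  intervals \<open>[e\<^sub>0, c)\<close>, and that \<open>f\<^sup>\<phi>\<close> is ergodic. Hence \<open>f\<^sup>\<tau>\<close> is ergodic, too, and
  \<open>\<mu>\<^sub>\<tau>\<close> is the measure induced by \<open>\<mu>\<^sub>0\<close>: \<open>\<mu>\<^sub>\<tau>(A)\<close> is the \<open>\<mu>\<^sub>0\<close>-integral of the
  number of \<open>j < \<rho>\<close> with \<open>(f\<^sup>\<tau>)\<^sup>j \<in> A\<close>, divided by the integral of \<open>\<rho>\<close>.

  On \<open>[e\<^sub>k, e\<^sub>k\<^sub>+\<^sub>1)\<close> the first \<open>k\<close> return times are constants with sum \<open>t\<^sub>k\<close>, so that the two sides of the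
  first claim differ there only if \<open>2 t\<^sub>k > n\<close> or if the last return time lies in \<open>(n - t\<^sub>k, n]\<close>.
  Every return contracts by the factor \<open>e\<^sub>0\<close>, and a return of length \<open>N\<close> by \<open>O(N\<^sup>-\<^sup>(\<^sup>1\<^sup>+\<^sup>\<beta>\<^sup>))\<close>, hence the
  contributions of the blocks are summable.
\<close>

section \<open>Invariant measures\<close>

text \<open>The two measures are given, not constructed, so \<open>\<mu>\<tau>\<close> can be tied
  to \<open>\<mu>0\<close> only by uniqueness. The branches of \<open>F\<close> need not be full,
  which rules out a direct proof of its ergodicity; this is borrowed from \<open>G\<close>, which is
  pointwise a power of \<open>F\<close>. The density of \<open>\<mu>0\<close> comes without any
  regularity. What holds for Lebesgue measure on every cylinder therefore reaches
  \<open>\<mu>0\<close> only as an upper bound in the limit of long cylinders, and invariance then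
  removes the limit. The lower bound for intervals \<open>[e0, c)\<close> is an upper bound for
  their complement. The threshold 2 t_k > n is chosen because otherwise n - t_k is at least n/2, so
  that powers of n - t_k and of n are comparable. The window (n - t_k, n] of last return times then
  has length O(t_k n^-(1+\<beta>)), and the factor t_k is paid for by the contraction
  O(t_k^-(1+\<beta>)) of an inverse branch that follows returns of total length t_k. In the second
  claim the integral is O(n^-\<beta>), and \<mu>0(\<phi> > n) is at least of this order because
  {\<phi> > n} contains an interval \<open>[e0, a m)\<close> with m a bounded multiple of n.\<close>

lemma prob_space_eqI_le:
  assumes M: "prob_space M" and N: "prob_space N" and sets: "sets M = sets N"
    and le: "\<And>B. B \<in> sets M \<Longrightarrow> emeasure M B \<le> emeasure N B"
  shows "M = N"
proof (rule measure_eqI[OF sets])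
  interpret M: prob_space M by fact
  interpret N: prob_space N by fact
  fix B assume B: "B \<in> sets M"
  have sp: "space M = space N" using sets by (rule sets_eq_imp_space_eq)
  \<comment> \<open>Both total masses are 1, so domination on the complement is reversed domination
    on \<open>B\<close>.\<close>
  have "measure M (space M - B) \<le> measure N (space M - B)"
    using le[of "space M - B"] B by (simp add: M.emeasure_eq_measure N.emeasure_eq_measure)
  moreover have "measure M (space M - B) = 1 - measure M B"
    using B by (simp add: M.prob_compl)
  moreover have "measure N (space M - B) = 1 - measure N B"
    using B sets by (simp add: sp N.prob_compl)
  ultimately show "emeasure M B = emeasure N B"
    using le[OF B] by (simp add: M.emeasure_eq_measure N.emeasure_eq_measure)
qed

lemma funpow_measurable: assumes T: "T \<in> measurable M M" shows "(T ^^ n) \<in> measurable M M"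
proof (induction n)
  case (Suc n)
  then show ?case by (simp only: funpow.simps measurable_comp[OF _ T])
qed (simp add: id_def)

lemma AE_invariant_funpow:
  assumes T: "T \<in> measurable M M" and inv: "distr M M T = M" and P: "AE x in M. P x"
  shows "AE x in M. P ((T ^^ n) x)"
proof (induction n)
  case 0 then show ?case using P by simp
next
  case (Suc n)
  have "AE x in distr M M T. P ((T ^^ n) x)" unfolding inv by (rule Suc)
  then have "AE x in M. P ((T ^^ n) (T x))" by (rule AE_distrD[OF T])
  then show ?case by (simp add: funpow_swap1)
qed

text \<open>The set where the density of \<open>\<mu>\<close> exceeds that of \<open>\<nu>\<close> is invariant up to null sets, and
  its limit superior under \<open>T\<close> is invariant in the strict sense.\<close>

theorem invariant_measure_unique:
  fixes X :: "'a measure"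
  assumes X: "sigma_finite_measure X" and T: "T \<in> measurable X X"
    and \<mu>: "prob_space \<mu>" "sets \<mu> = sets X" "absolutely_continuous X \<mu>" "distr \<mu> \<mu> T = \<mu>"
    and \<nu>: "prob_space \<nu>" "sets \<nu> = sets X" "absolutely_continuous X \<nu>" "distr \<nu> \<nu> T = \<nu>"
    and ergodic: "\<And>A. A \<in> sets X \<Longrightarrow> (\<And>y. y \<in> space X \<Longrightarrow> T y \<in> A \<longleftrightarrow> y \<in> A) \<Longrightarrow>
      A \<in> null_sets X \<or> space X - A \<in> null_sets X"
  shows "\<mu> = \<nu>"
proof -
  interpret X: sigma_finite_measure X by fact
  interpret \<mu>: prob_space \<mu> by fact
  interpret \<nu>: prob_space \<nu> by fact
  have sp: "space \<mu> = space X" "space \<nu> = space X"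
    using \<mu>(2) \<nu>(2) sets_eq_imp_space_eq by blast+
  have T\<mu>: "T \<in> measurable \<mu> \<mu>" and T\<nu>: "T \<in> measurable \<nu> \<nu>"
    using T \<mu>(2) \<nu>(2) by (simp_all cong: measurable_cong_sets)
  obtain f where f [measurable]: "f \<in> borel_measurable X" and f\<mu>: "density X f = \<mu>"
    using X.Radon_Nikodym[OF \<mu>(3,2)] by blast
  obtain g where g [measurable]: "g \<in> borel_measurable X" and g\<nu>: "density X g = \<nu>"
    using X.Radon_Nikodym[OF \<nu>(3,2)] by blast
  have e\<mu>: "emeasure \<mu> B = (\<integral>\<^sup>+x. f x * indicator B x \<partial>X)" if "B \<in> sets X" for B
    using emeasure_density[OF f that] f\<mu> by simp
  have e\<nu>: "emeasure \<nu> B = (\<integral>\<^sup>+x. g x * indicator B x \<partial>X)" if "B \<in> sets X" for B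
    using emeasure_density[OF g that] g\<nu> by simp
  define A where "A = {x \<in> space X. g x < f x}"
  have A [measurable]: "A \<in> sets X" unfolding A_def by measurable
  have in_A: "emeasure \<nu> B \<le> emeasure \<mu> B" if "B \<in> sets X" "B \<subseteq> A" for B
    unfolding e\<mu>[OF that(1)] e\<nu>[OF that(1)]
    by (rule nn_integral_mono) (use that in \<open>auto simp: A_def split: split_indicator\<close>)
  have out_A: "emeasure \<mu> B \<le> emeasure \<nu> B" if "B \<in> sets X" "B \<inter> A = {}" for B
    unfolding e\<mu>[OF that(1)] e\<nu>[OF that(1)]
  proof (rule nn_integral_mono)
    fix x assume "x \<in> space X"
    then show "f x * indicator B x \<le> g x * indicator B x"
      using that by (auto simp: A_def not_less[symmetric] split: split_indicator)
  qed
  define A' where "A' = T -` A \<inter> space X"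
  have A' [measurable]: "A' \<in> sets X" unfolding A'_def using measurable_sets[OF T A] .
  have \<mu>A': "emeasure \<mu> A' = emeasure \<mu> A"
  proof -
    have "emeasure (distr \<mu> \<mu> T) A = emeasure \<mu> (T -` A \<inter> space \<mu>)"
      by (rule emeasure_distr[OF T\<mu>]) (use A \<mu>(2) in simp)
    then show ?thesis using \<mu>(4) sp by (simp add: A'_def)
  qed
  have \<nu>A': "emeasure \<nu> A' = emeasure \<nu> A"
  proof -
    have "emeasure (distr \<nu> \<nu> T) A = emeasure \<nu> (T -` A \<inter> space \<nu>)"
      by (rule emeasure_distr[OF T\<nu>]) (use A \<nu>(2) in simp)
    then show ?thesis using \<nu>(4) sp by (simp add: A'_def)
  qed
  have \<mu>D: "measure \<mu> (A - A') = measure \<mu> (A' - A)"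
    using \<mu>.finite_measure_Diff'[of A A'] \<mu>.finite_measure_Diff'[of A' A] \<mu>A' A A' \<mu>(2)
    by (simp add: \<mu>.emeasure_eq_measure Int_commute)
  have \<nu>D: "measure \<nu> (A - A') = measure \<nu> (A' - A)"
    using \<nu>.finite_measure_Diff'[of A A'] \<nu>.finite_measure_Diff'[of A' A] \<nu>A' A A' \<nu>(2)
    by (simp add: \<nu>.emeasure_eq_measure Int_commute)
  \<comment> \<open>The chain \<nu>(A - A') \<le> \<mu>(A - A') = \<mu>(A' - A) \<le> \<nu>(A' - A)
    = \<nu>(A - A') closes up, so all its members are equal.\<close>
  have "measure \<nu> (A - A') \<le> measure \<mu> (A - A')"
    using in_A[of "A - A'"] by (simp add: \<mu>.emeasure_eq_measure \<nu>.emeasure_eq_measure)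
  moreover have "measure \<mu> (A' - A) \<le> measure \<nu> (A' - A)"
    using out_A[of "A' - A"] by (simp add: Int_commute \<mu>.emeasure_eq_measure \<nu>.emeasure_eq_measure)
  ultimately have eqD: "emeasure \<nu> (A - A') = emeasure \<mu> (A - A')"
    using \<mu>D \<nu>D by (simp add: \<mu>.emeasure_eq_measure \<nu>.emeasure_eq_measure)
  have nullD: "A - A' \<in> null_sets X"
  proof -
    have D: "A - A' \<in> sets X" by simp
    \<comment> \<open>On \<open>A - A'\<close> the density \<open>f\<close> is strictly larger than
      \<open>g\<close>; equal finite masses are then possible only if this set is null.\<close>
    have "AE x in X. f x * indicator (A - A') x \<le> g x * indicator (A - A') x"
    proof (rule ccontr)
      assume "\<not> ?thesis"
      then have "(\<integral>\<^sup>+x. g x * indicator (A - A') x \<partial>X) < (\<integral>\<^sup>+x. f x * indicator (A - A') x \<partial>X)"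
      proof (intro nn_integral_less)
        show "(\<integral>\<^sup>+x. g x * indicator (A - A') x \<partial>X) \<noteq> \<infinity>"
          unfolding e\<nu>[OF D, symmetric] by (simp add: \<nu>.emeasure_eq_measure)
        show "AE x in X. g x * indicator (A - A') x \<le> f x * indicator (A - A') x"
          by (intro AE_I2) (auto simp: A_def split: split_indicator)
      qed auto
      then show False using eqD unfolding e\<mu>[OF D] e\<nu>[OF D] by simp
    qed
    then have "AE x in X. x \<notin> A - A'"
      by (rule AE_mp) (intro AE_I2, auto simp: A_def not_le split: split_indicator_asm)
    then show ?thesis using D by (simp add: AE_iff_null_sets)
  qed
  have null_transfer: "B \<in> null_sets \<mu>" "B \<in> null_sets \<nu>" if "B \<in> null_sets X" for B
    using that \<mu>(3) \<nu>(3) by (auto simp: absolutely_continuous_def)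
  \<comment> \<open>For \<open>A' - A\<close> the argument gives nullity with respect to
    \<open>\<mu>\<close> and \<open>\<nu>\<close> but not \<open>X\<close>. The almost sure
    statements below are therefore made for the two measures separately.\<close>
  have "measure \<mu> (A' - A) = 0" "measure \<nu> (A' - A) = 0"
    using null_transfer[OF nullD] \<mu>D \<nu>D by (auto simp: null_sets_def \<mu>.emeasure_eq_measure \<nu>.emeasure_eq_measure)
  then have nullD': "A' - A \<in> null_sets \<mu>" "A' - A \<in> null_sets \<nu>"
    using \<mu>(2) \<nu>(2) by (auto simp: null_sets_def \<mu>.emeasure_eq_measure \<nu>.emeasure_eq_measure)
  have inv_AE: "AE x in M. T x \<in> A \<longleftrightarrow> x \<in> A"
    if "A - A' \<in> null_sets M" "A' - A \<in> null_sets M" "space M = space X" for M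
    using AE_not_in[OF that(1)] AE_not_in[OF that(2)] AE_space
    by eventually_elim (auto simp: A'_def that(3))
  define S where "S = {x \<in> space X. \<forall>m. \<exists>j\<ge>m. (T ^^ j) x \<in> A}"
  have S: "S \<in> sets X"
  proof -
    have [measurable]: "(T ^^ j) \<in> measurable X X" for j by (rule funpow_measurable[OF T])
    show ?thesis unfolding S_def by measurable
  qed
  have S_inv: "T y \<in> S \<longleftrightarrow> y \<in> S" if y: "y \<in> space X" for y
  proof -
    have Ty: "T y \<in> space X" using measurable_space[OF T y] .
    have eq: "(T ^^ j) (T y) = (T ^^ Suc j) y" for j by (simp add: funpow_swap1)
    have "(\<forall>m. \<exists>j\<ge>m. (T ^^ Suc j) y \<in> A) \<longleftrightarrow> (\<forall>m. \<exists>j\<ge>m. (T ^^ j) y \<in> A)"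
    proof safe
      fix m assume "\<forall>m. \<exists>j\<ge>m. (T ^^ Suc j) y \<in> A"
      then obtain j where "j \<ge> m" "(T ^^ Suc j) y \<in> A" by blast
      then show "\<exists>j\<ge>m. (T ^^ j) y \<in> A" by (intro exI[of _ "Suc j"]) auto
    next
      fix m assume "\<forall>m. \<exists>j\<ge>m. (T ^^ j) y \<in> A"
      then obtain j where "j \<ge> Suc m" "(T ^^ j) y \<in> A" by blast
      then show "\<exists>j\<ge>m. (T ^^ Suc j) y \<in> A" by (intro exI[of _ "j - 1"]) (cases j, auto)
    qed
    then show ?thesis using y Ty unfolding S_def mem_Collect_eq eq by blast
  qed
  have S_AE: "AE x in M. x \<in> S \<longleftrightarrow> x \<in> A"
    if TM: "T \<in> measurable M M" "distr M M T = M" and M: "AE x in M. T x \<in> A \<longleftrightarrow> x \<in> A" "space M = space X" for M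
  proof -
    have "AE x in M. \<forall>n. T ((T ^^ n) x) \<in> A \<longleftrightarrow> (T ^^ n) x \<in> A"
      unfolding AE_all_countable using AE_invariant_funpow[OF TM M(1)] by blast
    then show ?thesis using AE_space
    proof eventually_elim
      case (elim x)
      have "(T ^^ n) x \<in> A \<longleftrightarrow> x \<in> A" for n using elim by (induction n) auto
      then show ?case using elim(2) M(2) unfolding S_def by auto
    qed
  qed
  have S\<mu>: "AE x in \<mu>. x \<in> S \<longleftrightarrow> x \<in> A"
    by (rule S_AE[OF T\<mu> \<mu>(4) inv_AE[OF null_transfer(1)[OF nullD] nullD'(1) sp(1)] sp(1)])
  have S\<nu>: "AE x in \<nu>. x \<in> S \<longleftrightarrow> x \<in> A"
    by (rule S_AE[OF T\<nu> \<nu>(4) inv_AE[OF null_transfer(2)[OF nullD] nullD'(2) sp(2)] sp(2)])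
  \<comment> \<open>Either \<open>A\<close> is \<open>\<mu>\<close>-null, and \<mu> \<le> \<nu> off
    \<open>A\<close> extends to all sets, or \<open>A\<close> has full \<open>\<nu>\<close>-measure,
    and \<nu> \<le> \<mu> does.\<close>
  from ergodic[OF S S_inv] show ?thesis
  proof
    assume null: "S \<in> null_sets X"
    have n: "AE x in \<mu>. x \<notin> A"
      using S\<mu> AE_not_in[OF null_transfer(1)[OF null]] by eventually_elim simp
    show ?thesis
    proof (rule prob_space_eqI_le[OF \<mu>(1) \<nu>(1)])
      fix B assume B: "B \<in> sets \<mu>"
      have "emeasure \<mu> B = emeasure \<mu> (B - A)"
        using n B A \<mu>(2) by (intro emeasure_eq_AE) auto
      also have "\<dots> \<le> emeasure \<nu> (B - A)" using B \<mu>(2) by (intro out_A) auto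
      also have "\<dots> \<le> emeasure \<nu> B" using B \<mu>(2) \<nu>(2) by (intro emeasure_mono) auto
      finally show "emeasure \<mu> B \<le> emeasure \<nu> B" .
    qed (use \<mu> \<nu> in simp)
  next
    assume null: "space X - S \<in> null_sets X"
    have n: "AE x in \<nu>. x \<in> A"
      using S\<nu> AE_not_in[OF null_transfer(2)[OF null]] AE_space[of \<nu>]
      by eventually_elim (simp add: sp)
    have "\<nu> = \<mu>"
    proof (rule prob_space_eqI_le[OF \<nu>(1) \<mu>(1)])
      fix B assume B: "B \<in> sets \<nu>"
      have "emeasure \<nu> B = emeasure \<nu> (B \<inter> A)"
        using n B A \<nu>(2) by (intro emeasure_eq_AE) auto
      also have "\<dots> \<le> emeasure \<mu> (B \<inter> A)" using B \<nu>(2) by (intro in_A) auto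
      also have "\<dots> \<le> emeasure \<mu> B" using B \<mu>(2) \<nu>(2) by (intro emeasure_mono) auto
      finally show "emeasure \<nu> B \<le> emeasure \<mu> B" .
    qed (use \<mu> \<nu> in simp)
    then show ?thesis by simp
  qed
qed

text \<open>The suspension of \<open>M\<close> with roof function \<open>r\<close>, projected to the
  base: the sum over j of the images under \<open>T ^^ j\<close> of \<open>M\<close> restricted to
  {r > j}, scaled by \<open>c\<close>.\<close>

definition tower :: "'a measure \<Rightarrow> ('a \<Rightarrow> 'a) \<Rightarrow> ('a \<Rightarrow> nat) \<Rightarrow> ennreal \<Rightarrow> 'a measure" where
  "tower M T r c = measure_of (space M) (sets M)
     (\<lambda>A. c * (\<integral>\<^sup>+y. (\<Sum>j<r y. indicator A ((T ^^ j) y)) \<partial>M))"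

lemma sets_tower [simp]: "sets (tower M T r c) = sets M"
  by (simp add: tower_def)

lemma tower_sum_measurable:
  assumes "T \<in> measurable M M" "r \<in> measurable M (count_space UNIV)" "A \<in> sets M"
  shows "(\<lambda>y. \<Sum>j<r y. indicator A ((T ^^ j) y) :: ennreal) \<in> borel_measurable M"
proof (rule measurable_compose_countable[OF _ assms(2)])
  fix n
  have [measurable]: "(T ^^ j) \<in> measurable M M" for j by (rule funpow_measurable[OF assms(1)])
  have [measurable]: "A \<in> sets M" by fact
  show "(\<lambda>y. \<Sum>j<n. indicator A ((T ^^ j) y) :: ennreal) \<in> borel_measurable M" by measurable
qed

text \<open>\<open>measure_of\<close> takes the prescribed values only if these are countably
  additive. They are, because a countable sum commutes with the finite inner sum and with the
  integral.\<close>

lemma emeasure_tower: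
  assumes T: "T \<in> measurable M M" and r: "r \<in> measurable M (count_space UNIV)" and A: "A \<in> sets M"
  shows "emeasure (tower M T r c) A = c * (\<integral>\<^sup>+y. (\<Sum>j<r y. indicator A ((T ^^ j) y)) \<partial>M)"
proof (rule emeasure_measure_of[OF tower_def[of M T r c]])
  show "sets M \<subseteq> Pow (space M)" by (rule sets.space_closed)
  show "A \<in> sets (tower M T r c)" using A by simp
  show "positive (sets (tower M T r c)) (\<lambda>A. c * (\<integral>\<^sup>+y. (\<Sum>j<r y. indicator A ((T ^^ j) y)) \<partial>M))"
    by (simp add: positive_def)
  show "countably_additive (sets (tower M T r c)) (\<lambda>A. c * (\<integral>\<^sup>+y. (\<Sum>j<r y. indicator A ((T ^^ j) y)) \<partial>M))"
  proof (rule countably_additiveI)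
    fix B :: "nat \<Rightarrow> 'a set"
    assume B: "range B \<subseteq> sets (tower M T r c)" "disjoint_family B"
    have Bi: "B i \<in> sets M" for i using B(1) by auto
    have "(\<Sum>i. c * (\<integral>\<^sup>+y. (\<Sum>j<r y. indicator (B i) ((T ^^ j) y)) \<partial>M)) =
        c * (\<integral>\<^sup>+y. (\<Sum>i. \<Sum>j<r y. indicator (B i) ((T ^^ j) y)) \<partial>M)"
      by (simp add: nn_integral_suminf[OF tower_sum_measurable[OF T r Bi]])
    also have "(\<lambda>y. \<Sum>i. \<Sum>j<r y. indicator (B i) ((T ^^ j) y) :: ennreal) =
        (\<lambda>y. \<Sum>j<r y. indicator (\<Union>i. B i) ((T ^^ j) y))"
      by (rule ext, subst suminf_sum) (auto simp: suminf_indicator[OF B(2)])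
    finally show "(\<Sum>i. c * (\<integral>\<^sup>+y. (\<Sum>j<r y. indicator (B i) ((T ^^ j) y)) \<partial>M)) =
        c * (\<integral>\<^sup>+y. (\<Sum>j<r y. indicator (\<Union>i. B i) ((T ^^ j) y)) \<partial>M)" .
  qed
qed

text \<open>\<open>G\<close> is the map \<open>T\<^sup>r\<close>; summing an invariant measure of \<open>G\<close> along the \<open>T\<close>-orbit up to time \<open>r\<close>
  telescopes to an invariant measure of \<open>T\<close>.\<close>

lemma tower_invariant:
  assumes T: "T \<in> measurable M M" and r: "r \<in> measurable M (count_space UNIV)"
    and G: "G \<in> measurable M M" "distr M M G = M" and GT: "AE y in M. G y = (T ^^ r y) y"
    and M: "finite_measure M"
  shows "distr (tower M T r c) (tower M T r c) T = tower M T r c"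
proof (rule measure_eqI)
  interpret finite_measure M by fact
  fix A assume "A \<in> sets (distr (tower M T r c) (tower M T r c) T)"
  then have A: "A \<in> sets M" by simp
  let ?A' = "T -` A \<inter> space M"
  have A': "?A' \<in> sets M" using measurable_sets[OF T A] .
  have sp: "space (tower M T r c) = space M" by (rule sets_eq_imp_space_eq) simp
  let ?S = "\<lambda>y. \<Sum>j<r y. indicator A ((T ^^ j) y) :: ennreal"
  let ?S' = "\<lambda>y. \<Sum>j<r y. indicator ?A' ((T ^^ j) y) :: ennreal"
  have "AE y in M. ?S' y + indicator A y = ?S y + indicator (G -` A \<inter> space M) y"
    using GT AE_space
  proof eventually_elim
    case (elim y)
    have Tj: "(T ^^ j) y \<in> space M" for j
      using measurable_space[OF funpow_measurable[OF T] elim(2)] .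
    have "?S' y = (\<Sum>j<r y. indicator A ((T ^^ Suc j) y))"
      using Tj by (intro sum.cong) (auto split: split_indicator)
    then have "?S' y + indicator A y = (\<Sum>j<Suc (r y). indicator A ((T ^^ j) y))"
      by (subst sum.lessThan_Suc_shift) (simp add: add.commute)
    also have "\<dots> = ?S y + indicator A ((T ^^ r y) y)" by (rule sum.lessThan_Suc)
    also have "indicator A ((T ^^ r y) y) = (indicator (G -` A \<inter> space M) y :: ennreal)"
      using elim by (auto split: split_indicator)
    finally show ?case .
  qed
  then have "(\<integral>\<^sup>+y. ?S' y + indicator A y \<partial>M) = (\<integral>\<^sup>+y. ?S y + indicator (G -` A \<inter> space M) y \<partial>M)"
    by (rule nn_integral_cong_AE)
  then have "(\<integral>\<^sup>+y. ?S' y \<partial>M) + emeasure M A = (\<integral>\<^sup>+y. ?S y \<partial>M) + emeasure M (G -` A \<inter> space M)"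
    using A measurable_sets[OF G(1) A]
    by (simp add: nn_integral_add tower_sum_measurable[OF T r A] tower_sum_measurable[OF T r A'])
  also have "emeasure M (G -` A \<inter> space M) = emeasure M A"
    using emeasure_distr[OF G(1) A] G(2) by simp
  finally have "(\<integral>\<^sup>+y. ?S' y \<partial>M) = (\<integral>\<^sup>+y. ?S y \<partial>M)"
    \<comment> \<open>The summand cancelled here is finite since \<open>M\<close> is; the two
      integrals that remain may be infinite.\<close>
    by (simp add: emeasure_eq_measure ennreal_add_left_cancel add.commute[of _ "ennreal _"])
  then show "emeasure (distr (tower M T r c) (tower M T r c) T) A = emeasure (tower M T r c) A"
    using A A' T by (subst emeasure_distr) (simp_all add: sp emeasure_tower[OF T r] cong: measurable_cong_sets)
qed simp

section \<open>Maps with concave full branches\<close>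

text \<open>Chord slopes decrease to the right. The inequality is multiplied out, so that it covers
  degenerate intervals, avoids derivatives and passes to compositions. The domain is the whole
  half-line because branches are compared with their continuations beyond
  \<open>[l, 1]\<close>.\<close>

definition concave_incr :: "(real \<Rightarrow> real) \<Rightarrow> bool" where
  "concave_incr g \<longleftrightarrow>
     (\<forall>x>0. 0 < g x) \<and> (\<forall>x y. 0 < x \<longrightarrow> x < y \<longrightarrow> g x < g y) \<and>
     (\<forall>x y u v. 0 < x \<longrightarrow> x \<le> y \<longrightarrow> y \<le> u \<longrightarrow> u \<le> v \<longrightarrow>
        (g v - g u) * (y - x) \<le> (g y - g x) * (v - u))"

lemma concave_incrI:
  assumes "\<And>x. 0 < x \<Longrightarrow> 0 < g x" and "\<And>x y. 0 < x \<Longrightarrow> x < y \<Longrightarrow> g x < g y"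
    and "\<And>x y u v. 0 < x \<Longrightarrow> x \<le> y \<Longrightarrow> y \<le> u \<Longrightarrow> u \<le> v \<Longrightarrow>
           (g v - g u) * (y - x) \<le> (g y - g x) * (v - u)"
  shows "concave_incr g"
  using assms unfolding concave_incr_def by blast

lemma concave_incr_pos: "concave_incr g \<Longrightarrow> 0 < x \<Longrightarrow> 0 < g x"
  and concave_incr_less: "concave_incr g \<Longrightarrow> 0 < x \<Longrightarrow> x < y \<Longrightarrow> g x < g y"
  and concave_incr_slope: "concave_incr g \<Longrightarrow> 0 < x \<Longrightarrow> x \<le> y \<Longrightarrow> y \<le> u \<Longrightarrow> u \<le> v \<Longrightarrow>
        (g v - g u) * (y - x) \<le> (g y - g x) * (v - u)"
  unfolding concave_incr_def by blast+

lemma concave_incr_le: "concave_incr g \<Longrightarrow> 0 < x \<Longrightarrow> x \<le> y \<Longrightarrow> g x \<le> g y"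
  using concave_incr_less[of g x y] by (cases "x = y") auto

lemma concave_incr_less_iff: "concave_incr g \<Longrightarrow> 0 < x \<Longrightarrow> 0 < y \<Longrightarrow> g x < g y \<longleftrightarrow> x < y"
  by (meson concave_incr_le concave_incr_less not_less)

lemma concave_incr_le_iff: "concave_incr g \<Longrightarrow> 0 < x \<Longrightarrow> 0 < y \<Longrightarrow> g x \<le> g y \<longleftrightarrow> x \<le> y"
  by (meson concave_incr_less_iff not_less)

lemma concave_incr_id: "concave_incr id"
  by (rule concave_incrI) (auto simp: mult.commute)

text \<open>A chord slope of \<open>g \<circ> h\<close> is a slope of \<open>g\<close> times a slope
  of \<open>h\<close>, and both factors decrease. The case \<open>x = y\<close> is split off because
  \<open>h y - h x\<close> has to be cancelled.\<close>

lemma concave_incr_comp: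
  assumes g: "concave_incr g" and h: "concave_incr h"
  shows "concave_incr (g \<circ> h)"
proof (rule concave_incrI)
  fix x :: real assume "0 < x"
  then show "0 < (g \<circ> h) x" using g h by (simp add: concave_incr_pos)
next
  fix x y :: real assume "0 < x" "x < y"
  then show "(g \<circ> h) x < (g \<circ> h) y"
    using g h by (simp add: concave_incr_pos concave_incr_less)
next
  fix x y u v :: real assume *: "0 < x" "x \<le> y" "y \<le> u" "u \<le> v"
  show "((g \<circ> h) v - (g \<circ> h) u) * (y - x) \<le> ((g \<circ> h) y - (g \<circ> h) x) * (v - u)"
  proof (cases "x = y")
    case False
    with * have lt: "x < y" by simp
    let ?H = "h y - h x"
    have Hpos: "0 < ?H" using concave_incr_less[OF h] * lt by simp
    have le: "h x \<le> h y" "h y \<le> h u" "h u \<le> h v" "0 < h x"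
      using concave_incr_le[OF h] concave_incr_pos[OF h] * by auto
    have 1: "(g (h v) - g (h u)) * ?H \<le> (g (h y) - g (h x)) * (h v - h u)"
      by (rule concave_incr_slope[OF g]) (use le in auto)
    have 2: "(h v - h u) * (y - x) \<le> ?H * (v - u)"
      by (rule concave_incr_slope[OF h]) (use * in auto)
    have gle: "g (h x) \<le> g (h y)" using concave_incr_le[OF g] le by auto
    have "(g (h v) - g (h u)) * (y - x) * ?H \<le> (g (h y) - g (h x)) * (h v - h u) * (y - x)"
      using mult_right_mono[OF 1, of "y - x"] lt by (simp add: mult_ac)
    also have "\<dots> \<le> (g (h y) - g (h x)) * (?H * (v - u))"
      using mult_left_mono[OF 2, of "g (h y) - g (h x)"] gle by (simp add: mult_ac)
    finally have "((g (h v) - g (h u)) * (y - x)) * ?H \<le> ((g (h y) - g (h x)) * (v - u)) * ?H"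
      by (simp add: mult_ac)
    then show ?thesis using Hpos by simp
  qed simp
qed

lemma ennreal_less_add_pos: "x < \<infinity> \<Longrightarrow> 0 < e \<Longrightarrow> x < x + ennreal e"
  by (cases x) (auto simp: ennreal_less_iff simp flip: ennreal_plus)

lemma image_atLeastLessThan_mono:
  fixes f :: "real \<Rightarrow> real"
  assumes "continuous_on {a..b} f" and mono: "\<And>x y. a \<le> x \<Longrightarrow> x < y \<Longrightarrow> y \<le> b \<Longrightarrow> f x < f y"
    and "a \<le> b"
  shows "f ` {a..<b} = {f a..<f b}"
proof
  have "f a \<le> f x" if "a \<le> x" "x \<le> b" for x
    using mono[of a x] that by (cases "a = x") auto
  then show "f ` {a..<b} \<subseteq> {f a..<f b}"
    using mono by auto
  show "{f a..<f b} \<subseteq> f ` {a..<b}"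
  proof
    fix y assume y: "y \<in> {f a..<f b}"
    then obtain x where "a \<le> x" "x \<le> b" "f x = y"
      using IVT'[of f a y b] assms by auto
    then show "y \<in> f ` {a..<b}" using y by (cases "x = b") auto
  qed
qed

text \<open>
  The branch \<open>sc i\<close> is the left neighbour of branch \<open>i\<close>: the concave continuation of \<open>g i\<close>
  to the left of \<open>l\<close> maps \<open>[m, l)\<close> onto the interval of branch \<open>sc i\<close>.
\<close>

locale concave_branches =
  fixes l m q :: real and I :: "'i set" and g :: "'i \<Rightarrow> real \<Rightarrow> real"
    and sc :: "'i \<Rightarrow> 'i" and G :: "real \<Rightarrow> real"
  assumes m_pos: "0 < m" and m_less: "m < l" and l_less: "l < 1"
    and q_nonneg: "0 \<le> q" and q_less: "q < 1"
    and countable_I: "countable I"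
    and branch: "i \<in> I \<Longrightarrow> concave_incr (g i)"
    and contr: "i \<in> I \<Longrightarrow> l \<le> x \<Longrightarrow> x \<le> y \<Longrightarrow> y \<le> 1 \<Longrightarrow> g i y - g i x \<le> q * (y - x)"
    and range_l: "i \<in> I \<Longrightarrow> l \<le> g i l" and range_1: "i \<in> I \<Longrightarrow> g i 1 \<le> 1"
    and disj: "i \<in> I \<Longrightarrow> j \<in> I \<Longrightarrow> i \<noteq> j \<Longrightarrow> g i ` {l..<1} \<inter> g j ` {l..<1} = {}"
    and G_g: "i \<in> I \<Longrightarrow> l \<le> x \<Longrightarrow> x < 1 \<Longrightarrow> G (g i x) = x"
    and cover: "countable ({l..<1} - (\<Union>i\<in>I. g i ` {l..<1}))"
    and sc_inj: "inj_on sc I" and sc_I: "i \<in> I \<Longrightarrow> sc i \<in> I"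
    and sc_m: "i \<in> I \<Longrightarrow> g i m = g (sc i) l" and sc_l: "i \<in> I \<Longrightarrow> g i l = g (sc i) 1"
    and small: "l < v \<Longrightarrow> \<exists>i\<in>I. g i 1 \<le> v"
    and G_meas: "G \<in> measurable (restrict_space borel {l..1}) (restrict_space borel {l..1})"
begin

section \<open>Words, iterated inverse branches and cylinders\<close>

lemma l_pos: "0 < l" using m_pos m_less by simp

text \<open>The inverse branch of \<open>G ^^ n\<close> along a word of length n. The head is
  applied last, so \<open>G\<close> strips the head.\<close>

fun gw :: "'i list \<Rightarrow> real \<Rightarrow> real" where
  "gw [] = id"
| "gw (i # w) = g i \<circ> gw w"

definition words :: "nat \<Rightarrow> 'i list set" where
  "words n = {w. length w = n \<and> set w \<subseteq> I}"

definition cyl :: "'i list \<Rightarrow> real set" where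
  "cyl w = gw w ` {l..<1}"

lemma words_0: "words 0 = {[]}" by (auto simp: words_def)

lemma words_Suc: "words (Suc n) = {i # w |i w. i \<in> I \<and> w \<in> words n}"
  by (auto simp: words_def length_Suc_conv)

lemma countable_words: "countable (words n)"
proof (rule countable_subset)
  show "words n \<subseteq> lists I" by (auto simp: words_def)
  show "countable (lists I)" using countable_I by (rule countable_lists)
qed

lemma words_induct [consumes 1, case_names Nil Cons]:
  assumes "w \<in> words n" and "P 0 []"
    and "\<And>n i w. i \<in> I \<Longrightarrow> w \<in> words n \<Longrightarrow> P n w \<Longrightarrow> P (Suc n) (i # w)"
  shows "P n w"
  using assms(1)
proof (induction n arbitrary: w)
  case 0 then show ?case using assms(2) by (simp add: words_0)
next
  case (Suc n) then show ?case using assms(3) by (auto simp: words_Suc)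
qed

lemma gw_branch: "w \<in> words n \<Longrightarrow> concave_incr (gw w)"
proof (induction rule: words_induct)
  case Nil then show ?case using concave_incr_id by (simp only: gw.simps)
next
  case (Cons n i w) then show ?case by (simp only: gw.simps) (rule concave_incr_comp[OF branch])
qed

lemma g_range: "i \<in> I \<Longrightarrow> l \<le> x \<Longrightarrow> x \<le> 1 \<Longrightarrow> l \<le> g i x \<and> g i x \<le> 1"
  using concave_incr_le[OF branch, of i l x] concave_incr_le[OF branch, of i x 1] range_l[of i] range_1[of i] l_pos
  by auto

lemma g_range_less: "i \<in> I \<Longrightarrow> l \<le> x \<Longrightarrow> x < 1 \<Longrightarrow> g i x < 1"
  using concave_incr_less[OF branch, of i x 1] range_1[of i] l_pos by auto

lemma gw_range: "w \<in> words n \<Longrightarrow> l \<le> x \<Longrightarrow> x \<le> 1 \<Longrightarrow> l \<le> gw w x \<and> gw w x \<le> 1"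
  by (induction rule: words_induct) (auto simp: g_range)

lemma gw_range_less: "w \<in> words n \<Longrightarrow> l \<le> x \<Longrightarrow> x < 1 \<Longrightarrow> gw w x < 1"
  by (induction rule: words_induct) (auto simp: g_range_less gw_range less_imp_le)

lemma gw_contr:
  assumes "w \<in> words n" "l \<le> x" "x \<le> y" "y \<le> 1"
  shows "gw w y - gw w x \<le> q ^ n * (y - x)"
  using assms
proof (induction rule: words_induct)
  case (Cons n i w)
  have "gw w x \<le> gw w y"
    using concave_incr_le[OF gw_branch[OF Cons.hyps(2)], of x y] Cons.prems l_pos by auto
  then have "g i (gw w y) - g i (gw w x) \<le> q * (gw w y - gw w x)"
    using contr[OF Cons.hyps(1)] gw_range[OF Cons.hyps(2)] Cons.prems by auto
  also have "\<dots> \<le> q * (q ^ n * (y - x))"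
    using Cons.IH Cons.prems q_nonneg by (intro mult_left_mono) auto
  finally show ?case by simp
qed simp

lemma gw_less: "w \<in> words n \<Longrightarrow> l \<le> x \<Longrightarrow> x < y \<Longrightarrow> gw w x < gw w y"
  using concave_incr_less[OF gw_branch] l_pos by auto

lemma gw_le: "w \<in> words n \<Longrightarrow> l \<le> x \<Longrightarrow> x \<le> y \<Longrightarrow> gw w x \<le> gw w y"
  using concave_incr_le[OF gw_branch] l_pos by auto

lemma gw_cont: assumes "w \<in> words n" shows "continuous_on {l..1} (gw w)"
proof -
  have "1-lipschitz_on {l..1} (gw w)"
  proof (rule lipschitz_onI)
    have *: "dist (gw w x) (gw w y) \<le> 1 * dist x y" if "l \<le> x" "x \<le> y" "y \<le> 1" for x y
    proof -
      have "gw w y - gw w x \<le> q ^ n * (y - x)" using gw_contr[OF assms] that by auto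
      also have "\<dots> \<le> 1 * (y - x)"
        using q_nonneg q_less that by (intro mult_right_mono power_le_one) auto
      finally show ?thesis using gw_le[OF assms, of x y] that by (auto simp: dist_real_def)
    qed
    fix x y assume "x \<in> {l..1}" "y \<in> {l..1}"
    then show "dist (gw w x) (gw w y) \<le> 1 * dist x y"
      using *[of x y] *[of y x] by (cases "x \<le> y") (auto simp: dist_commute)
  qed simp
  then show ?thesis by (rule lipschitz_on_continuous_on)
qed

lemma gw_image:
  assumes "w \<in> words n" "l \<le> c" "c \<le> d" "d \<le> 1"
  shows "gw w ` {c..<d} = {gw w c..<gw w d}"
proof (rule image_atLeastLessThan_mono)
  show "continuous_on {c..d} (gw w)"
    by (rule continuous_on_subset[OF gw_cont[OF assms(1)]]) (use assms in auto)
qed (use assms gw_less[OF assms(1)] in auto)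

lemma cyl_eq: "w \<in> words n \<Longrightarrow> cyl w = {gw w l..<gw w 1}"
  using gw_image[of w n l 1] l_less by (simp add: cyl_def)

lemma cyl_subset: "w \<in> words n \<Longrightarrow> cyl w \<subseteq> {l..<1}"
  using gw_range gw_range_less by (fastforce simp: cyl_def)

lemma emeasure_cyl: "w \<in> words n \<Longrightarrow> emeasure lborel (cyl w) = ennreal (gw w 1 - gw w l)"
  using gw_le[of w n l 1] l_less by (simp add: cyl_eq)

lemma G_gw: "w \<in> words n \<Longrightarrow> l \<le> x \<Longrightarrow> x < 1 \<Longrightarrow> (G ^^ n) (gw w x) = x"
proof (induction rule: words_induct)
  case (Cons n i w)
  have "G (g i (gw w x)) = gw w x"
    using G_g[OF Cons.hyps(1)] gw_range[OF Cons.hyps(2)] gw_range_less[OF Cons.hyps(2)] Cons.prems by auto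
  then show ?case using Cons by (simp add: funpow_swap1)
qed simp

lemma cyl_disj:
  assumes "w \<in> words n" "w' \<in> words n" "w \<noteq> w'" shows "cyl w \<inter> cyl w' = {}"
  using assms
proof (induction arbitrary: w' rule: words_induct)
  case Nil then show ?case by (simp add: words_0)
next
  case (Cons n i w)
  then obtain j v where v: "w' = j # v" "j \<in> I" "v \<in> words n" by (auto simp: words_Suc)
  have sub: "cyl (k # u) = g k ` cyl u" for k u by (simp add: cyl_def image_comp)
  show ?case
  proof (cases "i = j")
    case True
    with Cons v have "cyl w \<inter> cyl v = {}" by auto
    moreover have "inj_on (g i) {l..<1}"
      using concave_incr_less[OF branch[OF Cons.hyps(1)]] l_pos
      by (intro linorder_inj_onI') (auto, metis less_irrefl less_le_trans)
    ultimately show ?thesis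
      using inj_on_image_Int[of "g i" "{l..<1}" "cyl w" "cyl v"] cyl_subset[OF Cons.hyps(2)] cyl_subset[OF v(3)]
        True v sub by simp
  next
    case False
    then have "g i ` {l..<1} \<inter> g j ` {l..<1} = {}" using disj Cons.hyps v by auto
    moreover have "cyl (i # w) \<subseteq> g i ` {l..<1}" "cyl (j # v) \<subseteq> g j ` {l..<1}"
      using cyl_subset[OF Cons.hyps(2)] cyl_subset[OF v(3)] by (auto simp: sub)
    ultimately show ?thesis using v by blast
  qed
qed

definition core :: "nat \<Rightarrow> real set" where "core n = (\<Union>w\<in>words n. cyl w)"

text \<open>Exceptional sets are kept countable rather than merely null: countability passes to
  images under the branches without an argument about null sets.\<close>

lemma countable_core: "countable ({l..<1} - core n)"
proof (induction n)
  case 0 then show ?case by (simp add: core_def words_0 cyl_def)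
next
  case (Suc n)
  have "{l..<1} - core (Suc n) \<subseteq>
     ({l..<1} - (\<Union>i\<in>I. g i ` {l..<1})) \<union> (\<Union>i\<in>I. g i ` ({l..<1} - core n))"
  proof
    fix y assume y: "y \<in> {l..<1} - core (Suc n)"
    show "y \<in> ({l..<1} - (\<Union>i\<in>I. g i ` {l..<1})) \<union> (\<Union>i\<in>I. g i ` ({l..<1} - core n))"
    proof (cases "\<exists>i\<in>I. \<exists>x\<in>{l..<1}. y = g i x")
      case True
      then obtain i x where i: "i \<in> I" "x \<in> {l..<1}" "y = g i x" by blast
      have "x \<notin> core n"
      proof
        assume "x \<in> core n"
        then obtain w z where w: "w \<in> words n" "z \<in> {l..<1}" "x = gw w z"
          by (auto simp: core_def cyl_def)
        have "y = gw (i # w) z" using i w by simp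
        then have "y \<in> core (Suc n)"
          unfolding core_def cyl_def words_Suc using i w by blast
        then show False using y by simp
      qed
      then have "x \<in> {l..<1} - core n" using i by simp
      then have "y \<in> (\<Union>i\<in>I. g i ` ({l..<1} - core n))" using i(1,3) by (intro UN_I[OF i(1)]) simp
      then show ?thesis by simp
    qed (use y in auto)
  qed
  moreover have "countable \<dots>" using cover Suc.IH countable_I by auto
  ultimately show ?case by (rule countable_subset)
qed

lemma cyl_borel [measurable]: "w \<in> words n \<Longrightarrow> cyl w \<in> sets borel"
  by (simp add: cyl_eq)

lemma cyl_union_borel: "W \<subseteq> words n \<Longrightarrow> (\<Union>w\<in>W. cyl w) \<in> sets borel"
  using countable_words[of n] by (intro sets.countable_UN') (auto intro: countable_subset cyl_borel)

lemma emeasure_cyl_union: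
  assumes "W \<subseteq> words n" "sets M = sets borel" "A \<in> sets borel"
  shows "emeasure M ((\<Union>w\<in>W. cyl w) \<inter> A) = (\<integral>\<^sup>+w. emeasure M (cyl w \<inter> A) \<partial>count_space W)"
proof -
  have "emeasure M (\<Union>w\<in>W. cyl w \<inter> A) = (\<integral>\<^sup>+w. emeasure M (cyl w \<inter> A) \<partial>count_space W)"
  proof (rule emeasure_UN_countable)
    show "disjoint_family_on (\<lambda>w. cyl w \<inter> A) W"
      using cyl_disj[of _ n] assms(1) by (fastforce simp: disjoint_family_on_def)
  qed (use assms countable_words[of n] in \<open>auto intro: countable_subset cyl_borel\<close>)
  then show ?thesis by simp
qed

section \<open>Approximation by unions of long cylinders\<close>

lemma inner_compact:
  assumes "B \<in> sets borel" "B \<subseteq> {l..1}" "e > 0"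
  obtains K where "compact K" "K \<subseteq> B" "emeasure lborel (B - K) < ennreal e"
proof -
  have "B \<in> sets lebesgue" using assms(1) by auto
  from sets_lebesgue_inner_closed[OF this assms(3)] obtain T where
    T: "closed T" "T \<subseteq> B" "emeasure lebesgue (B - T) < ennreal e" by metis
  have "compact T" using T assms(2) compact_eq_bounded_closed bounded_subset[OF bounded_closed_interval]
    by (metis cbox_interval bounded_cbox bounded_subset)
  moreover have "emeasure lborel (B - T) < ennreal e"
    using T assms(1) by (simp add: borel_closed sets.Diff)
  ultimately show ?thesis using that T by blast
qed

lemma emeasure_core:
  assumes "A \<in> sets borel" "A \<subseteq> {l..1}"
  shows "core n \<in> sets borel" "emeasure lborel (A \<inter> core n) = emeasure lborel A"
proof -
  show c: "core n \<in> sets borel" unfolding core_def by (rule cyl_union_borel[of _ n]) simp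
  have "countable (A - core n)"
    by (rule countable_subset[of _ "({l..<1} - core n) \<union> {1}"]) (use assms countable_core in auto)
  then have "A - core n \<in> null_sets lborel"
    by (rule countable_imp_null_set_lborel)
  then have "emeasure lborel ((A \<inter> core n) \<union> (A - core n)) = emeasure lborel (A \<inter> core n)"
    using assms c by (intro emeasure_Un_null_set) auto
  then show "emeasure lborel (A \<inter> core n) = emeasure lborel A"
    by (simp add: Int_Diff_Un)
qed


text \<open>Take a compact \<open>K\<close> in \<open>B\<close> of almost full measure and all
  cylinders of level n that meet it. Their length is at most \<open>q ^ n\<close>, so they stay in
  \<open>U\<close> as soon as this is below the distance from \<open>K\<close> to the complement of
  \<open>U\<close>, and only \<open>B - K\<close> and a null set are lost. The family
  \<open>W\<close> does not depend on \<open>S\<close>, so \<open>S\<close> may later vary with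
  n.\<close>

lemma approx_by_cyl:
  assumes B: "B \<in> sets borel" "B \<subseteq> {l..1}" and U: "open U" "B \<subseteq> U" and e: "e > 0"
  obtains W n0 where "\<And>n. W n \<subseteq> words n" "\<And>n. n \<ge> n0 \<Longrightarrow> (\<Union>w\<in>W n. cyl w) \<subseteq> U"
    "\<And>n S. S \<in> sets borel \<Longrightarrow>
      emeasure lborel (B \<inter> S) \<le> emeasure lborel ((\<Union>w\<in>W n. cyl w) \<inter> S) + ennreal e"
proof -
  obtain K where K: "compact K" "K \<subseteq> B" "emeasure lborel (B - K) < ennreal e"
    by (rule inner_compact[OF B e])
  have Kb: "K \<in> sets borel" using K by (auto intro: compact_imp_closed borel_closed)
  obtain d where d: "d > 0" "\<And>x y. x \<in> K \<Longrightarrow> y \<in> - U \<Longrightarrow> d \<le> dist x y"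
    using separate_compact_closed[OF K(1), of "- U"] U order_trans[OF K(2) U(2)]
    by (auto simp: closed_Compl disjoint_eq_subset_Compl)
  obtain n0 where n0: "q ^ n0 < d" using real_arch_pow_inv[OF d(1) q_less] by auto
  define W where "W n = {w \<in> words n. cyl w \<inter> K \<noteq> {}}" for n
  have W: "W n \<subseteq> words n" for n by (auto simp: W_def)
  have "(\<Union>w\<in>W n. cyl w) \<subseteq> U" if "n \<ge> n0" for n
  proof
    have n: "q ^ n < d" using n0 power_decreasing[OF that, of q] q_nonneg q_less by auto
    fix y assume "y \<in> (\<Union>w\<in>W n. cyl w)"
    then obtain w z where w: "w \<in> words n" and y: "y \<in> cyl w" and z: "z \<in> cyl w" "z \<in> K"
      by (auto simp: W_def)
    have "gw w 1 - gw w l \<le> q ^ n * (1 - l)" using gw_contr[OF w, of l 1] l_less by auto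
    also have "\<dots> \<le> q ^ n * 1" using q_nonneg l_pos by (intro mult_left_mono) auto
    finally have "dist z y < d" using y z n by (auto simp: cyl_eq[OF w] dist_real_def)
    then show "y \<in> U" using d(2)[OF z(2), of y] by force
  qed
  moreover have "emeasure lborel (B \<inter> S) \<le> emeasure lborel ((\<Union>w\<in>W n. cyl w) \<inter> S) + ennreal e"
    if S: "S \<in> sets borel" for n S
  proof -
    let ?V = "\<Union>w\<in>W n. cyl w"
    have V: "?V \<in> sets borel" by (rule cyl_union_borel[OF W])
    have "emeasure lborel (B \<inter> S) = emeasure lborel ((B \<inter> S) \<inter> core n)"
      by (rule emeasure_core(2)[symmetric]) (use B S in auto)
    also have "\<dots> \<le> emeasure lborel ((?V \<inter> S) \<union> (B - K))"
      using B S V Kb by (intro emeasure_mono) (auto simp: W_def core_def)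
    also have "\<dots> \<le> emeasure lborel (?V \<inter> S) + emeasure lborel (B - K)"
      using B S V Kb by (intro emeasure_subadditive) auto
    also have "\<dots> \<le> emeasure lborel (?V \<inter> S) + ennreal e"
      using K by (intro add_left_mono) auto
    finally show ?thesis .
  qed
  ultimately show thesis using that[of W n0] W by blast
qed

text \<open>Outer regularity of \<open>N\<close> provides an open \<open>U\<close> around
  \<open>B\<close> of nearly the same \<open>N\<close>-mass; long cylinders inside \<open>U\<close>
  cover \<open>B\<close> up to a small Lebesgue measure.\<close>

lemma cyl_lower_imp_lower:
  assumes N: "finite_measure N" "sets N = sets borel"
    and le: "\<And>n w. w \<in> words n \<Longrightarrow> ennreal k * emeasure lborel (cyl w) \<le> emeasure N (cyl w)"
    and B: "B \<in> sets borel" "B \<subseteq> {l..1}"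
  shows "ennreal k * emeasure lborel B \<le> emeasure N B"
proof (cases "k > 0")
  case False
  then show ?thesis by (simp add: ennreal_neg)
next
  case True
  interpret finite_measure N by fact
  show ?thesis
  proof (rule ennreal_le_epsilon)
    fix e :: real assume e: "e > 0"
    have "emeasure N B < emeasure N B + ennreal (e / 2)"
      using e by (intro ennreal_less_add_pos) (auto simp: emeasure_eq_measure)
    then obtain U where U: "open U" "B \<subseteq> U" "emeasure N U < emeasure N B + ennreal (e / 2)"
      using outer_regular[of N B] N(2) B(1) emeasure_finite[of "space N"] by (auto simp: INF_less_iff)
    \<comment> \<open>The approximation error is multiplied by \<open>k\<close> at the end and then
      contributes e/2; the other half was spent on outer regularity.\<close>
    have "e / (2 * k) > 0" using e True by simp
    then obtain W n0 where W: "\<And>n. W n \<subseteq> words n" "\<And>n. n \<ge> n0 \<Longrightarrow> (\<Union>w\<in>W n. cyl w) \<subseteq> U"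
      "\<And>n S. S \<in> sets borel \<Longrightarrow>
        emeasure lborel (B \<inter> S) \<le> emeasure lborel ((\<Union>w\<in>W n. cyl w) \<inter> S) + ennreal (e / (2 * k))"
      by (rule approx_by_cyl[OF B U(1,2)]) blast
    let ?V = "\<Union>w\<in>W n0. cyl w"
    have "ennreal k * emeasure lborel ?V = (\<integral>\<^sup>+w. ennreal k * emeasure lborel (cyl w) \<partial>count_space (W n0))"
      using emeasure_cyl_union[OF W(1), of lborel UNIV] by (simp add: nn_integral_cmult)
    also have "\<dots> \<le> (\<integral>\<^sup>+w. emeasure N (cyl w) \<partial>count_space (W n0))"
      using W(1)[of n0] le by (intro nn_integral_mono) auto
    also have "\<dots> = emeasure N ?V"
      using emeasure_cyl_union[OF W(1), of N UNIV] N by simp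
    also have "\<dots> \<le> emeasure N U" using W(2)[of n0] U N by (intro emeasure_mono) auto
    also have "\<dots> \<le> emeasure N B + ennreal (e / 2)" using U by simp
    finally have 1: "ennreal k * emeasure lborel ?V \<le> emeasure N B + ennreal (e / 2)" .
    have "ennreal k * emeasure lborel B \<le> ennreal k * (emeasure lborel ?V + ennreal (e / (2 * k)))"
      using W(3)[of UNIV n0] by (intro mult_left_mono) auto
    also have "\<dots> \<le> (emeasure N B + ennreal (e / 2)) + ennreal k * ennreal (e / (2 * k))"
      unfolding distrib_left using 1 by (rule add_right_mono)
    also have "ennreal k * ennreal (e / (2 * k)) = ennreal (e / 2)"
      using True e by (simp flip: ennreal_mult)
    also have "emeasure N B + ennreal (e / 2) + ennreal (e / 2) = emeasure N B + ennreal e"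
      using e by (simp add: add.assoc flip: ennreal_plus)
    finally show "ennreal k * emeasure lborel B \<le> emeasure N B + ennreal e" .
  qed
qed

abbreviation LY :: "real measure" where "LY \<equiv> restrict_space lborel {l..1}"

lemma sets_LY: "B \<in> sets LY \<longleftrightarrow> B \<in> sets borel \<and> B \<subseteq> {l..1}"
  by (subst sets_restrict_space_iff) auto

lemma emeasure_LY: "B \<subseteq> {l..1} \<Longrightarrow> emeasure LY B = emeasure lborel B"
  by (rule emeasure_restrict_space) auto

text \<open>An integrable density is nearly constant on long cylinders, so a bound for the fraction
  of each cylinder occupied by \<open>S n\<close> carries over to the weighted mass. For indicators
  this is \<open>approx_by_cyl\<close>; sums and monotone limits follow by induction on
  \<open>h\<close>. The threshold depends on \<open>h\<close> and \<open>e\<close>, hence the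
  existential form.\<close>

lemma cyl_upper_imp_density_upper:
  assumes h: "h \<in> borel_measurable LY" and c: "0 \<le> c"
    and S: "\<And>n. S n \<in> sets LY"
    and le: "\<And>n w. w \<in> words n \<Longrightarrow> emeasure lborel (cyl w \<inter> S n) \<le> ennreal c * emeasure lborel (cyl w)"
    and fin: "(\<integral>\<^sup>+x. h x \<partial>LY) < \<infinity>" and e: "e > 0"
  shows "\<exists>N. \<forall>n\<ge>N. (\<integral>\<^sup>+x. h x * indicator (S n) x \<partial>LY) \<le> ennreal c * (\<integral>\<^sup>+x. h x \<partial>LY) + ennreal e"
  using h fin e
proof (induction h arbitrary: e rule: borel_measurable_induct)
  case (cong f g)
  have "(\<integral>\<^sup>+x. f x \<partial>LY) = (\<integral>\<^sup>+x. g x \<partial>LY)"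
    "(\<integral>\<^sup>+x. f x * indicator (S n) x \<partial>LY) = (\<integral>\<^sup>+x. g x * indicator (S n) x \<partial>LY)" for n
    using cong(3) by (auto intro!: nn_integral_cong)
  then show ?case using cong by metis
next
  case (set B)
  then have B: "B \<in> sets borel" "B \<subseteq> {l..1}" by (auto simp: sets_LY)
  \<comment> \<open>The errors are \<open>d\<close> from the approximation and \<open>c * d\<close>
    from \<open>U - B\<close>, together \<open>d * (c + 1) = e / 2\<close>. The summand 1 keeps the
    denominator positive for \<open>c = 0\<close>.\<close>
  define d where "d = e / (2 * (c + 1))"
  have d: "d > 0" using set c by (simp add: d_def)
  obtain U where U: "open U" "B \<subseteq> U" "emeasure lborel (U - B) < ennreal d"
    using outer_regular_lborel[OF B(1) d] by metis
  obtain W N where W: "\<And>n. W n \<subseteq> words n" "\<And>n. n \<ge> N \<Longrightarrow> (\<Union>w\<in>W n. cyl w) \<subseteq> U"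
      "\<And>n S. S \<in> sets borel \<Longrightarrow>
        emeasure lborel (B \<inter> S) \<le> emeasure lborel ((\<Union>w\<in>W n. cyl w) \<inter> S) + ennreal d"
    by (rule approx_by_cyl[OF B U(1,2) d]) blast
  show ?case
  proof (intro exI allI impI)
    fix n assume n: "n \<ge> N"
    let ?V = "\<Union>w\<in>W n. cyl w"
    have Sn: "S n \<in> sets borel" "S n \<subseteq> {l..1}" using S[of n] by (auto simp: sets_LY)
    have "B \<inter> S n \<in> sets LY" using set S by blast
    then have "(\<integral>\<^sup>+x. indicator B x * indicator (S n) x \<partial>LY) = emeasure lborel (B \<inter> S n)"
      using B by (simp add: emeasure_LY le_infI1 flip: indicator_inter_arith)
    also have "\<dots> \<le> emeasure lborel (?V \<inter> S n) + ennreal d" by (rule W(3)[OF Sn(1)])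
    also have "emeasure lborel (?V \<inter> S n) = (\<integral>\<^sup>+w. emeasure lborel (cyl w \<inter> S n) \<partial>count_space (W n))"
      using emeasure_cyl_union[OF W(1), of lborel "S n"] Sn by simp
    also have "\<dots> \<le> (\<integral>\<^sup>+w. ennreal c * emeasure lborel (cyl w) \<partial>count_space (W n))"
      using W(1)[of n] le by (intro nn_integral_mono) auto
    also have "\<dots> = ennreal c * emeasure lborel ?V"
      using emeasure_cyl_union[OF W(1), of lborel UNIV] by (simp add: nn_integral_cmult)
    also have "\<dots> \<le> ennreal c * emeasure lborel (B \<union> (U - B))"
      using W(2)[OF n] U B by (intro mult_left_mono emeasure_mono) auto
    also have "\<dots> \<le> ennreal c * (emeasure lborel B + emeasure lborel (U - B))"
      using U B by (intro mult_left_mono emeasure_subadditive) auto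
    also have "\<dots> \<le> ennreal c * (emeasure lborel B + ennreal d)"
      using U by (intro mult_left_mono add_left_mono) auto
    also have "ennreal c * (emeasure lborel B + ennreal d) + ennreal d = ennreal c * emeasure lborel B + ennreal (c * d + d)"
      using c d by (simp add: distrib_left add.assoc ennreal_mult)
    also have "c * d + d = d * (c + 1)" by (simp add: algebra_simps)
    also have "\<dots> = e / 2" using c by (simp add: d_def field_simps add_eq_0_iff)
    also have "ennreal c * emeasure lborel B + ennreal (e / 2) \<le> ennreal c * emeasure lborel B + ennreal e"
      using set by (intro add_left_mono ennreal_leI) auto
    also have "emeasure lborel B = (\<integral>\<^sup>+x. indicator B x \<partial>LY)"
      using set B by (simp add: emeasure_LY)
    finally show "(\<integral>\<^sup>+x. indicator B x * indicator (S n) x \<partial>LY) \<le>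
        ennreal c * (\<integral>\<^sup>+x. indicator B x \<partial>LY) + ennreal e"
      by simp
  qed
next
  case (mult u a)
  have [measurable]: "S n \<in> sets LY" for n by (rule S)
  have um [measurable]: "u \<in> borel_measurable LY" by fact
  show ?case
  proof (cases "a = 0")
    case True then show ?thesis by auto
  next
    case False
    define a' where "a' = enn2real a"
    have a': "a = ennreal a'" "a' > 0" using False mult.hyps(1) by (auto simp: a'_def enn2real_positive_iff less_top zero_less_iff_neq_zero)
    have "(\<integral>\<^sup>+x. u x \<partial>LY) < \<infinity>"
      using mult.prems False by (auto simp: nn_integral_cmult ennreal_mult_less_top)
    from mult.IH[OF this, of "e / a'"] obtain N where N: "\<And>n. n \<ge> N \<Longrightarrow>
       (\<integral>\<^sup>+x. u x * indicator (S n) x \<partial>LY) \<le> ennreal c * (\<integral>\<^sup>+x. u x \<partial>LY) + ennreal (e / a')"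
      using mult.prems a' by auto
    show ?thesis
    proof (intro exI allI impI)
      fix n assume "n \<ge> N"
      have "(\<integral>\<^sup>+x. a * u x * indicator (S n) x \<partial>LY) = a * (\<integral>\<^sup>+x. u x * indicator (S n) x \<partial>LY)"
        by (simp add: nn_integral_cmult mult.assoc)
      also have "\<dots> \<le> a * (ennreal c * (\<integral>\<^sup>+x. u x \<partial>LY) + ennreal (e / a'))"
        using N[OF \<open>n \<ge> N\<close>] by (intro mult_left_mono) auto
      also have "\<dots> = ennreal c * (\<integral>\<^sup>+x. a * u x \<partial>LY) + a * ennreal (e / a')"
        by (simp add: nn_integral_cmult distrib_left mult_ac)
      also have "a * ennreal (e / a') = ennreal e"
        using a' mult.prems by (simp flip: ennreal_mult)
      finally show "(\<integral>\<^sup>+x. a * u x * indicator (S n) x \<partial>LY) \<le> ennreal c * (\<integral>\<^sup>+x. a * u x \<partial>LY) + ennreal e" .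
    qed
  qed
next
  case (add u v)
  have [measurable]: "S n \<in> sets LY" for n by (rule S)
  have um [measurable]: "u \<in> borel_measurable LY" "v \<in> borel_measurable LY" by fact+
  have sum: "(\<integral>\<^sup>+x. v x + u x \<partial>LY) = (\<integral>\<^sup>+x. v x \<partial>LY) + (\<integral>\<^sup>+x. u x \<partial>LY)"
    by (rule nn_integral_add) auto
  then have fin: "(\<integral>\<^sup>+x. u x \<partial>LY) < \<infinity>" "(\<integral>\<^sup>+x. v x \<partial>LY) < \<infinity>" using add.prems by auto
  obtain N1 where N1: "\<And>n. n \<ge> N1 \<Longrightarrow>
       (\<integral>\<^sup>+x. u x * indicator (S n) x \<partial>LY) \<le> ennreal c * (\<integral>\<^sup>+x. u x \<partial>LY) + ennreal (e / 2)"
    using add.IH(1)[OF fin(1), of "e / 2"] add.prems by auto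
  obtain N2 where N2: "\<And>n. n \<ge> N2 \<Longrightarrow>
       (\<integral>\<^sup>+x. v x * indicator (S n) x \<partial>LY) \<le> ennreal c * (\<integral>\<^sup>+x. v x \<partial>LY) + ennreal (e / 2)"
    using add.IH(2)[OF fin(2), of "e / 2"] add.prems by auto
  show ?case
  proof (intro exI allI impI)
    fix n assume n: "n \<ge> max N1 N2"
    have "(\<integral>\<^sup>+x. (v x + u x) * indicator (S n) x \<partial>LY) =
       (\<integral>\<^sup>+x. v x * indicator (S n) x \<partial>LY) + (\<integral>\<^sup>+x. u x * indicator (S n) x \<partial>LY)"
      by (subst nn_integral_add[symmetric]) (auto simp: distrib_right)
    also have "\<dots> \<le> (ennreal c * (\<integral>\<^sup>+x. v x \<partial>LY) + ennreal (e / 2)) + (ennreal c * (\<integral>\<^sup>+x. u x \<partial>LY) + ennreal (e / 2))"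
      using N1[of n] N2[of n] n by (intro add_mono) auto
    also have "\<dots> = ennreal c * (\<integral>\<^sup>+x. v x + u x \<partial>LY) + (ennreal (e / 2) + ennreal (e / 2))"
      unfolding sum by (simp add: distrib_left ac_simps)
    also have "ennreal (e / 2) + ennreal (e / 2) = ennreal e" using add.prems by (simp flip: ennreal_plus)
    finally show "(\<integral>\<^sup>+x. (v x + u x) * indicator (S n) x \<partial>LY) \<le> ennreal c * (\<integral>\<^sup>+x. v x + u x \<partial>LY) + ennreal e" .
  qed
next
  case (seq U)
  have [measurable]: "S n \<in> sets LY" for n by (rule S)
  have um [measurable]: "U i \<in> borel_measurable LY" for i by fact
  define H where "H = (SUP i. U i)"
  have "(\<lambda>x. SUP i. U i x) \<in> borel_measurable LY" by measurable
  moreover have "H = (\<lambda>x. SUP i. U i x)" by (simp add: H_def fun_eq_iff image_comp)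
  ultimately have hm [measurable]: "H \<in> borel_measurable LY" by simp
  have prems: "(\<integral>\<^sup>+x. H x \<partial>LY) < \<infinity>" "0 < e" using seq.prems by (simp_all only: H_def)
  have sup: "(\<integral>\<^sup>+x. H x \<partial>LY) = (SUP i. \<integral>\<^sup>+x. U i x \<partial>LY)"
    using nn_integral_monotone_convergence_SUP[OF seq.hyps(3) um] by (simp add: H_def SUP_apply image_comp)
  have le_h: "U i x \<le> H x" for i x unfolding H_def by (metis SUP_upper UNIV_I le_funD)
  have fin: "(\<integral>\<^sup>+x. U i x \<partial>LY) < \<infinity>" for i
    using nn_integral_mono[of LY "U i" H] le_h prems by (metis le_less_trans)
  have "(\<integral>\<^sup>+x. H x \<partial>LY) < (SUP i. \<integral>\<^sup>+x. U i x \<partial>LY) + ennreal (e / 2)"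
    unfolding sup[symmetric] by (rule ennreal_less_add_pos) (use prems in auto)
  \<comment> \<open>One \<open>U i\<close> misses at most e/2 of the integral of \<open>H\<close>,
    whatever \<open>S n\<close> is, so the threshold obtained for this \<open>U i\<close> serves for
    \<open>H\<close>.\<close>
  then obtain i where i: "(\<integral>\<^sup>+x. H x \<partial>LY) < (\<integral>\<^sup>+x. U i x \<partial>LY) + ennreal (e / 2)"
    by (subst (asm) ennreal_SUP_add_left[symmetric]) (simp, unfold less_SUP_iff, blast)
  obtain N where N: "\<And>n. n \<ge> N \<Longrightarrow>
       (\<integral>\<^sup>+x. U i x * indicator (S n) x \<partial>LY) \<le> ennreal c * (\<integral>\<^sup>+x. U i x \<partial>LY) + ennreal (e / 2)"
    using seq.IH[OF fin, of "e / 2"] seq.prems by auto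
  have "(\<integral>\<^sup>+x. H x - U i x \<partial>LY) = (\<integral>\<^sup>+x. H x \<partial>LY) - (\<integral>\<^sup>+x. U i x \<partial>LY)"
    using fin[of i] by (intro nn_integral_diff hm um AE_I2 le_h) auto
  also have "\<dots> \<le> ennreal (e / 2)"
    using i using fin[of i] by (auto simp: ennreal_minus_le_iff add.commute less_imp_le)
  finally have diff: "(\<integral>\<^sup>+x. H x - U i x \<partial>LY) \<le> ennreal (e / 2)" .
  show ?case
    unfolding H_def[symmetric]
  proof (intro exI allI impI)
    fix n assume n: "n \<ge> N"
    have "(\<integral>\<^sup>+x. H x * indicator (S n) x \<partial>LY) \<le>
       (\<integral>\<^sup>+x. U i x * indicator (S n) x + (H x - U i x) \<partial>LY)"
      using le_h by (intro nn_integral_mono) (auto split: split_indicator simp: add_diff_inverse_ennreal)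
    also have "\<dots> = (\<integral>\<^sup>+x. U i x * indicator (S n) x \<partial>LY) + (\<integral>\<^sup>+x. H x - U i x \<partial>LY)"
      by (rule nn_integral_add) auto
    also have "\<dots> \<le> (ennreal c * (\<integral>\<^sup>+x. U i x \<partial>LY) + ennreal (e / 2)) + ennreal (e / 2)"
      using N[OF n] diff by (intro add_mono) auto
    also have "\<dots> = ennreal c * (\<integral>\<^sup>+x. U i x \<partial>LY) + ennreal e"
      using prems by (simp add: add.assoc flip: ennreal_plus)
    also have "\<dots> \<le> ennreal c * (\<integral>\<^sup>+x. H x \<partial>LY) + ennreal e"
      using le_h by (intro add_right_mono mult_left_mono nn_integral_mono) auto
    finally show "(\<integral>\<^sup>+x. H x * indicator (S n) x \<partial>LY) \<le> ennreal c * (\<integral>\<^sup>+x. H x \<partial>LY) + ennreal e" .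
  qed
qed

text \<open>Meant for preimages \<open>S n\<close> of a fixed set under iterates of
  \<open>G\<close>: invariance makes their mass constant in n, so a bound that holds only in the
  limit becomes a bound for the set itself.\<close>

lemma cyl_upper_imp_upper:
  assumes \<mu>: "prob_space \<mu>" "sets \<mu> = sets (restrict_space borel {l..1})" "absolutely_continuous LY \<mu>"
    and c: "0 \<le> c"
    and S: "\<And>n. S n \<in> sets LY"
    and le: "\<And>n w. w \<in> words n \<Longrightarrow> emeasure lborel (cyl w \<inter> S n) \<le> ennreal c * emeasure lborel (cyl w)"
    and v: "\<And>n. emeasure \<mu> (S n) = v"
  shows "v \<le> ennreal c"
proof -
  interpret prob_space \<mu> by fact
  have setsLY: "sets LY = sets (restrict_space borel {l..1})" by (intro sets_restrict_space_cong) simp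
  interpret LY: finite_measure LY
    using l_less by (intro finite_measureI) (simp add: emeasure_LY space_restrict_space)
  obtain h where h: "h \<in> borel_measurable LY" "density LY h = \<mu>"
    using LY.Radon_Nikodym[OF \<mu>(3)] \<mu>(2) setsLY by auto
  have 1: "(\<integral>\<^sup>+x. h x \<partial>LY) = 1"
    using emeasure_space_1 emeasure_density[OF h(1), of "space LY"]
      nn_set_integral_space[of LY h] h(2) sets_eq_imp_space_eq[OF \<mu>(2)] sets_LY[of "{l..1}"]
    by (simp add: space_restrict_space)
  show ?thesis
  proof (rule ennreal_le_epsilon)
    fix e :: real assume "e > 0"
    have "\<exists>N. \<forall>n\<ge>N. (\<integral>\<^sup>+x. h x * indicator (S n) x \<partial>LY) \<le> ennreal c * (\<integral>\<^sup>+x. h x \<partial>LY) + ennreal e"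
      by (rule cyl_upper_imp_density_upper[OF h(1) c S le]) (use 1 \<open>e > 0\<close> in auto)
    then obtain N where "(\<integral>\<^sup>+x. h x * indicator (S N) x \<partial>LY) \<le> ennreal c + ennreal e"
      using 1 by auto
    also have "(\<integral>\<^sup>+x. h x * indicator (S N) x \<partial>LY) = emeasure \<mu> (S N)"
      using h emeasure_density[OF h(1) S[of N]] by simp
    finally show "v \<le> ennreal c + ennreal e" using v by simp
  qed
qed


section \<open>Where cylinders are sent by the iterates of \<open>G\<close>\<close>

lemma g_less: "i \<in> I \<Longrightarrow> 0 < x \<Longrightarrow> x < y \<Longrightarrow> g i x < g i y"
  by (rule concave_incr_less[OF branch])

lemma g_le: "i \<in> I \<Longrightarrow> 0 < x \<Longrightarrow> x \<le> y \<Longrightarrow> g i x \<le> g i y"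
  by (rule concave_incr_le[OF branch])

lemma gwg_branch: "w \<in> words n \<Longrightarrow> i \<in> I \<Longrightarrow> concave_incr (\<lambda>x. gw w (g i x))"
  using concave_incr_comp[OF gw_branch branch] by (simp add: comp_def)

lemma g_image: "i \<in> I \<Longrightarrow> l \<le> c \<Longrightarrow> c \<le> d \<Longrightarrow> d \<le> 1 \<Longrightarrow> g i ` {c..<d} = {g i c..<g i d}"
  using gw_image[of "[i]" 1 c d] by (simp add: words_Suc words_0)

lemma gw_inj: assumes "w \<in> words n" shows "inj_on (gw w) {l..<1}"
proof (rule inj_onI)
  fix x y assume "x \<in> {l..<1}" "y \<in> {l..<1}" "gw w x = gw w y"
  then show "x = y"
    using gw_less[OF assms, of x y] gw_less[OF assms, of y x] by (cases x y rule: linorder_cases) auto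
qed

text \<open>Inside \<open>cyl w\<close> the preimage of \<open>[c, d)\<close> is the disjoint union
  of the images of \<open>[c, d)\<close> under \<open>gw w \<circ> g i\<close>, up to points coming
  from the countable set that no branch covers.\<close>

lemma cyl_Suc_null:
  assumes w: "w \<in> words n" and cd: "l \<le> c" "c \<le> d" "d \<le> 1"
  shows "{y \<in> cyl w. (G ^^ Suc n) y \<in> {c..<d}} \<in> sets borel"
    and "emeasure lborel {y \<in> cyl w. (G ^^ Suc n) y \<in> {c..<d}} =
         (\<integral>\<^sup>+i. ennreal (gw w (g i d) - gw w (g i c)) \<partial>count_space I)"
proof -
  let ?A = "{y \<in> cyl w. (G ^^ Suc n) y \<in> {c..<d}}"
  let ?E = "{l..<1} - (\<Union>i\<in>I. g i ` {l..<1})"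
  let ?X = "\<lambda>i. {gw w (g i c)..<gw w (g i d)}"
  have img: "gw w ` g i ` {c..<d} = ?X i" if "i \<in> I" for i
    using gw_image[OF w, of "g i c" "g i d"] g_image[OF that, of c d] g_range[OF that] g_le[OF that, of c d] cd l_pos
    by auto
  have G1: "(G ^^ Suc n) (gw w x) = G x" if "x \<in> {l..<1}" for x
    using G_gw[OF w, of x] that by simp
  have sub: "(\<Union>i\<in>I. ?X i) \<subseteq> ?A"
  proof clarify
    fix i y assume i: "i \<in> I" and "y \<in> ?X i"
    then have "y \<in> gw w ` g i ` {c..<d}" using img[OF i] by simp
    then obtain x where x: "x \<in> {c..<d}" "y = gw w (g i x)" by blast
    have "g i x \<in> {l..<1}" using g_range[OF i, of x] g_range_less[OF i, of x] x cd by auto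
    moreover have "G (g i x) = x" using G_g[OF i, of x] x cd by auto
    ultimately show "y \<in> cyl w \<and> (G ^^ Suc n) y \<in> {c..<d}"
      using x G1[of "g i x"] by (auto simp: cyl_def simp del: funpow.simps)
  qed
  have sub2: "?A \<subseteq> (\<Union>i\<in>I. ?X i) \<union> gw w ` ?E"
  proof
    fix y assume y: "y \<in> ?A"
    then obtain x where x: "x \<in> {l..<1}" "y = gw w x" by (auto simp: cyl_def)
    then have Gx: "G x \<in> {c..<d}" using y G1[of x] by simp
    show "y \<in> (\<Union>i\<in>I. ?X i) \<union> gw w ` ?E"
    proof (cases "\<exists>i\<in>I. \<exists>z\<in>{l..<1}. x = g i z")
      case True
      then obtain i z where i: "i \<in> I" "z \<in> {l..<1}" "x = g i z" by blast
      then have "z \<in> {c..<d}" using Gx G_g[OF i(1), of z] by auto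
      then have "y \<in> gw w ` g i ` {c..<d}" using i x by auto
      then show ?thesis using img[OF i(1)] i by auto
    next
      case False
      then have "x \<in> ?E" using x by auto
      then show ?thesis using x by auto
    qed
  qed
  define R where "R = ?A - (\<Union>i\<in>I. ?X i)"
  have "countable R" by (rule countable_subset[of _ "gw w ` ?E"]) (use sub2 cover in \<open>auto simp: R_def\<close>)
  then have R: "R \<in> null_sets lborel" by (rule countable_imp_null_set_lborel)
  have A: "?A = (\<Union>i\<in>I. ?X i) \<union> R" using sub by (auto simp: R_def)
  have X: "(\<Union>i\<in>I. ?X i) \<in> sets borel"
    using countable_I by (intro sets.countable_UN') auto
  show "?A \<in> sets borel" unfolding A using X R by auto
  have "emeasure lborel ?A = emeasure lborel (\<Union>i\<in>I. ?X i)"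
    unfolding A by (rule emeasure_Un_null_set) (use X R in auto)
  also have "\<dots> = (\<integral>\<^sup>+i. emeasure lborel (?X i) \<partial>count_space I)"
  proof (rule emeasure_UN_countable)
    show "disjoint_family_on ?X I"
    proof (unfold disjoint_family_on_def, intro ballI impI)
      fix i j assume ij: "i \<in> I" "j \<in> I" "i \<noteq> j"
      have sb: "g k ` {c..<d} \<subseteq> g k ` {l..<1}" "g k ` {l..<1} \<subseteq> {l..<1}" if "k \<in> I" for k
        using cd g_range[OF that] g_range_less[OF that] by (auto simp: image_subset_iff)
      have "g i ` {c..<d} \<subseteq> {l..<1}" "g j ` {c..<d} \<subseteq> {l..<1}"
        using sb[OF ij(1)] sb[OF ij(2)] by (auto intro: order_trans)
      then have "gw w ` g i ` {c..<d} \<inter> gw w ` g j ` {c..<d} = gw w ` (g i ` {c..<d} \<inter> g j ` {c..<d})"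
        by (rule inj_on_image_Int[OF gw_inj[OF w], symmetric])
      also have "g i ` {c..<d} \<inter> g j ` {c..<d} = {}"
        using disj[OF ij] sb(1)[OF ij(1)] sb(1)[OF ij(2)] by blast
      finally show "?X i \<inter> ?X j = {}" using img[OF ij(1)] img[OF ij(2)] by simp
    qed
  qed (use countable_I in auto)
  also have "\<dots> = (\<integral>\<^sup>+i. ennreal (gw w (g i d) - gw w (g i c)) \<partial>count_space I)"
  proof (intro nn_integral_cong)
    fix i assume "i \<in> space (count_space I)"
    then have i: "i \<in> I" by simp
    have "gw w (g i c) \<le> gw w (g i d)"
      using concave_incr_le[OF gwg_branch[OF w i], of c d] cd l_pos by auto
    then show "emeasure lborel (?X i) = ennreal (gw w (g i d) - gw w (g i c))" by simp
  qed
  finally show "emeasure lborel ?A = (\<integral>\<^sup>+i. ennreal (gw w (g i d) - gw w (g i c)) \<partial>count_space I)" .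
qed

text \<open>Concavity compares a piece of a branch with the left neighbour of that branch, which is again
  a branch; summing over all branches bounds the density of the image of Lebesgue measure.\<close>

lemma cyl_upper:
  assumes w: "w \<in> words n" and cd: "l \<le> c" "c \<le> d" "d \<le> 1"
  shows "emeasure lborel {y \<in> cyl w. (G ^^ Suc n) y \<in> {c..<d}} \<le>
    ennreal ((d - c) / (l - m)) * emeasure lborel (cyl w)"
proof -
  let ?X = "\<lambda>i. {gw w (g (sc i) l)..<gw w (g (sc i) 1)}"
  have rng: "l \<le> g i l" "g i l \<le> g i 1" "g i 1 \<le> 1" if "i \<in> I" for i
    using g_range[OF that] g_le[OF that, of l 1] l_less l_pos by auto
  have X: "?X i = gw w ` g (sc i) ` {l..<1}" if "i \<in> I" for i
    using gw_image[OF w, of "g (sc i) l" "g (sc i) 1"] g_image[OF sc_I[OF that], of l 1]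
      rng[OF sc_I[OF that]] l_less by auto
  have le: "ennreal (gw w (g i d) - gw w (g i c)) \<le> ennreal ((d - c) / (l - m)) * emeasure lborel (?X i)"
    if i: "i \<in> I" for i
  proof -
    have "(gw w (g i d) - gw w (g i c)) * (l - m) \<le> (gw w (g i l) - gw w (g i m)) * (d - c)"
      by (rule concave_incr_slope[OF gwg_branch[OF w i]]) (use m_pos m_less cd in auto)
    then have *: "gw w (g i d) - gw w (g i c) \<le> (d - c) / (l - m) * (gw w (g (sc i) 1) - gw w (g (sc i) l))"
      using m_less by (simp add: field_simps sc_m[OF i] sc_l[OF i])
    have "gw w (g (sc i) l) \<le> gw w (g (sc i) 1)"
      using concave_incr_le[OF gwg_branch[OF w sc_I[OF i]], of l 1] l_less l_pos by auto
    then have "emeasure lborel (?X i) = ennreal (gw w (g (sc i) 1) - gw w (g (sc i) l))" by simp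
    then show ?thesis using * cd m_less \<open>gw w (g (sc i) l) \<le> _\<close>
      by (simp add: ennreal_leI flip: ennreal_mult)
  qed
  have "emeasure lborel {y \<in> cyl w. (G ^^ Suc n) y \<in> {c..<d}} =
         (\<integral>\<^sup>+i. ennreal (gw w (g i d) - gw w (g i c)) \<partial>count_space I)"
    by (rule cyl_Suc_null(2)[OF w cd])
  also have "\<dots> \<le> (\<integral>\<^sup>+i. ennreal ((d - c) / (l - m)) * emeasure lborel (?X i) \<partial>count_space I)"
    using le by (intro nn_integral_mono) auto
  also have "\<dots> = ennreal ((d - c) / (l - m)) * (\<integral>\<^sup>+i. emeasure lborel (?X i) \<partial>count_space I)"
    by (rule nn_integral_cmult) simp
  also have "(\<integral>\<^sup>+i. emeasure lborel (?X i) \<partial>count_space I) = emeasure lborel (\<Union>i\<in>I. ?X i)"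
  proof (rule emeasure_UN_countable[symmetric])
    \<comment> \<open>Injectivity of \<open>sc\<close> keeps the intervals of the left neighbours
      disjoint, so that their lengths add up to at most that of \<open>cyl w\<close>.\<close>
    show "disjoint_family_on ?X I"
    proof (unfold disjoint_family_on_def, intro ballI impI)
      fix i j assume ij: "i \<in> I" "j \<in> I" "i \<noteq> j"
      have sb: "g k ` {l..<1} \<subseteq> {l..<1}" if "k \<in> I" for k
        using g_range[OF that] g_range_less[OF that] by (auto simp: image_subset_iff)
      have ne: "sc i \<noteq> sc j" using ij sc_inj by (auto simp: inj_on_def)
      have "gw w ` g (sc i) ` {l..<1} \<inter> gw w ` g (sc j) ` {l..<1} =
          gw w ` (g (sc i) ` {l..<1} \<inter> g (sc j) ` {l..<1})"
        by (rule inj_on_image_Int[OF gw_inj[OF w] sb[OF sc_I[OF ij(1)]] sb[OF sc_I[OF ij(2)]], symmetric])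
      also have "\<dots> = {}" using disj[OF sc_I[OF ij(1)] sc_I[OF ij(2)] ne] by simp
      finally show "?X i \<inter> ?X j = {}" using X[OF ij(1)] X[OF ij(2)] by simp
    qed
  qed (use countable_I in auto)
  also have "\<dots> \<le> emeasure lborel (cyl w)"
  proof (rule emeasure_mono)
    show "(\<Union>i\<in>I. ?X i) \<subseteq> cyl w"
    proof clarify
      fix i y assume i: "i \<in> I" and y: "y \<in> ?X i"
      have "g (sc i) ` {l..<1} \<subseteq> {l..<1}"
        using g_range[OF sc_I[OF i]] g_range_less[OF sc_I[OF i]] by (auto simp: image_subset_iff)
      then show "y \<in> cyl w" using y unfolding X[OF i] by (auto simp: cyl_def)
    qed
  qed (use w in \<open>auto intro: cyl_borel\<close>)
  finally show ?thesis by (simp add: mult_left_mono)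
qed

text \<open>A concave increasing \<open>gw w\<close> is steepest at the left, so
  \<open>[l, c)\<close> receives at least its proportional share of the cylinder. The complement is
  estimated because \<open>cyl_upper_imp_upper\<close> transfers upper bounds.\<close>

lemma cyl_lower_left:
  assumes w: "w \<in> words n" and c: "l \<le> c" "c \<le> 1"
  shows "emeasure lborel (cyl w \<inter> {y \<in> {l..1}. (G ^^ n) y \<notin> {l..<c}}) \<le>
    ennreal (1 - (c - l) / (1 - l)) * emeasure lborel (cyl w)"
proof -
  have "cyl w \<inter> {y \<in> {l..1}. (G ^^ n) y \<notin> {l..<c}} = gw w ` {c..<1}"
  proof -
    have inv: "(G ^^ n) (gw w x) = x" if "x \<in> {l..<1}" for x using G_gw[OF w] that by auto
    show ?thesis
    proof
      show "cyl w \<inter> {y \<in> {l..1}. (G ^^ n) y \<notin> {l..<c}} \<subseteq> gw w ` {c..<1}"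
        using inv by (auto simp: cyl_def)
      show "gw w ` {c..<1} \<subseteq> cyl w \<inter> {y \<in> {l..1}. (G ^^ n) y \<notin> {l..<c}}"
      proof
        fix y assume "y \<in> gw w ` {c..<1}"
        then obtain x where x: "x \<in> {c..<1}" "y = gw w x" by blast
        then show "y \<in> cyl w \<inter> {y \<in> {l..1}. (G ^^ n) y \<notin> {l..<c}}"
          using inv[of x] gw_range[OF w, of x] c by (simp add: cyl_def)
      qed
    qed
  qed
  then have "emeasure lborel (cyl w \<inter> {y \<in> {l..1}. (G ^^ n) y \<notin> {l..<c}}) = ennreal (gw w 1 - gw w c)"
    using gw_image[OF w, of c 1] gw_le[OF w, of c 1] c by simp
  also have "\<dots> \<le> ennreal ((1 - (c - l) / (1 - l)) * (gw w 1 - gw w l))"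
  proof (rule ennreal_leI)
    have "(gw w 1 - gw w c) * (c - l) \<le> (gw w c - gw w l) * (1 - c)"
      by (rule concave_incr_slope[OF gw_branch[OF w]]) (use c l_pos in auto)
    then have "(gw w 1 - gw w c) * (1 - l) \<le> (1 - c) * (gw w 1 - gw w l)"
      by (simp add: algebra_simps)
    moreover have "1 - (c - l) / (1 - l) = (1 - c) / (1 - l)"
      using l_less by (simp add: field_simps)
    ultimately show "gw w 1 - gw w c \<le> (1 - (c - l) / (1 - l)) * (gw w 1 - gw w l)"
      using l_less by (simp add: field_simps)
  qed
  also have "\<dots> = ennreal (1 - (c - l) / (1 - l)) * emeasure lborel (cyl w)"
    unfolding emeasure_cyl[OF w] using gw_le[OF w, of l 1] c l_less by (intro ennreal_mult) auto
  finally show ?thesis .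
qed


lemma G_pow_meas: "(G ^^ n) \<in> measurable (restrict_space borel {l..1}) (restrict_space borel {l..1})"
proof (induction n)
  case (Suc n)
  then show ?case using G_meas by (simp only: funpow.simps) (rule measurable_comp)
qed (simp add: id_def)

lemma G_pow_borel: "(G ^^ n) \<in> borel_measurable (restrict_space borel {l..1})"
  using G_pow_meas[of n] by (simp add: measurable_restrict_space2_iff)

lemma sets_G_vimage:
  assumes "B \<in> sets borel" shows "{y \<in> {l..1}. (G ^^ n) y \<in> B} \<in> sets LY"
proof -
  have "(G ^^ n) -` B \<inter> space (restrict_space borel {l..1}) \<in> sets (restrict_space borel {l..1})"
    using G_pow_borel assms by (rule measurable_sets)
  moreover have "(G ^^ n) -` B \<inter> space (restrict_space borel {l..1}) = {y \<in> {l..1}. (G ^^ n) y \<in> B}"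
    by (auto simp: space_restrict_space)
  ultimately show ?thesis by (auto simp: sets_LY sets_restrict_space_iff)
qed

text \<open>After n + 1 steps the image of Lebesgue measure on the cylinder has a decreasing
  density. By \<open>cyl_upper\<close> at most half of the mass lies in a short interval
  \<open>[l, v)\<close>, so at least half lies in \<open>[v, 1)\<close>, and monotonicity gives a
  lower density bound on \<open>[l, v)\<close>. Near 1 there is no such bound; therefore one more
  step is taken along a branch \<open>i0\<close> whose interval lies in \<open>[l, v)\<close> and
  which is mapped onto everything.\<close>

lemma cyl_lower:
  obtains k where "k > 0"
    "\<And>n w B. w \<in> words n \<Longrightarrow> B \<in> sets borel \<Longrightarrow> B \<subseteq> {l..1} \<Longrightarrow>
       ennreal k * emeasure lborel (cyl w) * emeasure lborel B
         \<le> emeasure lborel {y \<in> cyl w. (G ^^ Suc (Suc n)) y \<in> B}"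
proof -
  \<comment> \<open>The first bound keeps \<open>v\<close> below 1; the second makes the factor
    \<open>(v - l) / (l - m)\<close> of \<open>cyl_upper\<close> at most 1/2.\<close>
  define v where "v = min ((l + 1) / 2) (l + (l - m) / 2)"
  have v1: "v \<le> (l + 1) / 2" unfolding v_def by (rule min.cobounded1)
  have v2: "v \<le> l + (l - m) / 2" unfolding v_def by (rule min.cobounded2)
  have v3: "l < v" using l_less m_less by (simp add: v_def)
  have v: "l < v" "v < 1" "v - l \<le> (l - m) / 2"
    using v1 v2 v3 l_less by (simp_all add: field_simps)
  obtain i0 where i0: "i0 \<in> I" "g i0 1 \<le> v" using small[OF v(1)] by auto
  \<comment> \<open>The concave continuation of \<open>g i0\<close> beyond 1 gives a positive lower
    bound for its chord slopes on \<open>[l, 1]\<close>; 2 is just some point to the right of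
    1.\<close>
  define \<sigma> where "\<sigma> = g i0 2 - g i0 1"
  have \<sigma>: "\<sigma> > 0" using g_less[OF i0(1), of 1 2] by (simp add: \<sigma>_def)
  define k where "k = \<sigma> / 2"
  have main: "ennreal k * emeasure lborel (cyl w) * emeasure lborel B
         \<le> emeasure lborel {y \<in> cyl w. (G ^^ Suc (Suc n)) y \<in> B}"
    if w: "w \<in> words n" and B: "B \<in> sets borel" "B \<subseteq> {l..1}" for n w B
  proof -
    define M where "M = gw w 1 - gw w l"
    have M: "M \<ge> 0" using gw_le[OF w, of l 1] l_less by (simp add: M_def)
    have eM: "emeasure lborel (cyl w) = ennreal M" using emeasure_cyl[OF w] by (simp add: M_def)
    define U where "U c d = emeasure lborel {y \<in> cyl w. (G ^^ Suc n) y \<in> {c..<d}}" for c d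
    have U_eq: "U c d = (\<integral>\<^sup>+i. ennreal (gw w (g i d) - gw w (g i c)) \<partial>count_space I)"
      if "l \<le> c" "c \<le> d" "d \<le> 1" for c d
      unfolding U_def by (rule cyl_Suc_null(2)[OF w that])
    have U_fin: "U c d \<le> ennreal M" for c d
      unfolding U_def eM[symmetric] by (rule emeasure_mono) (use w in \<open>auto intro: cyl_borel\<close>)
    have U_all: "U l 1 = ennreal M"
    proof -
      have "cyl w - {y \<in> cyl w. (G ^^ Suc n) y \<in> {l..<1}} \<subseteq> cyl w - core (Suc n)"
      proof
        fix y assume y: "y \<in> cyl w - {y \<in> cyl w. (G ^^ Suc n) y \<in> {l..<1}}"
        have "y \<notin> core (Suc n)"
        proof
          assume "y \<in> core (Suc n)"
          then obtain u x where "u \<in> words (Suc n)" "x \<in> {l..<1}" "y = gw u x"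
            by (auto simp: core_def cyl_def)
          then show False using y G_gw[of u "Suc n" x] by (simp del: funpow.simps)
        qed
        then show "y \<in> cyl w - core (Suc n)" using y by simp
      qed
      also have "\<dots> \<subseteq> {l..<1} - core (Suc n)" using cyl_subset[OF w] by auto
      finally have "countable (cyl w - {y \<in> cyl w. (G ^^ Suc n) y \<in> {l..<1}})"
        using countable_core countable_subset by blast
      then have null: "cyl w - {y \<in> cyl w. (G ^^ Suc n) y \<in> {l..<1}} \<in> null_sets lborel"
        by (rule countable_imp_null_set_lborel)
      have "{y \<in> cyl w. (G ^^ Suc n) y \<in> {l..<1}} \<in> sets borel"
        by (rule cyl_Suc_null(1)[OF w]) (use l_less in auto)
      then have "emeasure lborel ({y \<in> cyl w. (G ^^ Suc n) y \<in> {l..<1}} \<union>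
          (cyl w - {y \<in> cyl w. (G ^^ Suc n) y \<in> {l..<1}})) = U l 1"
        unfolding U_def using null by (intro emeasure_Un_null_set) auto
      moreover have "{y \<in> cyl w. (G ^^ Suc n) y \<in> {l..<1}} \<union>
          (cyl w - {y \<in> cyl w. (G ^^ Suc n) y \<in> {l..<1}}) = cyl w" by auto
      ultimately show ?thesis using eM by simp
    qed
    have "U l 1 \<le> U l v + U v 1"
    proof -
      have eq: "{y \<in> cyl w. (G ^^ Suc n) y \<in> {l..<1}} =
        {y \<in> cyl w. (G ^^ Suc n) y \<in> {l..<v}} \<union> {y \<in> cyl w. (G ^^ Suc n) y \<in> {v..<1}}"
        using v by auto
      show ?thesis unfolding U_def eq
        by (rule emeasure_subadditive) (use cyl_Suc_null(1)[OF w] v in auto)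
    qed
    moreover have "U l v \<le> ennreal (M / 2)"
    proof -
      have "U l v \<le> ennreal ((v - l) / (l - m)) * ennreal M"
        unfolding U_def eM[symmetric] by (rule cyl_upper[OF w]) (use v in auto)
      also have "\<dots> = ennreal ((v - l) / (l - m) * M)"
        using v m_less M by (intro ennreal_mult[symmetric]) auto
      also have "\<dots> \<le> ennreal (1 / 2 * M)"
        using v m_less M by (intro ennreal_leI mult_right_mono) (auto simp: field_simps)
      finally show ?thesis by simp
    qed
    moreover obtain u where u: "U v 1 = ennreal u" "u \<ge> 0"
      using U_fin[of v 1] by (cases "U v 1") (auto simp: top_unique)
    ultimately have "ennreal M \<le> ennreal (M / 2) + ennreal u"
      using U_all by (metis add_mono order_refl order_trans)
    then have uM: "M / 2 \<le> u" using M u(2) by (simp flip: ennreal_plus)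
    \<comment> \<open>The density on \<open>[l, v)\<close> is at least its average on
      \<open>[v, 1)\<close>, which is at least M/2 because \<open>1 - v \<le> 1\<close>.\<close>
    have U_low: "ennreal (M / 2 * (d - c)) \<le> U c d" if cd: "l \<le> c" "c \<le> d" "d \<le> v" for c d
    proof -
      have "ennreal (M / 2 * (d - c)) \<le> ennreal ((d - c) / (1 - v) * u)"
      proof (rule ennreal_leI)
        have "M / 2 * (d - c) \<le> u * (d - c)" using uM cd by (intro mult_right_mono) auto
        also have "\<dots> \<le> u * ((d - c) / (1 - v))"
        proof (rule mult_left_mono)
          have "(d - c) * (1 - v) \<le> (d - c) * 1" using cd v l_pos by (intro mult_left_mono) auto
          then show "d - c \<le> (d - c) / (1 - v)" using v by (simp add: field_simps)
        qed (use u in auto)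
        finally show "M / 2 * (d - c) \<le> (d - c) / (1 - v) * u" by (simp add: mult.commute)
      qed
      also have "\<dots> = ennreal ((d - c) / (1 - v)) * U v 1"
        unfolding u(1) using cd v u(2) by (intro ennreal_mult) auto
      also have "\<dots> = (\<integral>\<^sup>+i. ennreal ((d - c) / (1 - v)) * ennreal (gw w (g i 1) - gw w (g i v)) \<partial>count_space I)"
        using v by (simp add: U_eq nn_integral_cmult)
      also have "\<dots> \<le> (\<integral>\<^sup>+i. ennreal (gw w (g i d) - gw w (g i c)) \<partial>count_space I)"
      proof (rule nn_integral_mono)
        fix i assume "i \<in> space (count_space I)"
        then have i: "i \<in> I" by simp
        have "(gw w (g i 1) - gw w (g i v)) * (d - c) \<le> (gw w (g i d) - gw w (g i c)) * (1 - v)"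
          by (rule concave_incr_slope[OF gwg_branch[OF w i]]) (use cd v l_pos in auto)
        then have "(d - c) / (1 - v) * (gw w (g i 1) - gw w (g i v)) \<le> gw w (g i d) - gw w (g i c)"
          using v by (simp add: field_simps)
        moreover have "gw w (g i v) \<le> gw w (g i 1)"
          using concave_incr_le[OF gwg_branch[OF w i], of v 1] v l_pos by auto
        ultimately show "ennreal ((d - c) / (1 - v)) * ennreal (gw w (g i 1) - gw w (g i v))
            \<le> ennreal (gw w (g i d) - gw w (g i c))"
          using cd v by (simp add: ennreal_leI flip: ennreal_mult)
      qed
      also have "\<dots> = U c d" using cd v by (simp add: U_eq)
      finally show ?thesis .
    qed
    define N where "N = distr (restrict_space lborel (cyl w)) borel (G ^^ Suc (Suc n))"
    have cylY: "cyl w \<subseteq> {l..1}" using cyl_subset[OF w] by auto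
    have meas: "G ^^ Suc (Suc n) \<in> borel_measurable (restrict_space lborel (cyl w))"
      unfolding measurable_cong_sets[OF sets_restrict_space_cong[OF sets_lborel] refl]
      by (rule measurable_restrict_mono[OF G_pow_borel cylY])
    have eN: "emeasure N A = emeasure lborel {y \<in> cyl w. (G ^^ Suc (Suc n)) y \<in> A}"
      if "A \<in> sets borel" for A
    proof -
      have "emeasure N A = emeasure (restrict_space lborel (cyl w))
          ((G ^^ Suc (Suc n)) -` A \<inter> space (restrict_space lborel (cyl w)))"
        unfolding N_def by (rule emeasure_distr[OF meas that])
      also have "(G ^^ Suc (Suc n)) -` A \<inter> space (restrict_space lborel (cyl w)) =
          {y \<in> cyl w. (G ^^ Suc (Suc n)) y \<in> A}" by (auto simp: space_restrict_space)
      also have "emeasure (restrict_space lborel (cyl w)) \<dots> = emeasure lborel \<dots>"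
        using w by (intro emeasure_restrict_space) (auto intro: cyl_borel)
      finally show ?thesis .
    qed
    have finN: "finite_measure N"
    proof (rule finite_measureI)
      have "emeasure N (space N) = emeasure lborel {y \<in> cyl w. (G ^^ Suc (Suc n)) y \<in> UNIV}"
        using eN[of UNIV] by (simp add: N_def)
      also have "\<dots> = ennreal M" using eM by simp
      finally show "emeasure N (space N) \<noteq> \<infinity>" by simp
    qed
    have "ennreal (k * M) * emeasure lborel B \<le> emeasure N B"
    proof (rule cyl_lower_imp_lower[OF finN _ _ B])
      show "sets N = sets borel" by (simp add: N_def)
      fix n' w' assume w': "w' \<in> words n'"
      define c where "c = gw w' l"
      define d where "d = gw w' 1"
      have cd: "l \<le> c" "c \<le> d" "d \<le> 1" "cyl w' = {c..<d}"
        using gw_range[OF w', of l] gw_range[OF w', of 1] gw_le[OF w', of l 1] cyl_eq[OF w'] l_less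
        by (auto simp: c_def d_def)
      have gcd: "l \<le> g i0 c" "g i0 c \<le> g i0 d" "g i0 d \<le> v"
        using g_range[OF i0(1), of c] g_le[OF i0(1), of c d] g_le[OF i0(1), of d 1] cd i0 l_pos by auto
      have "(g i0 2 - g i0 1) * (d - c) \<le> (g i0 d - g i0 c) * (2 - 1)"
        by (rule concave_incr_slope[OF branch[OF i0(1)]]) (use cd l_pos in auto)
      then have "\<sigma> * (d - c) \<le> g i0 d - g i0 c" by (simp add: \<sigma>_def)
      then have "k * M * (d - c) \<le> M / 2 * (g i0 d - g i0 c)"
        using mult_left_mono[of "\<sigma> * (d - c)" "g i0 d - g i0 c" "M / 2"] M by (simp add: k_def mult_ac)
      then have "ennreal (k * M) * emeasure lborel (cyl w') \<le> ennreal (M / 2 * (g i0 d - g i0 c))"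
        using cd \<sigma> M by (simp add: ennreal_leI k_def flip: ennreal_mult)
      also have "\<dots> \<le> U (g i0 c) (g i0 d)" by (rule U_low) (use gcd in auto)
      also have "\<dots> \<le> emeasure lborel {y \<in> cyl w. (G ^^ Suc (Suc n)) y \<in> cyl w'}"
        unfolding U_def
      proof (rule emeasure_mono)
        show "{y \<in> cyl w. (G ^^ Suc n) y \<in> {g i0 c..<g i0 d}} \<subseteq>
          {y \<in> cyl w. (G ^^ Suc (Suc n)) y \<in> cyl w'}"
        proof clarify
          fix y assume y: "y \<in> cyl w" "(G ^^ Suc n) y \<in> {g i0 c..<g i0 d}"
          then have "(G ^^ Suc n) y \<in> g i0 ` {c..<d}"
            using g_image[OF i0(1), of c d] cd by simp
          then obtain x where x: "x \<in> {c..<d}" "(G ^^ Suc n) y = g i0 x" by blast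
          then have "(G ^^ Suc (Suc n)) y = x" using G_g[OF i0(1), of x] cd by simp
          then show "(G ^^ Suc (Suc n)) y \<in> cyl w'" using x cd by simp
        qed
        have "{y \<in> {l..1}. (G ^^ Suc (Suc n)) y \<in> cyl w'} \<in> sets LY"
          by (rule sets_G_vimage) (use w' in \<open>rule cyl_borel\<close>)
        then have "cyl w \<inter> {y \<in> {l..1}. (G ^^ Suc (Suc n)) y \<in> cyl w'} \<in> sets borel"
          using cyl_borel[OF w] by (auto simp only: sets_LY)
        also have "cyl w \<inter> {y \<in> {l..1}. (G ^^ Suc (Suc n)) y \<in> cyl w'} =
            {y \<in> cyl w. (G ^^ Suc (Suc n)) y \<in> cyl w'}"
          using cylY by auto
        finally show "{y \<in> cyl w. (G ^^ Suc (Suc n)) y \<in> cyl w'} \<in> sets lborel" by simp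
      qed
      also have "\<dots> = emeasure N (cyl w')" using eN[OF cyl_borel[OF w']] by simp
      finally show "ennreal (k * M) * emeasure lborel (cyl w') \<le> emeasure N (cyl w')" .
    qed
    moreover have "ennreal (k * M) = ennreal k * ennreal M"
      by (rule ennreal_mult) (use \<sigma> M in \<open>auto simp: k_def\<close>)
    ultimately show ?thesis
      using eN[OF B(1)] eM by (simp del: funpow.simps)
  qed
  show thesis by (rule that[of k, OF _ main]) (use \<sigma> in \<open>simp add: k_def\<close>)
qed



section \<open>Absolutely continuous invariant measures of \<open>G\<close>\<close>

context
  fixes \<mu> :: "real measure"
  assumes \<mu>: "prob_space \<mu>" "sets \<mu> = sets (restrict_space borel {l..1})" "absolutely_continuous LY \<mu>"
    and inv: "distr \<mu> \<mu> G = \<mu>"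
begin

lemma sets_mu: "sets \<mu> = sets LY"
  unfolding \<mu>(2) by (rule sets_restrict_space_cong) simp

lemma space_mu: "space \<mu> = {l..1}"
  using sets_eq_imp_space_eq[OF \<mu>(2)] by (simp add: space_restrict_space)

lemma G_meas_mu: "G \<in> measurable \<mu> \<mu>"
  using G_meas by (simp cong: measurable_cong_sets add: \<mu>(2))

lemma invariant_pow: "B \<in> sets borel \<Longrightarrow> B \<subseteq> {l..1} \<Longrightarrow> emeasure \<mu> {y \<in> {l..1}. (G ^^ n) y \<in> B} = emeasure \<mu> B"
proof (induction n)
  case 0
  have "{y \<in> {l..1}. (G ^^ 0) y \<in> B} = B" using 0 by auto
  then show ?case by simp
next
  case (Suc n)
  let ?A = "{y \<in> {l..1}. (G ^^ n) y \<in> B}"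
  have A: "?A \<in> sets \<mu>" using sets_G_vimage[OF Suc.prems(1)] sets_mu by simp
  have "emeasure \<mu> ?A = emeasure (distr \<mu> \<mu> G) ?A" by (simp only: inv)
  also have "\<dots> = emeasure \<mu> (G -` ?A \<inter> space \<mu>)" by (rule emeasure_distr[OF G_meas_mu A])
  also have "G -` ?A \<inter> space \<mu> = {y \<in> {l..1}. (G ^^ Suc n) y \<in> B}"
  proof (rule set_eqI)
    fix y
    show "y \<in> G -` ?A \<inter> space \<mu> \<longleftrightarrow> y \<in> {y \<in> {l..1}. (G ^^ Suc n) y \<in> B}"
      using measurable_space[OF G_meas_mu, of y] unfolding space_mu funpow_Suc_right by auto
  qed
  finally show ?case using Suc.IH[OF Suc.prems] by (simp only:)
qed

text \<open>Cylinders of level n are paired with preimages under \<open>G ^^ Suc n\<close>: the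
  comparison with left neighbours in \<open>cyl_upper\<close> takes place in the additional
  step.\<close>

theorem invariant_measure_upper:
  assumes cd: "l \<le> c" "c \<le> d" "d \<le> 1"
  shows "emeasure \<mu> {c..<d} \<le> ennreal ((d - c) / (l - m))"
proof (rule cyl_upper_imp_upper[OF \<mu>])
  show "{y \<in> {l..1}. (G ^^ Suc n) y \<in> {c..<d}} \<in> sets LY" for n
    by (rule sets_G_vimage) simp
  show "emeasure \<mu> {y \<in> {l..1}. (G ^^ Suc n) y \<in> {c..<d}} = emeasure \<mu> {c..<d}" for n
    by (rule invariant_pow) (use cd in auto)
  fix n w assume w: "w \<in> words n"
  have "cyl w \<inter> {y \<in> {l..1}. (G ^^ Suc n) y \<in> {c..<d}} = {y \<in> cyl w. (G ^^ Suc n) y \<in> {c..<d}}"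
    using cyl_subset[OF w] by auto
  then show "emeasure lborel (cyl w \<inter> {y \<in> {l..1}. (G ^^ Suc n) y \<in> {c..<d}})
      \<le> ennreal ((d - c) / (l - m)) * emeasure lborel (cyl w)"
    using cyl_upper[OF w cd] by (simp del: funpow.simps)
qed (use cd m_less in auto)

theorem invariant_measure_lower_left:
  assumes c: "l \<le> c" "c \<le> 1"
  shows "ennreal ((c - l) / (1 - l)) \<le> emeasure \<mu> {l..<c}"
proof -
  interpret prob_space \<mu> by fact
  have B: "{l..1} - {l..<c} \<in> sets borel" by auto
  have S: "{y \<in> {l..1}. (G ^^ n) y \<notin> {l..<c}} = {y \<in> {l..1}. (G ^^ n) y \<in> {l..1} - {l..<c}}" for n
    using measurable_space[OF G_pow_meas[of n]] unfolding space_restrict_space by auto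
  have "emeasure \<mu> ({l..1} - {l..<c}) \<le> ennreal (1 - (c - l) / (1 - l))"
  proof (rule cyl_upper_imp_upper[OF \<mu>])
    show "{y \<in> {l..1}. (G ^^ n) y \<notin> {l..<c}} \<in> sets LY" for n
      unfolding S by (rule sets_G_vimage[OF B])
    show "emeasure \<mu> {y \<in> {l..1}. (G ^^ n) y \<notin> {l..<c}} = emeasure \<mu> ({l..1} - {l..<c})" for n
      unfolding S by (rule invariant_pow[OF B]) auto
    show "0 \<le> 1 - (c - l) / (1 - l)" using c l_less by (simp add: field_simps)
  qed (rule cyl_lower_left[OF _ c])
  moreover have "emeasure \<mu> ({l..1} - {l..<c}) = 1 - emeasure \<mu> {l..<c}"
  proof -
    have "{l..<c} \<in> sets \<mu>" using c by (simp add: sets_mu sets_LY) auto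
    then show ?thesis using emeasure_compl[of "{l..<c}" \<mu>] emeasure_space_1 by (simp add: space_mu)
  qed
  ultimately have *: "1 - emeasure \<mu> {l..<c} \<le> ennreal (1 - (c - l) / (1 - l))" by simp
  have nn: "0 \<le> (c - l) / (1 - l)" "(c - l) / (1 - l) \<le> 1" using c l_less by (auto simp: field_simps)
  have "1 - prob {l..<c} \<le> 1 - (c - l) / (1 - l)"
    using * nn unfolding emeasure_eq_measure by (simp add: ennreal_minus flip: ennreal_1)
  then show ?thesis by (simp add: emeasure_eq_measure ennreal_leI)
qed

end

text \<open>Suppose \<open>A\<close> and its complement \<open>Ac\<close> both have positive length.
  By \<open>cyl_lower\<close> and invariance \<open>A\<close> occupies at least the fraction
  \<open>k * r\<close> of every cylinder. Let \<open>\<kappa>\<close> be normalised Lebesgue measure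
  on \<open>Ac\<close>; then \<open>cyl_upper_imp_upper\<close> with the constant sequence
  \<open>Ac\<close> yields \<kappa>(Ac) < 1, a contradiction. This takes the place of a density
  point argument.\<close>

theorem invariant_set_trivial:
  assumes A: "A \<in> sets borel" "A \<subseteq> {l..1}"
    and inv: "\<And>y. y \<in> {l..1} \<Longrightarrow> G y \<in> A \<longleftrightarrow> y \<in> A"
  shows "emeasure lborel A = 0 \<or> emeasure lborel ({l..1} - A) = 0"
proof (rule ccontr)
  assume neg: "\<not> ?thesis"
  obtain k where k: "k > 0" "\<And>n w B. w \<in> words n \<Longrightarrow> B \<in> sets borel \<Longrightarrow> B \<subseteq> {l..1} \<Longrightarrow>
       ennreal k * emeasure lborel (cyl w) * emeasure lborel B
         \<le> emeasure lborel {y \<in> cyl w. (G ^^ Suc (Suc n)) y \<in> B}"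
    by (rule cyl_lower) blast
  have GY: "G y \<in> {l..1}" if "y \<in> {l..1}" for y
    using measurable_space[OF G_meas, of y] that by (simp add: space_restrict_space)
  have pow: "(G ^^ n) y \<in> A \<longleftrightarrow> y \<in> A" if "y \<in> {l..1}" for n y
    using that
  proof (induction n arbitrary: y)
    case (Suc n)
    then show ?case using inv[of y] GY[of y] by (simp add: funpow_swap1)
  qed simp
  have fin: "emeasure lborel B < \<infinity>" if "B \<subseteq> {l..1}" for B
  proof -
    have "emeasure lborel B \<le> emeasure lborel {l..1}" using that by (intro emeasure_mono) auto
    then show ?thesis using l_less by (simp add: order_le_less_trans)
  qed
  have real: "\<exists>r>0. emeasure lborel B = ennreal r" if "B \<subseteq> {l..1}" "emeasure lborel B \<noteq> 0" for B
  proof (cases "emeasure lborel B")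
    case (real r)
    then show ?thesis using that(2) by (intro exI[of _ r]) (cases "r = 0", auto)
  qed (use fin[OF that(1)] in auto)
  obtain r where r: "emeasure lborel A = ennreal r" "r > 0"
    using real[OF A(2)] neg by auto
  define Ac where "Ac = {l..1} - A"
  have Ac: "Ac \<in> sets LY" using A by (auto simp: Ac_def sets_LY)
  obtain s where s: "emeasure lborel Ac = ennreal s" "s > 0"
    using real[of Ac] neg by (auto simp: Ac_def)
  define \<kappa> where "\<kappa> = density LY (\<lambda>x. ennreal (1 / s) * indicator Ac x)"
  have e\<kappa>: "emeasure \<kappa> B = ennreal (1 / s) * emeasure lborel (Ac \<inter> B)" if "B \<in> sets LY" for B
  proof -
    have "Ac \<inter> B \<in> sets LY" using that Ac by blast
    then have "emeasure \<kappa> B = ennreal (1 / s) * emeasure LY (Ac \<inter> B)"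
      using that Ac unfolding \<kappa>_def
      by (simp add: emeasure_density nn_integral_cmult mult.assoc flip: indicator_inter_arith)
    also have "emeasure LY (Ac \<inter> B) = emeasure lborel (Ac \<inter> B)"
      by (rule emeasure_LY) (auto simp: Ac_def)
    finally show ?thesis .
  qed
  have setsLY: "sets LY = sets (restrict_space borel {l..1})" by (intro sets_restrict_space_cong) simp
  have one: "ennreal (1 / s) * emeasure lborel Ac = 1"
    using s by (simp flip: ennreal_mult)
  \<comment> \<open>The maximum supplies the nonnegative constant that
    \<open>cyl_upper_imp_upper\<close> asks for.\<close>
  have "(1 :: ennreal) \<le> ennreal (max 0 (1 - k * r))"
  proof (rule cyl_upper_imp_upper[where S = "\<lambda>_. Ac" and \<mu> = \<kappa>])
    show "prob_space \<kappa>"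
    proof (rule prob_spaceI)
      have sp: "space \<kappa> = {l..1}" by (simp add: \<kappa>_def space_restrict_space)
      have "{l..1} \<in> sets LY" by (simp add: sets_LY)
      moreover have "Ac \<inter> {l..1} = Ac" by (auto simp: Ac_def)
      ultimately show "emeasure \<kappa> (space \<kappa>) = 1" using e\<kappa>[of "{l..1}"] one sp by simp
    qed
    show "sets \<kappa> = sets (restrict_space borel {l..1})" using setsLY by (simp add: \<kappa>_def)
    show "absolutely_continuous LY \<kappa>"
      unfolding \<kappa>_def using Ac by (intro absolutely_continuousI_density) auto
    show "emeasure \<kappa> Ac = 1" using e\<kappa>[OF Ac] one by simp
    fix n w assume w: "w \<in> words n"
    define M where "M = gw w 1 - gw w l"
    have M: "M \<ge> 0" "emeasure lborel (cyl w) = ennreal M"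
      using gw_le[OF w, of l 1] emeasure_cyl[OF w] l_less by (auto simp: M_def)
    have "{y \<in> cyl w. (G ^^ Suc (Suc n)) y \<in> A} = cyl w \<inter> A"
      using cyl_subset[OF w] pow[of _ "Suc (Suc n)"] by (auto simp del: funpow.simps)
    then have "ennreal (k * M * r) \<le> emeasure lborel (cyl w \<inter> A)"
      using k(2)[OF w A] k(1) r M by (simp add: ennreal_mult)
    moreover obtain a where a: "emeasure lborel (cyl w \<inter> A) = ennreal a" "a \<ge> 0"
      using fin[of "cyl w \<inter> A"] A by (cases "emeasure lborel (cyl w \<inter> A)") auto
    ultimately have 1: "k * M * r \<le> a" by simp
    obtain a' where a': "emeasure lborel (cyl w \<inter> Ac) = ennreal a'" "a' \<ge> 0"
      using fin[of "cyl w \<inter> Ac"] by (cases "emeasure lborel (cyl w \<inter> Ac)") (auto simp: Ac_def)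
    have Acb: "Ac \<in> sets borel" using Ac by (simp add: sets_LY)
    have "emeasure lborel (cyl w \<inter> A) + emeasure lborel (cyl w \<inter> Ac) =
        emeasure lborel ((cyl w \<inter> A) \<union> (cyl w \<inter> Ac))"
      using cyl_borel[OF w] A Acb by (intro plus_emeasure) (auto simp: Ac_def)
    also have "(cyl w \<inter> A) \<union> (cyl w \<inter> Ac) = cyl w" using cyl_subset[OF w] by (auto simp: Ac_def)
    finally have "a + a' = M" using a a' M by (simp flip: ennreal_plus)
    then have "a' \<le> (1 - k * r) * M" using 1 by (simp add: algebra_simps)
    also have "\<dots> \<le> max 0 (1 - k * r) * M" using M by (intro mult_right_mono) auto
    finally show "emeasure lborel (cyl w \<inter> Ac) \<le> ennreal (max 0 (1 - k * r)) * emeasure lborel (cyl w)"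
      unfolding a'(1) M(2) using M(1) by (subst ennreal_mult[symmetric]) (simp_all only: max.cobounded1 ennreal_leI)
  qed (use Ac in auto)
  then have "ennreal 1 \<le> ennreal (max 0 (1 - k * r))" by (simp only: ennreal_1)
  then have "1 \<le> max 0 (1 - k * r)" by (subst (asm) ennreal_le_iff) simp_all
  then show False using mult_pos_pos[OF k(1) r(2)] by (auto simp: max_def split: if_splits)
qed

end

section \<open>Inverse branches of the intermittent map\<close>

locale intermittent =
  fixes \<alpha> b :: real
  assumes alpha_pos: "0 < \<alpha>" and b_pos: "0 < b" and b_le: "b \<le> 1"
begin

text \<open>
  \<open>A\<close> is the map before reduction modulo 1, now on \<open>[0, \<infinity>)\<close>; \<open>L\<close> and \<open>R\<close> extend the
  inverses of the left and of the right branch of \<open>f\<close>. The interval \<open>[a m, a (m - 1))\<close> consists of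
  the points with return time \<open>m \<ge> 1\<close>, and \<open>Q m\<close> is the inverse of \<open>f\<^sup>\<tau>\<close> on it.
\<close>

definition A :: "real \<Rightarrow> real" where "A x = x * (1 + b * x powr \<alpha>)"
definition L :: "real \<Rightarrow> real" where "L = inv_into {0..} A"
definition R :: "real \<Rightarrow> real" where "R z = L (z + 1)"
definition e0 :: real where "e0 = L 1"
text \<open>The backward orbit of 1 under the left branch, running through \<open>p 1 = e0\<close>
  to the neutral fixed point 0.\<close>

definition p :: "nat \<Rightarrow> real" where "p n = (L ^^ n) 1"
definition Q :: "nat \<Rightarrow> real \<Rightarrow> real" where "Q m = R \<circ> (L ^^ (m - 1))"
definition a :: "nat \<Rightarrow> real" where "a n = R (p n)"
definition \<beta> :: real where "\<beta> = 1 / \<alpha>"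

lemma A_0: "A 0 = 0" and A_1: "A 1 = 1 + b" by (auto simp: A_def)

lemma A_expand:
  assumes "0 \<le> x" "x \<le> y" shows "(1 + b * x powr \<alpha>) * (y - x) \<le> A y - A x"
proof -
  have "y * (1 + b * x powr \<alpha>) \<le> y * (1 + b * y powr \<alpha>)"
    using assms b_pos alpha_pos by (intro mult_left_mono add_left_mono powr_mono2) auto
  then show ?thesis by (simp add: A_def algebra_simps)
qed

lemma A_diff: assumes "0 \<le> x" "x \<le> y" shows "y - x \<le> A y - A x"
proof -
  have "1 * (y - x) \<le> (1 + b * x powr \<alpha>) * (y - x)"
    using assms b_pos by (intro mult_right_mono) auto
  then show ?thesis using A_expand[OF assms] by simp
qed

lemma A_less: "0 \<le> x \<Longrightarrow> x < y \<Longrightarrow> A x < A y" using A_diff[of x y] by simp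

lemma A_le: "0 \<le> x \<Longrightarrow> x \<le> y \<Longrightarrow> A x \<le> A y" using A_diff[of x y] by simp

lemma A_ge: "0 \<le> x \<Longrightarrow> x \<le> A x" using A_diff[of 0 x] by (simp add: A_0)

lemma A_nonneg: "0 \<le> x \<Longrightarrow> 0 \<le> A x" using A_ge[of x] by simp

lemma A_image: "A ` {0..} = {0..}"
proof
  show "A ` {0..} \<subseteq> {0..}" using A_nonneg by auto
  have cont: "continuous_on {0..z} A" for z
    unfolding A_def using alpha_pos by (intro continuous_intros continuous_on_powr') auto
  show "{0..} \<subseteq> A ` {0..}"
  proof
    fix z :: real assume "z \<in> {0..}"
    then obtain x where "0 \<le> x" "x \<le> z" "A x = z"
      using IVT'[of A 0 z z, OF _ _ _ cont] A_ge[of z] by (auto simp: A_0)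
    then show "z \<in> A ` {0..}" by auto
  qed
qed

lemma A_inj: "inj_on A {0..}"
proof (rule inj_onI)
  fix x y assume "x \<in> {0..}" "y \<in> {0..}" "A x = A y"
  then show "x = y" using A_less[of x y] A_less[of y x] by (cases x y rule: linorder_cases) auto
qed

lemma A_L: "0 \<le> z \<Longrightarrow> A (L z) = z"
  unfolding L_def by (rule f_inv_into_f) (simp add: A_image)

lemma L_nonneg: "0 \<le> z \<Longrightarrow> 0 \<le> L z"
  using inv_into_into[of z A "{0..}"] by (simp add: A_image L_def)

lemma L_A: "0 \<le> x \<Longrightarrow> L (A x) = x"
  unfolding L_def by (rule inv_into_f_f[OF A_inj]) simp

lemma L_0: "L 0 = 0" using L_A[of 0] by (simp add: A_0)

lemma L_diff: "0 \<le> x \<Longrightarrow> x \<le> y \<Longrightarrow> L x \<le> L y \<and> L y - L x \<le> y - x"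
proof -
  assume xy: "0 \<le> x" "x \<le> y"
  have le: "L x \<le> L y"
  proof (rule ccontr)
    assume "\<not> L x \<le> L y"
    then have "A (L y) < A (L x)" using xy L_nonneg[of y] by (intro A_less) auto
    then show False using A_L xy by simp
  qed
  then show ?thesis using A_diff[of "L x" "L y"] A_L xy L_nonneg by simp
qed

lemma L_less: assumes "0 \<le> x" "x < y" shows "L x < L y"
proof (rule ccontr)
  assume "\<not> L x < L y"
  then have "A (L y) \<le> A (L x)" using assms L_nonneg[of y] by (intro A_le) auto
  then show False using A_L assms by simp
qed

lemma L_le: "0 \<le> z \<Longrightarrow> L z \<le> z" using A_ge[of "L z"] A_L[of z] L_nonneg[of z] by simp

lemma L_pos: "0 < z \<Longrightarrow> 0 < L z" using L_less[of 0 z] by (simp add: L_0)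

lemma A_deriv: assumes "0 < x" shows "(A has_real_derivative 1 + b * (1 + \<alpha>) * x powr \<alpha>) (at x)"
proof -
  have "((\<lambda>x. x * (1 + b * x powr \<alpha>)) has_real_derivative
     1 * (1 + b * x powr \<alpha>) + (0 + b * (\<alpha> * x powr (\<alpha> - 1))) * x) (at x)"
    using assms by (intro DERIV_mult DERIV_ident DERIV_add DERIV_const DERIV_cmult has_real_derivative_powr)
  moreover have "x powr (\<alpha> - 1) * x = x powr \<alpha>"
    using assms by (simp add: powr_diff)
  ultimately show ?thesis unfolding A_def by (simp add: algebra_simps)
qed

lemma A_slope:
  assumes "0 < x" "x \<le> y" "y \<le> u" "u \<le> v"
  shows "(A y - A x) * (v - u) \<le> (A v - A u) * (y - x)"
proof (cases "x = y \<or> u = v")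
  case False
  then have lt: "x < y" "u < v" using assms by auto
  obtain \<xi> where \<xi>: "x < \<xi>" "\<xi> < y" "A y - A x = (y - x) * (1 + b * (1 + \<alpha>) * \<xi> powr \<alpha>)"
    using MVT2[OF lt(1), of A "\<lambda>x. 1 + b * (1 + \<alpha>) * x powr \<alpha>"] A_deriv assms by auto
  obtain \<zeta> where \<zeta>: "u < \<zeta>" "\<zeta> < v" "A v - A u = (v - u) * (1 + b * (1 + \<alpha>) * \<zeta> powr \<alpha>)"
    using MVT2[OF lt(2), of A "\<lambda>x. 1 + b * (1 + \<alpha>) * x powr \<alpha>"] A_deriv assms by auto
  have "1 + b * (1 + \<alpha>) * \<xi> powr \<alpha> \<le> 1 + b * (1 + \<alpha>) * \<zeta> powr \<alpha>"
    using \<xi> \<zeta> assms b_pos alpha_pos by (intro add_left_mono mult_left_mono powr_mono2) auto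
  then have "(y - x) * (v - u) * (1 + b * (1 + \<alpha>) * \<xi> powr \<alpha>) \<le> (y - x) * (v - u) * (1 + b * (1 + \<alpha>) * \<zeta> powr \<alpha>)"
    using lt by (intro mult_left_mono) auto
  then show ?thesis unfolding \<xi> \<zeta> by (simp add: mult_ac)
qed auto

lemma A_lipschitz:
  assumes "0 < x" "x \<le> y" "y \<le> 1" shows "A y - A x \<le> (2 + \<alpha>) * (y - x)"
proof (cases "x = y")
  case False
  then have lt: "x < y" using assms by simp
  obtain \<xi> where \<xi>: "x < \<xi>" "\<xi> < y" "A y - A x = (y - x) * (1 + b * (1 + \<alpha>) * \<xi> powr \<alpha>)"
    using MVT2[OF lt, of A "\<lambda>x. 1 + b * (1 + \<alpha>) * x powr \<alpha>"] A_deriv assms by auto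
  have "b * (1 + \<alpha>) * \<xi> powr \<alpha> \<le> 1 * (1 + \<alpha>) * 1"
    using \<xi> assms b_pos b_le alpha_pos powr_mono2[of \<alpha> \<xi> 1] by (intro mult_mono) auto
  then have "(y - x) * (1 + b * (1 + \<alpha>) * \<xi> powr \<alpha>) \<le> (y - x) * (2 + \<alpha>)"
    using lt by (intro mult_left_mono) auto
  then show ?thesis by (simp add: \<xi> mult.commute)
qed simp

lemma concave_L: "concave_incr L"
proof (rule concave_incrI)
  fix x y u v :: real assume *: "0 < x" "x \<le> y" "y \<le> u" "u \<le> v"
  have "(A (L y) - A (L x)) * (L v - L u) \<le> (A (L v) - A (L u)) * (L y - L x)"
    by (rule A_slope) (use * L_pos L_diff in auto)
  then show "(L v - L u) * (y - x) \<le> (L y - L x) * (v - u)"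
    using * A_L by (simp add: mult.commute)
qed (use L_pos L_less in auto)

lemma concave_R: "concave_incr R"
proof (rule concave_incrI)
  fix x y u v :: real assume *: "0 < x" "x \<le> y" "y \<le> u" "u \<le> v"
  have "(L (v + 1) - L (u + 1)) * ((y + 1) - (x + 1)) \<le> (L (y + 1) - L (x + 1)) * ((v + 1) - (u + 1))"
    by (rule concave_incr_slope[OF concave_L]) (use * in auto)
  then show "(R v - R u) * (y - x) \<le> (R y - R x) * (v - u)" by (simp add: R_def)
qed (use L_pos L_less in \<open>auto simp: R_def\<close>)

lemma concave_Lpow: "concave_incr (L ^^ n)"
proof (induction n)
  case 0 then show ?case using concave_incr_id by (simp add: id_def)
next
  case (Suc n) then show ?case by (simp only: funpow.simps) (rule concave_incr_comp[OF concave_L])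
qed

lemma concave_Q: "concave_incr (Q m)"
  unfolding Q_def by (rule concave_incr_comp[OF concave_R concave_Lpow])

lemma A_e0: "A e0 = 1" by (simp add: e0_def A_L)

lemma e0_pos: "0 < e0" by (simp add: e0_def L_pos)

lemma e0_less: "e0 < 1"
proof (rule ccontr)
  assume "\<not> e0 < 1"
  then have "A 1 \<le> A e0" by (intro A_le) auto
  then show False using b_pos by (simp add: A_e0 A_1)
qed

lemma e0_inverse: "e0 * (1 + b * e0 powr \<alpha>) = 1" using A_e0 by (simp add: A_def)

lemma pm_disc_eq: "pm_disc \<alpha> b = e0"
  unfolding pm_disc_def
proof (rule the_equality)
  show "0 < e0 \<and> e0 < 1 \<and> e0 * (1 + b * e0 powr \<alpha>) = 1" using e0_pos e0_less e0_inverse by simp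
  fix x assume x: "0 < x \<and> x < 1 \<and> x * (1 + b * x powr \<alpha>) = 1"
  then have "A x = 1" by (simp add: A_def)
  then show "x = e0" using L_A[of x] x by (simp add: e0_def)
qed

lemma pm_base_eq: "pm_base \<alpha> b = {e0..1}" by (simp add: pm_base_def pm_disc_eq)

lemma R_nonneg: "0 \<le> z \<Longrightarrow> e0 \<le> R z" using L_diff[of 1 "z + 1"] by (simp add: R_def e0_def)

lemma R_pos: "0 < z \<Longrightarrow> e0 < R z" using L_less[of 1 "z + 1"] by (simp add: R_def e0_def)

lemma A_R: "0 \<le> z \<Longrightarrow> A (R z) = z + 1" by (simp add: R_def A_L)

text \<open>To the right of \<open>e0\<close> the chord slopes of \<open>A\<close> are at least
  \<open>1 + b * e0 powr \<alpha>\<close>, and this is 1/e0 by the equation that defines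
  \<open>e0\<close>.\<close>

lemma R_contr: assumes "0 \<le> x" "x \<le> y" shows "R y - R x \<le> e0 * (y - x)"
proof -
  have le: "R x \<le> R y" using L_diff[of "x + 1" "y + 1"] assms by (simp add: R_def)
  have "e0 powr \<alpha> \<le> R x powr \<alpha>"
    using R_nonneg[OF assms(1)] e0_pos alpha_pos by (intro powr_mono2) auto
  then have "(1 + b * e0 powr \<alpha>) * (R y - R x) \<le> (1 + b * R x powr \<alpha>) * (R y - R x)"
    using le b_pos by (intro mult_right_mono add_left_mono mult_left_mono) auto
  also have "\<dots> \<le> A (R y) - A (R x)"
    using le R_nonneg[OF assms(1)] e0_pos by (intro A_expand) auto
  also have "\<dots> = y - x" using assms by (simp add: A_R)
  finally have "e0 * ((1 + b * e0 powr \<alpha>) * (R y - R x)) \<le> e0 * (y - x)"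
    using e0_pos by (intro mult_left_mono) auto
  moreover have "e0 * ((1 + b * e0 powr \<alpha>) * (R y - R x)) = R y - R x"
    using e0_inverse by (metis mult.assoc mult_1)
  ultimately show ?thesis by simp
qed

lemma Lpow_nonneg: "0 \<le> z \<Longrightarrow> 0 \<le> (L ^^ n) z"
  by (induction n) (auto simp: L_nonneg)

lemma Lpow_diff: "0 \<le> x \<Longrightarrow> x \<le> y \<Longrightarrow> (L ^^ n) x \<le> (L ^^ n) y \<and> (L ^^ n) y - (L ^^ n) x \<le> y - x"
proof (induction n)
  case (Suc n)
  then show ?case using L_diff[of "(L ^^ n) x" "(L ^^ n) y"] Lpow_nonneg[of x n] by auto
qed simp

lemma Lpow_Apow: "0 \<le> z \<Longrightarrow> (L ^^ n) ((A ^^ n) z) = z"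
proof (induction n arbitrary: z)
  case (Suc n)
  have "(L ^^ Suc n) ((A ^^ Suc n) z) = L ((L ^^ n) ((A ^^ n) (A z)))"
    by (simp add: funpow_swap1)
  then show ?case using Suc A_nonneg[of z] by (simp add: L_A)
qed simp

lemma p_0: "p 0 = 1" and p_1: "p (Suc 0) = e0" and p_Suc: "p (Suc n) = L (p n)"
  by (auto simp: p_def e0_def)

lemma p_pos: "0 < p n" by (induction n) (auto simp: p_0 p_Suc L_pos)

lemma A_p: "A (p (Suc n)) = p n" using p_pos[of n] by (simp add: p_Suc A_L)

lemma p_step: "p n - p (Suc n) = b * p (Suc n) powr (1 + \<alpha>)"
  using A_p[of n] p_pos[of "Suc n"] by (simp add: A_def powr_add algebra_simps)

lemma p_less_Suc: "p (Suc n) < p n"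
  using p_step[of n] p_pos[of "Suc n"] b_pos by (metis diff_gt_0_iff_gt mult_pos_pos powr_gt_zero less_irrefl)

lemma p_less: "m < n \<Longrightarrow> p n < p m"
  by (rule lift_Suc_mono_less[of "\<lambda>n. - p n", simplified]) (auto simp: p_less_Suc)

lemma p_le: "m \<le> n \<Longrightarrow> p n \<le> p m" using p_less[of m n] by (cases "m = n") auto

lemma p_le_1: "p n \<le> 1" using p_le[of 0 n] by (simp add: p_0)

lemma Lpow_p: "(L ^^ n) (p m) = p (n + m)" by (simp add: p_def funpow_add)

lemma Q_e0: "1 \<le> m \<Longrightarrow> Q m e0 = a m"
  using Lpow_p[of "m - 1" 1] by (simp add: Q_def a_def p_1)

lemma Q_1: "1 \<le> m \<Longrightarrow> Q m 1 = a (m - 1)"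
  using Lpow_p[of "m - 1" 0] by (simp add: Q_def a_def p_0)

lemma Q_p2: "1 \<le> m \<Longrightarrow> Q m (p 2) = a (Suc m)"
  using Lpow_p[of "m - 1" 2] by (simp add: Q_def a_def)

lemma Q_nonneg: "0 \<le> z \<Longrightarrow> e0 \<le> Q m z" by (simp add: Q_def R_nonneg Lpow_nonneg)

lemma Q_contr: assumes "0 \<le> x" "x \<le> y" shows "Q m y - Q m x \<le> e0 * (y - x)"
proof -
  have "Q m y - Q m x \<le> e0 * ((L ^^ (m - 1)) y - (L ^^ (m - 1)) x)"
    unfolding Q_def comp_def using Lpow_diff[OF assms] Lpow_nonneg[OF assms(1)] by (intro R_contr) auto
  also have "\<dots> \<le> e0 * (y - x)" using Lpow_diff[OF assms] e0_pos by (intro mult_left_mono) auto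
  finally show ?thesis .
qed

section \<open>Asymptotics of \<open>p\<close>\<close>

lemma beta_pos: "0 < \<beta>" using alpha_pos by (simp add: \<beta>_def)

text \<open>In the coordinate p^-\<alpha> the recursion \<open>p n = p (Suc n) * (1 + s)\<close> is
  nearly a translation: the increment is r (1 - (1 + s)^-\<alpha>) with r s = b, and for 0 < s \<le>
  1 the bracket lies between \<alpha> s / (2 + \<alpha>) and \<alpha> s. Summation makes p^-\<alpha>
  grow linearly, so \<open>p n\<close> is of order n^-\<beta>.\<close>

lemma p_powr_step:
  "b * \<alpha> / (2 + \<alpha>) \<le> p (Suc n) powr (- \<alpha>) - p n powr (- \<alpha>)"
  "p (Suc n) powr (- \<alpha>) - p n powr (- \<alpha>) \<le> b * \<alpha>"
proof -
  define r where "r = p (Suc n) powr (- \<alpha>)"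
  define s where "s = b * p (Suc n) powr \<alpha>"
  have pp: "0 < p (Suc n)" by (rule p_pos)
  have r: "r > 0" using pp by (simp add: r_def)
  have s0: "s > 0" using pp b_pos by (simp add: s_def)
  have "p (Suc n) powr \<alpha> \<le> 1 powr \<alpha>"
    using pp p_le_1[of "Suc n"] alpha_pos by (intro powr_mono2) auto
  then have s1: "s \<le> 1" using b_le b_pos mult_mono[of b 1 "p (Suc n) powr \<alpha>" 1] by (simp add: s_def)
  have rs: "r * s = b" using pp by (simp add: r_def s_def powr_minus field_simps)
  have "p n = p (Suc n) * (1 + s)" using A_p[of n] by (simp add: A_def s_def)
  then have pn: "p n powr (- \<alpha>) = r * (1 + s) powr (- \<alpha>)"
    using pp s0 by (simp add: powr_mult r_def)
  have ex: "(1 + s) powr (- \<alpha>) = exp (- (\<alpha> * ln (1 + s)))" using s0 by (simp add: powr_def)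
  have "1 - \<alpha> * s \<le> 1 - \<alpha> * ln (1 + s)"
    using ln_add_one_self_le_self[of s] s0 alpha_pos by simp
  also have "\<dots> \<le> (1 + s) powr (- \<alpha>)"
    unfolding ex using exp_ge_add_one_self[of "- (\<alpha> * ln (1 + s))"] by simp
  finally have "r * (1 - (1 + s) powr (- \<alpha>)) \<le> r * (\<alpha> * s)"
    using r by (intro mult_left_mono) auto
  then show "p (Suc n) powr (- \<alpha>) - p n powr (- \<alpha>) \<le> b * \<alpha>"
    unfolding pn r_def[symmetric] using rs by (simp add: algebra_simps)
  have "ln (1 / (1 + s)) \<le> 1 / (1 + s) - 1" using s0 by (intro ln_le_minus_one) auto
  then have "s / (1 + s) \<le> ln (1 + s)" using s0 by (simp add: ln_div field_simps)
  moreover have "s / 2 \<le> s / (1 + s)" using s0 s1 by (intro divide_left_mono) auto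
  ultimately have "s / 2 \<le> ln (1 + s)" by linarith
  then have "\<alpha> * (s / 2) \<le> \<alpha> * ln (1 + s)" using alpha_pos by (intro mult_left_mono) auto
  then have "1 + \<alpha> * s / 2 \<le> exp (\<alpha> * ln (1 + s))"
    using exp_ge_add_one_self[of "\<alpha> * ln (1 + s)"] by linarith
  then have "(1 + s) powr (- \<alpha>) \<le> 1 / (1 + \<alpha> * s / 2)"
    unfolding ex exp_minus inverse_eq_divide[symmetric] using mult_pos_pos[OF alpha_pos s0]
    by (intro le_imp_inverse_le) auto
  moreover have "1 - 1 / (1 + \<alpha> * s / 2) = \<alpha> * s / (2 + \<alpha> * s)"
  proof -
    have "1 - 1 / (1 + t / 2) = t / (2 + t)" if "t > 0" for t :: real
      using that by (simp add: field_simps)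
    then show ?thesis using mult_pos_pos[OF alpha_pos s0] by blast
  qed
  moreover have "\<alpha> * s / (2 + \<alpha>) \<le> \<alpha> * s / (2 + \<alpha> * s)"
    using s0 s1 alpha_pos mult_left_le[of s \<alpha>] by (intro divide_left_mono) (auto intro!: mult_pos_pos add_pos_pos)
  ultimately have "\<alpha> * s / (2 + \<alpha>) \<le> 1 - (1 + s) powr (- \<alpha>)" by simp
  then have "r * (\<alpha> * s / (2 + \<alpha>)) \<le> r * (1 - (1 + s) powr (- \<alpha>))"
    using r by (intro mult_left_mono) auto
  moreover have "r * (\<alpha> * s / (2 + \<alpha>)) = b * \<alpha> / (2 + \<alpha>)" using rs by (simp add: mult_ac)
  ultimately have "b * \<alpha> / (2 + \<alpha>) \<le> r * (1 - (1 + s) powr (- \<alpha>))" by (simp only:)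
  then show "b * \<alpha> / (2 + \<alpha>) \<le> p (Suc n) powr (- \<alpha>) - p n powr (- \<alpha>)"
    unfolding pn r_def[symmetric] by (simp only: right_diff_distrib mult_1_right)
qed

lemma p_powr_bounds:
  "1 + real n * (b * \<alpha> / (2 + \<alpha>)) \<le> p n powr (- \<alpha>)"
  "p n powr (- \<alpha>) \<le> 1 + real n * (b * \<alpha>)"
proof (induction n)
  case (Suc n)
  have *: "real (Suc n) * c = real n * c + c" for c :: real by (simp add: algebra_simps)
  case 1 then show ?case unfolding * using p_powr_step(1)[of n] Suc by linarith
  case 2 then show ?case unfolding * using p_powr_step(2)[of n] Suc by linarith
qed (simp_all add: p_0)

lemma p_eq_powr: "p n = (p n powr (- \<alpha>)) powr (- \<beta>)"
  using p_pos[of n] alpha_pos by (simp add: powr_powr \<beta>_def)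

lemma p_upper:
  obtains C where "C > 0" "\<And>n. n \<ge> 1 \<Longrightarrow> p n \<le> C * real n powr (- \<beta>)"
proof
  let ?c = "b * \<alpha> / (2 + \<alpha>)"
  have c: "?c > 0" using b_pos alpha_pos by simp
  then show "0 < ?c powr (- \<beta>)" by (metis powr_gt_zero less_irrefl)
  fix n :: nat assume "n \<ge> 1"
  have "p n = (p n powr (- \<alpha>)) powr (- \<beta>)" by (rule p_eq_powr)
  also have "\<dots> \<le> (real n * ?c) powr (- \<beta>)"
  proof (rule powr_mono2')
    show "0 < real n * ?c" by (rule mult_pos_pos[OF _ c]) (use \<open>n \<ge> 1\<close> in simp)
    show "real n * ?c \<le> p n powr (- \<alpha>)" using p_powr_bounds(1)[of n] by linarith
  qed (use beta_pos in simp)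
  also have "\<dots> = ?c powr (- \<beta>) * real n powr (- \<beta>)"
    by (simp only: powr_mult mult.commute)
  finally show "p n \<le> ?c powr (- \<beta>) * real n powr (- \<beta>)" .
qed

lemma p_lower:
  obtains C where "C > 0" "\<And>n. n \<ge> 1 \<Longrightarrow> C * real n powr (- \<beta>) \<le> p n"
proof
  let ?c = "1 + b * \<alpha>"
  have c: "?c > 0" using b_pos alpha_pos by (simp add: add_pos_pos)
  then show "0 < ?c powr (- \<beta>)" by (metis powr_gt_zero less_irrefl)
  fix n :: nat assume n: "n \<ge> 1"
  have "?c powr (- \<beta>) * real n powr (- \<beta>) = (real n * ?c) powr (- \<beta>)"
    by (simp only: powr_mult mult.commute)
  also have "\<dots> \<le> (p n powr (- \<alpha>)) powr (- \<beta>)"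
  proof (rule powr_mono2')
    show "p n powr (- \<alpha>) \<le> real n * ?c" using p_powr_bounds(2)[of n] n by (simp add: algebra_simps)
  qed (use p_pos[of n] beta_pos in auto)
  finally show "?c powr (- \<beta>) * real n powr (- \<beta>) \<le> p n" using p_eq_powr[of n] by simp
qed

lemma p_tendsto_0: "p \<longlonglongrightarrow> 0"
proof -
  obtain C where C: "C > 0" "\<And>n. n \<ge> 1 \<Longrightarrow> p n \<le> C * real n powr (- \<beta>)" by (rule p_upper) blast
  have "(\<lambda>n. C * real n powr (- \<beta>)) \<longlonglongrightarrow> C * 0"
    using beta_pos by (intro tendsto_mult tendsto_const tendsto_neg_powr filterlim_real_sequentially) auto
  then have lim: "(\<lambda>n. C * real n powr (- \<beta>)) \<longlonglongrightarrow> 0" by simp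
  show ?thesis
  proof (rule tendsto_sandwich[OF _ _ tendsto_const lim])
    show "\<forall>\<^sub>F n in sequentially. p n \<le> C * real n powr (- \<beta>)"
      by (rule eventually_mono[OF eventually_ge_at_top[of 1]]) (use C in auto)
    show "\<forall>\<^sub>F n in sequentially. 0 \<le> p n" using p_pos by (auto intro!: always_eventually less_imp_le)
  qed
qed

text \<open>By \<open>p_step\<close> the difference is at most p^(1+\<alpha>), and \<beta> (1 +
  \<alpha>) = 1 + \<beta>.\<close>

lemma p_diff_upper:
  obtains C where "C > 0" "\<And>n. n \<ge> 1 \<Longrightarrow> p n - p (Suc n) \<le> C * real n powr (- (1 + \<beta>))"
proof -
  obtain C where C: "C > 0" "\<And>n. n \<ge> 1 \<Longrightarrow> p n \<le> C * real n powr (- \<beta>)" by (rule p_upper) blast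
  have "p n - p (Suc n) \<le> C powr (1 + \<alpha>) * real n powr (- (1 + \<beta>))" if n: "n \<ge> 1" for n
  proof -
    have "p n - p (Suc n) = b * p (Suc n) powr (1 + \<alpha>)" by (rule p_step)
    also have "\<dots> \<le> 1 * p (Suc n) powr (1 + \<alpha>)" using b_le by (intro mult_right_mono) auto
    also have "p (Suc n) powr (1 + \<alpha>) \<le> p n powr (1 + \<alpha>)"
      using p_less_Suc[of n] p_pos[of "Suc n"] alpha_pos by (intro powr_mono2) auto
    also have "p n powr (1 + \<alpha>) \<le> (C * real n powr (- \<beta>)) powr (1 + \<alpha>)"
      using C(2)[OF n] p_pos[of n] alpha_pos by (intro powr_mono2) auto
    also have "\<dots> = C powr (1 + \<alpha>) * real n powr (- \<beta> * (1 + \<alpha>))"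
      using C n by (simp add: powr_mult powr_powr)
    also have "- \<beta> * (1 + \<alpha>) = - (1 + \<beta>)" using alpha_pos by (simp add: \<beta>_def field_simps)
    finally show ?thesis by simp
  qed
  then show thesis using that[of "C powr (1 + \<alpha>)"] C by simp
qed

text \<open>To the right of \<open>e0 = p 1\<close> the concave map \<open>L ^^ (m - 1)\<close> is
  no steeper than on \<open>[p 2, p 1]\<close>, an interval it sends onto
  \<open>[p (Suc m), p m]\<close>.\<close>

lemma Q_contr_powr:
  obtains C where "C > 0"
    "\<And>m x y. m \<ge> 1 \<Longrightarrow> e0 \<le> x \<Longrightarrow> x \<le> y \<Longrightarrow> Q m y - Q m x \<le> C * real m powr (- (1 + \<beta>)) * (y - x)"
proof -
  obtain C where C: "C > 0" "\<And>n. n \<ge> 1 \<Longrightarrow> p n - p (Suc n) \<le> C * real n powr (- (1 + \<beta>))"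
    by (rule p_diff_upper) blast
  define d where "d = p 1 - p 2"
  have d: "d > 0" using p_less[of 1 2] by (simp add: d_def)
  have "Q m y - Q m x \<le> C / d * real m powr (- (1 + \<beta>)) * (y - x)"
    if m: "m \<ge> 1" and xy: "e0 \<le> x" "x \<le> y" for m x y
  proof -
    let ?g = "L ^^ (m - 1)"
    have x0: "0 \<le> x" using xy e0_pos by simp
    have "Q m y - Q m x \<le> e0 * (?g y - ?g x)"
      unfolding Q_def comp_def using Lpow_diff[OF x0 xy(2)] Lpow_nonneg[OF x0] by (intro R_contr) auto
    also have "\<dots> \<le> 1 * (?g y - ?g x)"
      using e0_less Lpow_diff[OF x0 xy(2), of "m - 1"] by (intro mult_right_mono) auto
    finally have 1: "Q m y - Q m x \<le> ?g y - ?g x" by simp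
    have "(?g y - ?g x) * (p 1 - p 2) \<le> (?g (p 1) - ?g (p 2)) * (y - x)"
      by (rule concave_incr_slope[OF concave_Lpow]) (use xy p_pos p_less[of 1 2] in \<open>auto simp: p_1\<close>)
    also have "?g (p 1) - ?g (p 2) = p m - p (Suc m)"
      using m by (simp add: Lpow_p)
    also have "\<dots> * (y - x) \<le> C * real m powr (- (1 + \<beta>)) * (y - x)"
      using C(2)[OF m] xy by (intro mult_right_mono) auto
    finally have "?g y - ?g x \<le> C / d * real m powr (- (1 + \<beta>)) * (y - x)"
      using d by (simp add: d_def field_simps)
    with 1 show ?thesis by simp
  qed
  then show thesis using that[of "C / d"] C d by simp
qed

end

section \<open>Return times and the points \<open>e\<^sub>k\<close>\<close>

lemma first_return_eqI:
  assumes "1 \<le> m" "(f ^^ m) y \<in> Y" "\<And>n. 1 \<le> n \<Longrightarrow> n < m \<Longrightarrow> (f ^^ n) y \<notin> Y"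
  shows "first_return f Y y = enat m"
  unfolding first_return_def
proof (rule antisym)
  show "(INF n\<in>{n. 1 \<le> n \<and> (f ^^ n) y \<in> Y}. enat n) \<le> enat m"
    by (rule INF_lower) (use assms in auto)
  show "enat m \<le> (INF n\<in>{n. 1 \<le> n \<and> (f ^^ n) y \<in> Y}. enat n)"
    by (rule INF_greatest) (use assms in \<open>force simp: not_less[symmetric]\<close>)
qed

lemma first_return_infI:
  assumes "\<And>n. 1 \<le> n \<Longrightarrow> (f ^^ n) y \<notin> Y" shows "first_return f Y y = \<infinity>"
proof -
  have "{n. 1 \<le> n \<and> (f ^^ n) y \<in> Y} = {}" using assms by auto
  then show ?thesis unfolding first_return_def by (simp only: image_empty Inf_empty) (simp add: top_enat_def)
qed

context intermittent begin

abbreviation f :: "real \<Rightarrow> real" where "f \<equiv> pm_map \<alpha> b"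
abbreviation \<tau> :: "real \<Rightarrow> enat" where "\<tau> \<equiv> pm_tau \<alpha> b"
abbreviation e :: "nat \<Rightarrow> real" where "e \<equiv> pm_e \<alpha> b"
abbreviation \<rho> :: "real \<Rightarrow> nat" where "\<rho> \<equiv> pm_rho \<alpha> b"
abbreviation \<phi> :: "real \<Rightarrow> enat" where "\<phi> \<equiv> pm_phi \<alpha> b"
abbreviation F :: "real \<Rightarrow> real" where "F \<equiv> induced_map f \<tau>"

section \<open>Return times on the branches \<open>Q m\<close>\<close>

lemma f_eq: "f x = frac (A x)" by (simp add: pm_map_def A_def)

lemma f_unique: "A x - c \<in> \<int> \<Longrightarrow> 0 \<le> c \<Longrightarrow> c < 1 \<Longrightarrow> f x = c"
  unfolding f_eq by (subst frac_unique_iff) auto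

lemma f_L: "0 \<le> z \<Longrightarrow> z < 1 \<Longrightarrow> f (L z) = z" by (rule f_unique) (auto simp: A_L)

lemma f_R: "0 \<le> z \<Longrightarrow> z < 1 \<Longrightarrow> f (R z) = z" by (rule f_unique) (auto simp: A_R)

lemma Lpow_less_1: "0 \<le> x \<Longrightarrow> x < 1 \<Longrightarrow> (L ^^ n) x < 1"
  using Lpow_nonneg L_le by (induction n) (auto intro: le_less_trans)

lemma Lpow_less_e0: assumes "0 \<le> x" "x < 1" shows "(L ^^ Suc n) x < e0"
  unfolding e0_def funpow.simps comp_def
  by (rule L_less) (use assms Lpow_less_1 Lpow_nonneg in auto)

lemma f_Lpow:
  assumes "0 \<le> x" "x < 1" "i \<le> n" shows "(f ^^ i) ((L ^^ n) x) = (L ^^ (n - i)) x"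
  using assms(3)
proof (induction i)
  case (Suc i)
  then have "(f ^^ Suc i) ((L ^^ n) x) = f ((L ^^ (n - i)) x)" by simp
  also have "n - i = Suc (n - Suc i)" using Suc.prems by simp
  also have "f ((L ^^ Suc (n - Suc i)) x) = (L ^^ (n - Suc i)) x"
    using f_L[OF Lpow_nonneg Lpow_less_1] assms by simp
  finally show ?case .
qed simp

lemma f_Q:
  assumes "1 \<le> m" "0 \<le> x" "x < 1" "1 \<le> i" "i \<le> m"
  shows "(f ^^ i) (Q m x) = (L ^^ (m - i)) x"
proof -
  obtain j where j: "i = Suc j" using assms(4) by (cases i) auto
  have "(f ^^ i) (Q m x) = (f ^^ j) (f (Q m x))" by (simp only: j funpow_Suc_right comp_apply)
  also have "f (Q m x) = (L ^^ (m - 1)) x"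
    unfolding Q_def comp_apply by (rule f_R[OF Lpow_nonneg Lpow_less_1]) (use assms in auto)
  also have "(f ^^ j) ((L ^^ (m - 1)) x) = (L ^^ (m - 1 - j)) x"
    by (rule f_Lpow) (use assms j in auto)
  finally show ?thesis using j by simp
qed

lemma tau_Q: assumes "1 \<le> m" "e0 \<le> x" "x < 1" shows "\<tau> (Q m x) = enat m"
  unfolding pm_tau_def pm_base_eq
proof (rule first_return_eqI)
  have x0: "0 \<le> x" using assms e0_pos by simp
  show "(f ^^ m) (Q m x) \<in> {e0..1}" using f_Q[OF assms(1) x0 assms(3), of m] assms by simp
  fix n assume n: "1 \<le> n" "n < m"
  then have "(f ^^ n) (Q m x) = (L ^^ Suc (m - Suc n)) x"
    using f_Q[OF assms(1) x0 assms(3), of n] by (simp add: Suc_diff_Suc del: funpow.simps)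
  also have "\<dots> < e0" by (rule Lpow_less_e0[OF x0 assms(3)])
  finally show "(f ^^ n) (Q m x) \<notin> {e0..1}" by simp
qed (use assms in auto)

lemma fpow_Q: "1 \<le> m \<Longrightarrow> e0 \<le> x \<Longrightarrow> x < 1 \<Longrightarrow> (f ^^ m) (Q m x) = x"
  using f_Q[of m x m] e0_pos by simp

lemma F_Q: "1 \<le> m \<Longrightarrow> e0 \<le> x \<Longrightarrow> x < 1 \<Longrightarrow> F (Q m x) = x"
  by (simp add: induced_map_def tau_Q fpow_Q)

lemma f_0: "f 0 = 0" by (simp add: f_eq A_0)

lemma tau_inf: assumes "f y = 0" shows "\<tau> y = \<infinity>"
  unfolding pm_tau_def pm_base_eq
proof (rule first_return_infI)
  fix n :: nat assume "1 \<le> n"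
  then obtain j where "n = Suc j" by (cases n) auto
  moreover have "(f ^^ j) 0 = 0" by (induction j) (auto simp: f_0)
  ultimately have "(f ^^ n) y = 0" using assms by (simp only: funpow_Suc_right comp_apply)
  then show "(f ^^ n) y \<notin> {e0..1}" using e0_pos by simp
qed

lemma tau_e0: "\<tau> e0 = \<infinity>" by (rule tau_inf) (simp add: f_eq A_e0)

text \<open>For \<open>b = 1\<close> not only \<open>e0\<close> but also the end point 1 falls onto
  the fixed point 0 and never returns. This degenerate case is the reason for most of the case
  distinctions at 1 below.\<close>

lemma tau_1: assumes "b = 1" shows "\<tau> 1 = \<infinity>"
proof (rule tau_inf)
  have "A 1 = 2" using A_1 assms by simp
  then show "f 1 = 0" unfolding f_eq by (simp add: frac_eq_0_iff)
qed

lemma R_0: "R 0 = e0" by (simp add: R_def e0_def)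

text \<open>The return time is read off from the position of \<open>A z - 1\<close> among the
  \<open>p n\<close>. For \<open>z \<le> 1\<close> the bound \<open>A z < 2\<close> excludes nothing
  but \<open>z = 1\<close> with \<open>b = 1\<close>.\<close>

lemma Q_exhaust:
  assumes "e0 < z" "A z < 2"
  obtains m x where "1 \<le> m" "e0 \<le> x" "x < 1" "z = Q m x"
proof -
  define v where "v = A z - 1"
  have v: "0 < v" "v < 1" using A_less[of e0 z] assms e0_pos by (auto simp: v_def A_e0)
  have "\<forall>\<^sub>F n in sequentially. p n < v" using p_tendsto_0 v(1) by (rule order_tendstoD)
  then obtain n0 where "p n0 \<le> v" unfolding eventually_sequentially by (meson order_refl less_imp_le)
  define m where "m = (LEAST n. p n \<le> v)"
  have m: "p m \<le> v" unfolding m_def by (rule LeastI) fact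
  have m1: "1 \<le> m" using m v(2) p_0 by (cases m) auto
  have m2: "v < p (m - 1)"
    using not_less_Least[of "m - 1" "\<lambda>n. p n \<le> v"] m1 unfolding m_def[symmetric] by auto
  define x where "x = (A ^^ (m - 1)) v"
  have Lx: "(L ^^ (m - 1)) x = v" using Lpow_Apow v by (simp add: x_def)
  have Ap: "0 < (A ^^ i) u" if "0 < u" for i u
    using that A_ge by (induction i) (auto intro: less_le_trans)
  have xpos: "0 < x" using Ap v by (simp add: x_def)
  have "(L ^^ (m - 1)) e0 \<le> (L ^^ (m - 1)) x"
    using Lpow_p[of "m - 1" 1] m m1 Lx by (simp add: p_1)
  then have "e0 \<le> x" using concave_incr_le_iff[OF concave_Lpow] e0_pos xpos by blast
  moreover have "(L ^^ (m - 1)) x < (L ^^ (m - 1)) 1" using m2 Lx by (simp add: p_def)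
  then have "x < 1" using concave_incr_less_iff[OF concave_Lpow] xpos by force
  moreover have "z = Q m x" unfolding Q_def comp_apply Lx R_def v_def using L_A[of z] assms e0_pos by simp
  ultimately show thesis using that m1 by blast
qed

lemma A_Q: assumes "1 \<le> m" "0 \<le> x" "x < 1" shows "A (Q m x) < 2"
  using A_R[of "(L ^^ (m - 1)) x"] Lpow_nonneg[OF assms(2)] Lpow_less_1[OF assms(2,3)]
  by (simp add: Q_def)

lemma a_tendsto: "a \<longlonglongrightarrow> e0"
proof -
  have "a n \<le> e0 + e0 * p n" for n
    using R_contr[of 0 "p n"] p_pos[of n] by (simp add: a_def R_0)
  moreover have "(\<lambda>n. e0 + e0 * p n) \<longlonglongrightarrow> e0 + e0 * 0"
    by (intro tendsto_intros p_tendsto_0)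
  moreover have "e0 \<le> a n" for n using R_nonneg p_pos by (simp add: a_def less_imp_le)
  ultimately show ?thesis
    by (intro tendsto_sandwich[OF _ _ tendsto_const, of e0 a _ "\<lambda>n. e0 + e0 * p n"]) auto
qed

lemma a_gt: "e0 < a n" using R_pos p_pos by (simp add: a_def)

lemma a_less: "m < n \<Longrightarrow> a n < a m"
  using concave_incr_less[OF concave_R p_pos p_less] by (simp add: a_def)

lemma a_le: "m \<le> n \<Longrightarrow> a n \<le> a m" using a_less[of m n] by (cases "m = n") auto

lemma a_le_iff: "a n \<le> a m \<longleftrightarrow> m \<le> n" by (meson a_le a_less not_less)

text \<open>The bound \<open>1 \<le> n\<close> matters at \<open>w = 1\<close> with
  \<open>b = 1\<close>: there \<open>a 0 = 1\<close>, but a return takes at least one step.\<close>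

definition Nw :: "real \<Rightarrow> nat" where "Nw w = (LEAST n. 1 \<le> n \<and> a n \<le> w)"

lemma Nw:
  assumes "e0 < w"
  shows "1 \<le> Nw w" "a (Nw w) \<le> w" "\<And>n. 1 \<le> n \<Longrightarrow> n < Nw w \<Longrightarrow> w < a n"
proof -
  have "\<forall>\<^sub>F n in sequentially. a n < w \<and> 1 \<le> n"
    using order_tendstoD(2)[OF a_tendsto assms] eventually_ge_at_top[of 1] by (rule eventually_conj)
  then obtain n0 where "1 \<le> n0 \<and> a n0 \<le> w" unfolding eventually_sequentially by (meson order_refl less_imp_le)
  then have "1 \<le> Nw w \<and> a (Nw w) \<le> w" unfolding Nw_def by (rule LeastI)
  then show "1 \<le> Nw w" "a (Nw w) \<le> w" by auto
  fix n assume "1 \<le> n" "n < Nw w"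
  then show "w < a n" using not_less_Least[of n "\<lambda>n. 1 \<le> n \<and> a n \<le> w"] unfolding Nw_def by auto
qed

text \<open>
  The \<open>k\<close>-th return map sends \<open>[e\<^sub>k, 1)\<close> onto \<open>[e0, w k)\<close> with inverse \<open>h k\<close> and return time \<open>t k\<close>.
  The rightmost branch of the next return on \<open>[e0, w k)\<close>, which need not be full, starts at \<open>a (N k)\<close>
  and has return time \<open>N k\<close>. The construction of the paper stops at \<open>e\<^sub>k = 1\<close> iff \<open>w k = e0\<close>;
  \<open>N k\<close> is junk from then on.
\<close>

primrec w :: "nat \<Rightarrow> real" where
  "w 0 = 1"
| "w (Suc k) = (if w k = e0 then e0 else (A ^^ (Nw (w k) - 1)) (A (w k) - 1))"

definition N :: "nat \<Rightarrow> nat" where "N k = Nw (w k)"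

primrec h :: "nat \<Rightarrow> real \<Rightarrow> real" where
  "h 0 = id"
| "h (Suc k) = (if w k = e0 then h k else h k \<circ> Q (N k))"

definition t :: "nat \<Rightarrow> nat" where "t k = (\<Sum>j<k. N j)"

lemma w_Suc_Q: assumes "e0 < w k" shows "0 < w (Suc k)" "Q (N k) (w (Suc k)) = w k"
proof -
  define v where "v = A (w k) - 1"
  have v: "0 < v" using A_less[of e0 "w k"] assms e0_pos by (simp add: v_def A_e0)
  have ws: "w (Suc k) = (A ^^ (N k - 1)) v" using assms by (simp add: N_def v_def)
  have Ap: "0 < (A ^^ i) u" if "0 < u" for i u
    using that A_ge by (induction i) (auto intro: less_le_trans)
  show "0 < w (Suc k)" unfolding ws using Ap v by simp
  show "Q (N k) (w (Suc k)) = w k"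
    unfolding ws Q_def comp_apply using Lpow_Apow[of v] v L_A[of "w k"] assms e0_pos
    by (simp add: R_def v_def)
qed

text \<open>The upper bound amounts to \<open>w k \<le> a (N k - 1)\<close>. For
  \<open>N k > 1\<close> this is minimality of \<open>N k\<close>; for \<open>N k = 1\<close> it
  follows from \<open>A (w k) \<le> 1 + b \<le> 2\<close>.\<close>

lemma w_range: "e0 \<le> w k \<and> w k \<le> 1"
proof (induction k)
  case 0 then show ?case using e0_less by simp
next
  case (Suc k)
  show ?case
  proof (cases "w k = e0")
    case True then show ?thesis using e0_less by simp
  next
    case False
    then have act: "e0 < w k" using Suc by simp
    note N = Nw[OF act, folded N_def]
    note ws = w_Suc_Q[OF act]
    have "Q (N k) e0 \<le> Q (N k) (w (Suc k))" using N ws by (simp add: Q_e0)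
    then have 1: "e0 \<le> w (Suc k)" using concave_incr_le_iff[OF concave_Q e0_pos ws(1)] by simp
    have "w k \<le> a (N k - 1)"
    proof (cases "N k = 1")
      case True
      have "A (w k) \<le> 2" using A_le[of "w k" 1] Suc e0_pos b_le by (auto simp: A_1)
      then have "L (A (w k)) \<le> L 2" using A_nonneg[of "w k"] Suc e0_pos by (intro L_diff[THEN conjunct1]) auto
      then show ?thesis using True L_A[of "w k"] act e0_pos by (simp add: a_def R_def p_0)
    next
      case False
      then show ?thesis using N(3)[of "N k - 1"] N(1) by (simp add: less_imp_le)
    qed
    then have "Q (N k) (w (Suc k)) \<le> Q (N k) 1" using N ws by (simp add: Q_1)
    then have "w (Suc k) \<le> 1" using concave_incr_le_iff[OF concave_Q ws(1)] by simp
    then show ?thesis using 1 by blast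
  qed
qed

lemma act: "w k \<noteq> e0 \<Longrightarrow> e0 < w k" using w_range[of k] by simp

lemma act_mono: "w k \<noteq> e0 \<Longrightarrow> j \<le> k \<Longrightarrow> w j \<noteq> e0"
proof (induction k)
  case (Suc k) then show ?case by (cases "j = Suc k") (auto split: if_splits)
qed simp

text \<open>Here \<open>w k = a (N k - 1)\<close>, which minimality of \<open>N k\<close> permits
  only if \<open>N k = 1\<close>. Then \<open>A (w k) = 2\<close>, while
  \<open>A 1 = 1 + b\<close>.\<close>

lemma w_eq_1: assumes "w (Suc k) = 1" shows "b = 1"
proof -
  have nz: "w k \<noteq> e0" using assms e0_less by auto
  note N = Nw[OF act[OF nz], folded N_def]
  have eq: "w k = a (N k - 1)" using w_Suc_Q[OF act[OF nz]] N assms by (simp add: Q_1)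
  have "N k = 1"
  proof (rule ccontr)
    assume "N k \<noteq> 1"
    then have "w k < a (N k - 1)" using N(1) N(3)[of "N k - 1"] by simp
    then show False using eq by simp
  qed
  then have "w k = R 1" using eq by (simp add: a_def p_0)
  then have "A (w k) = 2" by (simp add: A_R)
  moreover have "A (w k) \<le> A 1" using w_range[of k] e0_pos by (intro A_le) auto
  ultimately show "b = 1" using b_le by (simp add: A_1)
qed

lemma concave_h: "concave_incr (h k)"
  by (induction k) (auto simp: concave_incr_id[unfolded id_def] id_def intro!: concave_incr_comp concave_Q)

lemma h_ge: "e0 \<le> z \<Longrightarrow> e0 \<le> h k z"
proof (induction k arbitrary: z)
  case (Suc k) then show ?case using Q_nonneg[of z "N k"] e0_pos by auto
qed simp

lemma h_w: "h k (w k) = 1"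
proof (induction k)
  case (Suc k)
  then show ?case using w_Suc_Q(2)[of k] act[of k] by auto
qed simp

lemma h_contr: assumes "\<And>j. j < k \<Longrightarrow> w j \<noteq> e0" "e0 \<le> x" "x \<le> y"
  shows "h k y - h k x \<le> e0 ^ k * (y - x)"
  using assms
proof (induction k arbitrary: x y)
  case (Suc k)
  have x0: "0 < x" "0 \<le> x" using Suc.prems e0_pos by auto
  have le: "Q (N k) x \<le> Q (N k) y" using concave_incr_le[OF concave_Q x0(1)] Suc.prems by simp
  have "h (Suc k) y - h (Suc k) x = h k (Q (N k) y) - h k (Q (N k) x)" using Suc.prems(1)[of k] by simp
  also have "\<dots> \<le> e0 ^ k * (Q (N k) y - Q (N k) x)"
    by (rule Suc.IH) (use Suc.prems x0 le Q_nonneg in auto)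
  also have "\<dots> \<le> e0 ^ k * (e0 * (y - x))"
    using Q_contr[OF x0(2) Suc.prems(3)] e0_pos by (intro mult_left_mono) auto
  finally show ?case by (simp add: mult_ac)
qed simp

lemma h_cont: "continuous_on {e0..} (h k)"
proof (induction k)
  case (Suc k)
  have "1-lipschitz_on {e0..} (Q m)" for m
  proof (rule lipschitz_onI)
    have *: "dist (Q m x) (Q m y) \<le> 1 * dist x y" if "e0 \<le> x" "x \<le> y" for x y
    proof -
      have "Q m y - Q m x \<le> e0 * (y - x)" using Q_contr[of x y m] that e0_pos by auto
      also have "\<dots> \<le> 1 * (y - x)" using that e0_less by (intro mult_right_mono) auto
      finally show ?thesis
        using concave_incr_le[OF concave_Q, of x y m] that e0_pos by (auto simp: dist_real_def)
    qed
    fix x y assume "x \<in> {e0..}" "y \<in> {e0..}"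
    then show "dist (Q m x) (Q m y) \<le> 1 * dist x y"
      using *[of x y] *[of y x] by (cases "x \<le> y") (auto simp: dist_commute)
  qed simp
  then have "continuous_on {e0..} (Q m)" for m by (rule lipschitz_on_continuous_on)
  then have "continuous_on {e0..} (h k \<circ> Q m)" for m
    using Q_nonneg e0_pos by (intro continuous_on_compose continuous_on_subset[OF Suc]) auto
  then show ?case using Suc by auto
qed (simp add: id_def)

lemma h_surj:
  assumes "e0 \<le> c" "h k c \<le> y" "y \<le> h k d" "c \<le> d"
  obtains z where "c \<le> z" "z \<le> d" "h k z = y"
  using IVT'[of "h k" c y d] continuous_on_subset[OF h_cont[of k], of "{c..d}"] assms by force

text \<open>For \<open>k > 0\<close> the value \<open>z = 1\<close> has to be excluded: it occurs
  only if \<open>b = 1\<close> and \<open>w k = 1\<close>, and then \<open>h k z = 1\<close> is sent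
  by \<open>f\<close> to 0 and not to the limit from the left.\<close>

lemma orbit:
  assumes "\<And>j. j < k \<Longrightarrow> w j \<noteq> e0" "e0 \<le> z" "z \<le> w k" "z < 1 \<or> k = 0"
  shows "pm_tau_k \<alpha> b k (h k z) = enat (t k) \<and> (f ^^ t k) (h k z) = z \<and>
    (\<forall>j<k. \<tau> ((F ^^ j) (h k z)) = enat (N j)) \<and> (F ^^ k) (h k z) = z"
  using assms
proof (induction k arbitrary: z)
  case 0 then show ?case by (simp add: pm_tau_k_def t_def zero_enat_def)
next
  case (Suc k)
  have nz: "w k \<noteq> e0" using Suc.prems(1) by blast
  note N = Nw[OF act[OF nz], folded N_def]
  have z: "0 < z" "z < 1" using Suc.prems e0_pos by auto
  let ?y = "Q (N k) z"
  have y1: "e0 \<le> ?y" using Q_nonneg z by simp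
  have y2: "?y \<le> w k"
    using concave_incr_le[OF concave_Q z(1) Suc.prems(3), of "N k"] w_Suc_Q(2)[OF act[OF nz]] by simp
  have y3: "?y < 1 \<or> k = 0"
  proof (rule ccontr)
    assume neg: "\<not> ?thesis"
    then have "w k = 1" "?y = 1" using y2 w_range[of k] by auto
    moreover have "b = 1" using \<open>w k = 1\<close> neg w_eq_1 by (cases k) auto
    moreover have "A ?y < 2" using A_Q[OF N(1), of z] z by simp
    ultimately show False using A_1 by simp
  qed
  have IH: "pm_tau_k \<alpha> b k (h k ?y) = enat (t k)" "(f ^^ t k) (h k ?y) = ?y"
    "\<And>j. j < k \<Longrightarrow> \<tau> ((F ^^ j) (h k ?y)) = enat (N j)" "(F ^^ k) (h k ?y) = ?y"
    using Suc.IH[OF _ y1 y2 y3] Suc.prems(1) by auto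
  have hS: "h (Suc k) z = h k ?y" using nz by simp
  have tQ: "\<tau> ?y = enat (N k)" by (rule tau_Q) (use N Suc.prems z in auto)
  have fQ: "(f ^^ N k) ?y = z" by (rule fpow_Q) (use N Suc.prems z in auto)
  have 1: "pm_tau_k \<alpha> b (Suc k) (h (Suc k) z) = enat (t (Suc k))"
    using IH(1,2) tQ unfolding hS by (simp add: pm_tau_k_def pm_tau_def t_def)
  have 2: "(f ^^ t (Suc k)) (h (Suc k) z) = z"
  proof -
    have "t (Suc k) = N k + t k" by (simp add: t_def)
    then show ?thesis unfolding hS using IH(2) fQ by (simp only: funpow_add comp_apply)
  qed
  have 3: "(F ^^ Suc k) (h (Suc k) z) = z"
    unfolding hS using IH(4) F_Q[OF N(1), of z] Suc.prems z by simp
  have 4: "\<tau> ((F ^^ j) (h (Suc k) z)) = enat (N j)" if "j < Suc k" for j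
    using that IH(3)[of j] IH(4) tQ unfolding hS by (cases "j = k") auto
  show ?case using 1 2 3 4 by blast
qed

text \<open>A competitor to the right of \<open>h (Suc k) e0 = h k (a (N k))\<close> has the form
  \<open>h k z\<close> with \<open>a (N k) < z \<le> w k\<close>. If it reaches \<open>e0\<close> at
  its next return, then \<open>z = a m\<close> for some \<open>m \<ge> 1\<close>; but by the choice
  of \<open>N k\<close> no such point lies in this range. What remains is the end point 1 with
  \<open>b = 1\<close>, which never returns. Once \<open>w k = e0\<close>, both sides stay at
  1.\<close>

lemma pm_e_eq: "e k = h k e0"
proof (induction k)
  case 0 then show ?case by (simp add: pm_disc_eq)
next
  case (Suc k)
  show ?case
  proof (cases "w k = e0")
    case True
    then have "e k = 1" using Suc h_w[of k] by simp
    then show ?thesis using True h_w[of k] by simp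
  next
    case False
    note N = Nw[OF act[OF False], folded N_def]
    have pe: "e k \<noteq> 1"
      using Suc h_w[of k] concave_incr_less[OF concave_h e0_pos act[OF False], of k] by simp
    have valid: "w j \<noteq> e0" if "j < Suc k" for j using act_mono[OF False, of j] that by simp
    define x where "x = h (Suc k) e0"
    have xa: "x = h k (a (N k))" using False N by (simp add: x_def Q_e0)
    have "(GREATEST y. y \<in> pm_base \<alpha> b \<and>
              (\<exists>m. pm_tau_k \<alpha> b (Suc k) y = enat m \<and> (f ^^ m) y = pm_disc \<alpha> b)) = x"
    proof (rule Greatest_equality)
      have "e0 \<le> w (Suc k)" "e0 < 1" using w_range e0_less by blast+
      from orbit[OF valid order_refl this(1)] this(2)
      have "pm_tau_k \<alpha> b (Suc k) x = enat (t (Suc k))" "(f ^^ t (Suc k)) x = e0"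
        by (auto simp only: x_def)
      moreover have "x \<in> {e0..1}"
        using h_ge[of e0 "Suc k"] concave_incr_le[OF concave_h e0_pos \<open>e0 \<le> w (Suc k)\<close>, of "Suc k"] h_w[of "Suc k"]
        unfolding x_def by simp
      ultimately show "x \<in> pm_base \<alpha> b \<and> (\<exists>m. pm_tau_k \<alpha> b (Suc k) x = enat m \<and> (f ^^ m) x = pm_disc \<alpha> b)"
        unfolding pm_base_eq pm_disc_eq by blast
    next
      fix y assume y: "y \<in> pm_base \<alpha> b \<and> (\<exists>m. pm_tau_k \<alpha> b (Suc k) y = enat m \<and> (f ^^ m) y = pm_disc \<alpha> b)"
      then obtain m where y1: "e0 \<le> y" "y \<le> 1" and m: "pm_tau_k \<alpha> b (Suc k) y = enat m" "(f ^^ m) y = e0"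
        by (auto simp: pm_base_eq pm_disc_eq)
      show "y \<le> x"
      proof (rule ccontr)
        assume "\<not> y \<le> x"
        then have yx: "h k (a (N k)) < y" by (simp add: xa)
        obtain z where z: "a (N k) \<le> z" "z \<le> w k" "h k z = y"
          by (rule h_surj[of "a (N k)" k y "w k"]) (use yx y1 h_w[of k] a_gt N in \<open>auto simp: less_imp_le\<close>)
        have za: "a (N k) < z" using z yx by (cases "z = a (N k)") auto
        have ze: "e0 < z" using za a_gt[of "N k"] by simp
        show False
        proof (cases "z < 1 \<or> k = 0")
          case True
          have orb: "pm_tau_k \<alpha> b k y = enat (t k)" "(f ^^ t k) y = z"
            using orbit[of k z] valid ze z True by auto
          obtain n where n: "\<tau> z = enat n" "m = t k + n"
            using m(1) orb by (cases "\<tau> z") (auto simp: pm_tau_k_def pm_tau_def)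
          have fn: "(f ^^ n) z = e0" using m(2) n(2) orb(2) by (simp add: funpow_add add.commute)
          show False
          proof (cases "A z < 2")
            case True
            obtain m' x' where q: "1 \<le> m'" "e0 \<le> x'" "x' < 1" "z = Q m' x'"
              using Q_exhaust[OF ze True] by blast
            then have "n = m'" using tau_Q n by simp
            then have "x' = e0" using fpow_Q q fn by simp
            then have "z = a m'" using q by (simp add: Q_e0)
            then show False using za z N(3)[of m'] q(1) a_le_iff[of "N k" m'] a_le_iff[of m' "N k"] by force
          next
            case False
            have z1: "z \<le> 1" using z w_range[of k] by simp
            then have "A z \<le> A 1" using ze e0_pos by (intro A_le) auto
            then have b1: "b = 1" using False b_le by (simp add: A_1)
            have "z = 1"
            proof (rule ccontr)
              assume "z \<noteq> 1"
              then have "A z < A 1" using z1 ze e0_pos by (intro A_less) auto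
              then show False using False A_1 b1 by linarith
            qed
            then show False using tau_1[OF b1] n by simp
          qed
        next
          case False
          then have k: "k > 0" "z = 1" "w k = 1" using z w_range[of k] by auto
          then have b1: "b = 1" using w_eq_1 by (cases k) auto
          have "y = 1" using z k h_w[of k] by simp
          moreover have "pm_tau_k \<alpha> b (Suc j) 1 = \<infinity>" for j
            using tau_1[OF b1] by (induction j) (auto simp: pm_tau_k_def pm_tau_def zero_enat_def)
          ultimately show False using m(1) by simp
        qed
      qed
    qed
    then show ?thesis using pe by (simp add: x_def)
  qed
qed

lemma h_Suc_e0: "w k \<noteq> e0 \<Longrightarrow> h (Suc k) e0 = h k (a (N k))"
  using Nw(1)[OF act, of k] by (simp add: Q_e0 N_def)

lemma pm_e_le: "e k \<le> e (Suc k)"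
proof (cases "w k = e0")
  case False
  then show ?thesis unfolding pm_e_eq h_Suc_e0[OF False]
    using concave_incr_le[OF concave_h e0_pos, of "a (N k)" k] a_gt[of "N k"] by simp
qed (simp only: pm_e_eq h.simps if_True order_refl simp_thms)

lemma pm_e_mono: "j \<le> k \<Longrightarrow> e j \<le> e k"
  by (rule lift_Suc_mono_le[of e]) (rule pm_e_le)

lemma pm_e_le_1: "e k \<le> 1"
  using concave_incr_le[OF concave_h e0_pos, of "w k" k] w_range[of k] h_w[of k] by (simp add: pm_e_eq)

lemma pm_e_ge: "1 - e k \<le> e0 ^ k"
proof (cases "w k = e0")
  case True
  then show ?thesis using h_w[of k] e0_pos by (simp add: pm_e_eq)
next
  case False
  have "1 - e k = h k (w k) - h k e0" by (simp add: pm_e_eq h_w)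
  also have "\<dots> \<le> e0 ^ k * (w k - e0)"
    by (rule h_contr) (use act_mono[OF False] w_range in auto)
  also have "\<dots> \<le> e0 ^ k * 1" using e0_pos w_range[of k] by (intro mult_left_mono) auto
  finally show ?thesis by simp
qed

section \<open>The blocks \<open>[e k, e (Suc k))\<close> and the values of \<open>\<rho>\<close>
  and \<open>\<phi>\<close> on them\<close>

lemma rho_eq:
  assumes "e k \<le> y" "y < e (Suc k)" shows "\<rho> y = Suc k"
proof -
  have "(THE j. e j \<le> y \<and> y < e (Suc j)) = k"
  proof (rule the_equality)
    fix j assume j: "e j \<le> y \<and> y < e (Suc j)"
    show "j = k"
    proof (rule linorder_cases[of j k])
      assume "j < k" then show ?thesis using pm_e_mono[of "Suc j" k] j assms by simp
    next
      assume "k < j" then show ?thesis using pm_e_mono[of "Suc k" j] j assms by simp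
    qed
  qed (use assms in simp)
  then show ?thesis by (simp add: pm_rho_def)
qed

lemma block_exists:
  assumes "e0 \<le> y" "y < 1"
  obtains k where "e k \<le> y" "y < e (Suc k)"
proof -
  obtain n where n: "e0 ^ n < 1 - y" using real_arch_pow_inv[of "1 - y" e0] assms e0_less by auto
  have ex: "y < e n" using pm_e_ge[of n] n by simp
  define k where "k = (LEAST k. y < e k)"
  have k: "y < e k" unfolding k_def by (rule LeastI) (rule ex)
  have "k \<noteq> 0" using k assms by (intro notI) (simp add: pm_disc_eq)
  then obtain j where j: "k = Suc j" by (cases k) auto
  have "\<not> y < e j" using not_less_Least[of j "\<lambda>k. y < e k"] j unfolding k_def by simp
  then show thesis using that[of j] k j by simp
qed

lemma block_act: "e k < e (Suc k) \<Longrightarrow> w k \<noteq> e0"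
  unfolding pm_e_eq by auto

lemma block_param:
  assumes "e k \<le> y" "y < e (Suc k)"
  obtains z where "w k \<noteq> e0" "e0 \<le> z" "z < a (N k)" "y = h k z"
proof -
  have nz: "w k \<noteq> e0" using block_act assms by force
  obtain z where z: "e0 \<le> z" "z \<le> a (N k)" "h k z = y"
    by (rule h_surj[of e0 k y "a (N k)"]) (use assms[unfolded pm_e_eq h_Suc_e0[OF nz]] a_gt in \<open>auto simp: less_imp_le\<close>)
  have "z \<noteq> a (N k)" using z assms[unfolded pm_e_eq h_Suc_e0[OF nz]] by auto
  then show thesis using that nz z by auto
qed

lemma a_N_le: "w k \<noteq> e0 \<Longrightarrow> 1 \<le> N k \<and> a (N k) \<le> w k \<and> a (N k) \<le> 1"
  using Nw[OF act, of k] w_range[of k] by (auto simp: N_def)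

lemma h_in_block:
  assumes "w k \<noteq> e0" "e0 \<le> z" "z < a (N k)"
  shows "e k \<le> h k z" "h k z < e (Suc k)"
  unfolding pm_e_eq h_Suc_e0[OF assms(1)]
  using assms e0_pos concave_incr_le[OF concave_h, of e0 z k] concave_incr_less[OF concave_h, of z "a (N k)" k]
  by auto

lemma block_orbit:
  assumes "w k \<noteq> e0" "e0 \<le> z" "z < a (N k)"
  shows "\<rho> (h k z) = Suc k" "\<phi> (h k z) = enat (t k) + \<tau> z"
    "\<And>j. j < k \<Longrightarrow> \<tau> ((F ^^ j) (h k z)) = enat (N j)" "(F ^^ k) (h k z) = z"
    "(f ^^ t k) (h k z) = z"
proof -
  show rho: "\<rho> (h k z) = Suc k" by (rule rho_eq[OF h_in_block[OF assms]])
  have z: "z \<le> w k" "z < 1" using a_N_le[OF assms(1)] assms by auto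
  have orb: "pm_tau_k \<alpha> b k (h k z) = enat (t k)" "(f ^^ t k) (h k z) = z"
    "\<forall>j<k. \<tau> ((F ^^ j) (h k z)) = enat (N j)" "(F ^^ k) (h k z) = z"
    using orbit[of k z] act_mono[OF assms(1)] assms(2) z by auto
  show "\<phi> (h k z) = enat (t k) + \<tau> z"
    unfolding pm_phi_def rho using orb(1,2) by (simp add: pm_tau_k_def pm_tau_def)
  show "\<And>j. j < k \<Longrightarrow> \<tau> ((F ^^ j) (h k z)) = enat (N j)" "(F ^^ k) (h k z) = z"
    "(f ^^ t k) (h k z) = z" using orb by auto
qed

end

section \<open>Invariant measures of the induced maps\<close>

lemma kth_return_funpow:
  "kth_return f Y k y = enat n \<Longrightarrow> (f ^^ n) y = (induced_map f (first_return f Y) ^^ k) y"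
proof (induction k arbitrary: n)
  case 0 then show ?case by (simp add: zero_enat_def)
next
  case (Suc k)
  obtain m where m: "kth_return f Y k y = enat m"
    using Suc.prems by (cases "kth_return f Y k y") auto
  obtain j where j: "first_return f Y ((f ^^ m) y) = enat j"
    using Suc.prems m by (cases "first_return f Y ((f ^^ m) y)") auto
  have "n = j + m" using Suc.prems m j by simp
  then have "(f ^^ n) y = (f ^^ j) ((f ^^ m) y)" by (simp add: funpow_add)
  also have "\<dots> = induced_map f (first_return f Y) ((f ^^ m) y)" using j by (simp add: induced_map_def)
  finally show ?case using Suc.IH[OF m] by simp
qed

text \<open>Measurability of the induced maps, and with it the fact that they send
  \<open>[e0, 1]\<close> into itself, is obtained from \<open>acip\<close> throughout.\<close>

lemma acipD:
  assumes "acip Y T \<mu>"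
  shows "prob_space \<mu>" "sets \<mu> = sets (restrict_space borel Y)"
    "absolutely_continuous (restrict_space lborel Y) \<mu>"
    "T \<in> measurable (restrict_space borel Y) (restrict_space borel Y)" "distr \<mu> \<mu> T = \<mu>"
  using assms by (auto simp: acip_def cong: measurable_cong_sets)

context intermittent begin

abbreviation G :: "real \<Rightarrow> real" where "G \<equiv> induced_map f (\<phi>)"

text \<open>A full branch of \<open>G\<close> is given by its block k and the last return time n. On
  \<open>[e0, a (N k))\<close> the return time exceeds \<open>N k\<close>; the possibly incomplete
  branch with return time exactly \<open>N k\<close> is left to the later blocks.\<close>

definition idx :: "(nat \<times> nat) set" where "idx = {(k, n). w k \<noteq> e0 \<and> N k < n}"

definition br :: "nat \<times> nat \<Rightarrow> real \<Rightarrow> real" where "br i = h (fst i) \<circ> Q (snd i)"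

lemma A_less_2: "0 \<le> z \<Longrightarrow> z < 1 \<Longrightarrow> A z < 2"
  using A_less[of z 1] b_le A_1 by linarith

lemma Q_bounds:
  assumes "1 \<le> m" "e0 \<le> x" "x < 1" shows "a m \<le> Q m x" "Q m x < a (m - 1)"
  using concave_incr_le[OF concave_Q e0_pos assms(2), of m] concave_incr_less[OF concave_Q _ assms(3), of m]
    assms e0_pos by (auto simp: Q_e0 Q_1)

lemma tau_gt_iff:
  assumes "e0 \<le> z" "z < 1" shows "enat n < \<tau> z \<longleftrightarrow> z < a n"
proof (cases "z = e0")
  case True then show ?thesis using tau_e0 a_gt by simp
next
  case False
  obtain m x where q: "1 \<le> m" "e0 \<le> x" "x < 1" "z = Q m x"
    using Q_exhaust[of z] A_less_2[of z] False assms e0_pos by auto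
  have t: "\<tau> z = enat m" using tau_Q q by simp
  show ?thesis
  proof (cases "n < m")
    case True
    then have "a (m - 1) \<le> a n" by (intro a_le) auto
    then show ?thesis using True t Q_bounds[OF q(1-3)] q(4) by simp
  next
    case False
    then have "a n \<le> a m" by (intro a_le) auto
    then show ?thesis using False t Q_bounds[OF q(1-3)] q(4) by simp
  qed
qed

lemma Q_less_a_N:
  assumes "N k < n" "e0 \<le> x" "x < 1" shows "e0 \<le> Q n x" "Q n x < a (N k)"
proof -
  have "a (n - 1) \<le> a (N k)" using assms by (intro a_le) auto
  then show "Q n x < a (N k)" using Q_bounds(2)[of n x] assms by simp
  show "e0 \<le> Q n x" using Q_nonneg assms e0_pos by simp
qed

lemma br_orbit:
  assumes "(k, n) \<in> idx" "e0 \<le> x" "x < 1"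
  shows "\<phi> (h k (Q n x)) = enat (t k + n)" "G (h k (Q n x)) = x"
    "\<rho> (h k (Q n x)) = Suc k"
proof -
  have k: "w k \<noteq> e0" "N k < n" "1 \<le> n" using assms by (auto simp: idx_def)
  note z = Q_less_a_N[OF k(2) assms(2,3)]
  note orb = block_orbit[OF k(1) z]
  show phi: "\<phi> (h k (Q n x)) = enat (t k + n)"
    using orb(2) tau_Q[OF k(3) assms(2,3)] by simp
  show "\<rho> (h k (Q n x)) = Suc k" by (rule orb(1))
  have "(f ^^ (n + t k)) (h k (Q n x)) = x"
    unfolding funpow_add comp_apply orb(5) by (rule fpow_Q[OF k(3) assms(2,3)])
  then show "G (h k (Q n x)) = x" by (simp add: induced_map_def phi add.commute)
qed

text \<open>A block can miss only its left end point \<open>e k\<close>, whose k-th return is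
  \<open>e0\<close>, a point that never returns.\<close>

lemma cover_countable: "countable ({e0..<1} - (\<Union>i\<in>idx. br i ` {e0..<1}))"
proof (rule countable_subset)
  show "{e0..<1} - (\<Union>i\<in>idx. br i ` {e0..<1}) \<subseteq> range e"
  proof
    fix y assume y: "y \<in> {e0..<1} - (\<Union>i\<in>idx. br i ` {e0..<1})"
    then obtain k where k: "e k \<le> y" "y < e (Suc k)"
      using block_exists[of y] by auto
    obtain z where z: "w k \<noteq> e0" "e0 \<le> z" "z < a (N k)" "y = h k z"
      using block_param[OF k] by blast
    have "z = e0"
    proof (rule ccontr)
      assume "z \<noteq> e0"
      moreover have "z < 1" using z(3) a_N_le[OF z(1)] by simp
      ultimately obtain m x where q: "1 \<le> m" "e0 \<le> x" "x < 1" "z = Q m x"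
        using Q_exhaust[of z] A_less_2[of z] z e0_pos by auto
      have "a m < a (N k)" using Q_bounds(1)[OF q(1-3)] q z by simp
      then have "(k, m) \<in> idx" using a_le_iff[of "N k" m] z by (auto simp: idx_def not_le[symmetric])
      moreover have "y = br (k, m) x" using q z by (simp add: br_def)
      ultimately have "y \<in> (\<Union>i\<in>idx. br i ` {e0..<1})"
        using q by (intro UN_I[of "(k, m)"] image_eqI[of _ _ x]) auto
      then show False using y by simp
    qed
    then show "y \<in> range e" using z by (simp add: pm_e_eq)
  qed
qed simp

text \<open>Lengthening the last return by one gives the left neighbour. The point
  \<open>p 2\<close> is the right choice for \<open>m\<close> because \<open>Q n\<close> sends
  \<open>p 2\<close>, \<open>e0\<close>, 1 to \<open>a (Suc n)\<close>, \<open>a n\<close>,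
  \<open>a (n - 1)\<close>, so that \<open>[p 2, e0)\<close> goes onto the interval of return time n
  + 1. Each block contains all n above \<open>N k\<close>, hence the neighbour always
  exists.\<close>

lemma concave_branches_G:
  assumes "G \<in> measurable (restrict_space borel {e0..1}) (restrict_space borel {e0..1})"
  shows "concave_branches e0 (p 2) e0 idx br (\<lambda>(k, n). (k, Suc n)) G"
proof
  show "0 < p 2" "p 2 < e0" using p_pos p_less[of 1 2] p_1 by auto
  show "e0 < 1" by (rule e0_less)
  show "0 \<le> e0" using e0_pos by simp
  show "countable idx" by simp
  fix i assume i: "i \<in> idx"
  obtain k n where kn: "i = (k, n)" by (cases i)
  then have k: "w k \<noteq> e0" "N k < n" "1 \<le> n" using i by (auto simp: idx_def)
  note N = a_N_le[OF k(1)]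
  show ci: "concave_incr (br i)"
    unfolding br_def by (rule concave_incr_comp[OF concave_h concave_Q])
  show "br i y - br i x \<le> e0 * (y - x)" if xy: "e0 \<le> x" "x \<le> y" "y \<le> 1" for x y
  proof -
    have x0: "0 < x" using xy e0_pos by simp
    have le: "Q n x \<le> Q n y" using concave_incr_le[OF concave_Q x0 xy(2)] .
    have "br i y - br i x \<le> e0 ^ k * (Q n y - Q n x)"
      using h_contr[of k "Q n x" "Q n y"] act_mono[OF k(1)] Q_nonneg[of x n] x0 le
      by (simp add: br_def kn)
    also have "\<dots> \<le> 1 * (Q n y - Q n x)"
      using le e0_pos e0_less by (intro mult_right_mono power_le_one) auto
    also have "\<dots> \<le> e0 * (y - x)" using Q_contr[of x y n] xy x0 by simp
    finally show ?thesis .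
  qed
  show "e0 \<le> br i e0" using h_ge[OF Q_nonneg] e0_pos by (simp add: br_def)
  show "br i 1 \<le> 1"
  proof -
    have "N k \<le> n - 1" using k by linarith
    then have "a (n - 1) \<le> w k" using a_le[of "N k" "n - 1"] N by linarith
    then have "h k (a (n - 1)) \<le> h k (w k)"
      using concave_incr_le[OF concave_h] a_gt[of "n - 1"] e0_pos by simp
    then show ?thesis using k h_w[of k] by (simp add: br_def kn Q_1)
  qed
  show "G (br i x) = x" if "e0 \<le> x" "x < 1" for x
    using br_orbit(2)[of k n x] i kn that by (simp add: br_def)
  have scI: "(k, Suc n) \<in> idx" using k by (simp add: idx_def)
  show "(case i of (k, n) \<Rightarrow> (k, Suc n)) \<in> idx" using scI kn by simp
  show "br i (p 2) = br (case i of (k, n) \<Rightarrow> (k, Suc n)) e0"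
    using k by (simp add: kn br_def Q_p2 Q_e0)
  show "br i e0 = br (case i of (k, n) \<Rightarrow> (k, Suc n)) 1"
    using k by (simp add: kn br_def Q_1 Q_e0)
next
  fix i j assume ij: "i \<in> idx" "j \<in> idx" "i \<noteq> j"
  obtain k n where i: "i = (k, n)" by (cases i)
  obtain k' n' where j: "j = (k', n')" by (cases j)
  show "br i ` {e0..<1} \<inter> br j ` {e0..<1} = {}"
  proof (rule ccontr)
    assume "\<not> ?thesis"
    then obtain x x' where x: "x \<in> {e0..<1}" "x' \<in> {e0..<1}" "br i x = br j x'" by blast
    then have eq: "h k (Q n x) = h k' (Q n' x')" by (simp add: br_def i j)
    have "Suc k = Suc k'" using br_orbit(3)[of k n x] br_orbit(3)[of k' n' x'] ij x eq i j by simp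
    moreover have "t k + n = t k' + n'" using br_orbit(1)[of k n x] br_orbit(1)[of k' n' x'] ij x eq i j by simp
    ultimately show False using ij i j by simp
  qed
next
  show "countable ({e0..<1} - (\<Union>i\<in>idx. br i ` {e0..<1}))" by (rule cover_countable)
  show "inj_on (\<lambda>(k, n). (k, Suc n)) idx" by (auto simp: inj_on_def)
  show "G \<in> measurable (restrict_space borel {e0..1}) (restrict_space borel {e0..1})" by fact
  fix v :: real assume v: "e0 < v"
  have "\<forall>\<^sub>F n in sequentially. a n < v" using a_tendsto v by (rule order_tendstoD)
  then obtain n0 where n0: "\<And>n. n \<ge> n0 \<Longrightarrow> a n < v" unfolding eventually_sequentially by blast
  define n where "n = Suc (max n0 (N 0))"
  have "N 0 < n" unfolding n_def by (simp only: less_Suc_eq_le max.cobounded2)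
  then have "(0, n) \<in> idx" using e0_less by (simp add: idx_def)
  moreover have "br (0, n) 1 \<le> v" using n0[of "n - 1"] by (simp add: br_def n_def Q_1 less_imp_le)
  ultimately show "\<exists>i\<in>idx. br i 1 \<le> v" by blast
qed

section \<open>Preimages of null sets\<close>

lemma negligible_L: assumes "negligible B" "B \<subseteq> {0..}" shows "negligible (L ` B)"
proof (rule negligible_locally_Lipschitz_image)
  fix x assume x: "x \<in> B"
  show "\<exists>T C. open T \<and> x \<in> T \<and> (\<forall>y\<in>B \<inter> T. norm (L y - L x) \<le> C * norm (y - x))"
  proof (intro exI[of _ UNIV] exI[of _ 1] conjI ballI)
    fix y assume "y \<in> B \<inter> UNIV"
    then show "norm (L y - L x) \<le> 1 * norm (y - x)"
      using L_diff[of x y] L_diff[of y x] x assms(2) by (cases "x \<le> y") auto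
  qed auto
qed (use assms in auto)

text \<open>This leads to the absolute continuity of the tower measure. The preimage lies in the
  images of \<open>B\<close> under the two Lipschitz inverse branches; \<open>L 2\<close> accounts
  for \<open>A y = 2\<close>, where reduction modulo 1 leaves the second branch.\<close>

lemma f_preimage_negligible:
  assumes B: "negligible B" "B \<subseteq> {0..1}" shows "negligible {y \<in> {0..1}. f y \<in> B}"
proof (rule negligible_subset)
  have "negligible ((+) 1 ` B)" using B(1) by (rule negligible_translation)
  then show "negligible (L ` B \<union> L ` ((+) 1 ` B) \<union> {L 2})"
    using B by (intro negligible_Un negligible_L) auto
  show "{y \<in> {0..1}. f y \<in> B} \<subseteq> L ` B \<union> L ` ((+) 1 ` B) \<union> {L 2}"
  proof
    fix y assume "y \<in> {y \<in> {0..1}. f y \<in> B}"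
    then have y: "0 \<le> y" "y \<le> 1" "f y \<in> B" by auto
    have A2: "0 \<le> A y" "A y \<le> 2" using A_nonneg[OF y(1)] A_le[OF y(1,2)] A_1 b_le by linarith+
    have yL: "y = L (A y)" using L_A y by simp
    consider "A y < 1" | "1 \<le> A y" "A y < 2" | "A y = 2" using A2 by linarith
    then show "y \<in> L ` B \<union> L ` ((+) 1 ` B) \<union> {L 2}"
    proof cases
      case 1
      then have "f y = A y" using A2 by (intro f_unique) auto
      then show ?thesis using yL y(3) by auto
    next
      case 2
      then have "f y = A y - 1" by (intro f_unique) auto
      then have "A y = 1 + f y" by simp
      then have "A y \<in> (+) 1 ` B" using y(3) by blast
      then show ?thesis using yL by (metis UnI1 UnI2 imageI)
    next
      case 3
      then show ?thesis using yL by simp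
    qed
  qed
qed

lemma f_range: "f y \<in> {0..1}" unfolding f_eq using frac_ge_0[of "A y"] frac_lt_1[of "A y"] by simp

lemma fpow_preimage_negligible:
  assumes B: "negligible B" "B \<subseteq> {0..1}" shows "negligible {y \<in> {0..1}. (f ^^ n) y \<in> B}"
proof (induction n)
  case 0
  then show ?case using B by (auto intro: negligible_subset)
next
  case (Suc n)
  have "{y \<in> {0..1}. (f ^^ Suc n) y \<in> B} = {y \<in> {0..1}. f y \<in> {y \<in> {0..1}. (f ^^ n) y \<in> B}}"
    using f_range by (auto simp: funpow_swap1)
  moreover have "negligible {y \<in> {0..1}. f y \<in> {y \<in> {0..1}. (f ^^ n) y \<in> B}}"
    by (rule f_preimage_negligible[OF Suc]) auto
  ultimately show ?case by (simp only:)
qed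

lemma F_preimage_negligible:
  assumes B: "negligible B" "B \<subseteq> {0..1}" shows "negligible {y \<in> {0..1}. F y \<in> B}"
proof (rule negligible_subset)
  \<comment> \<open>\<open>F\<close> coincides with some iterate of \<open>f\<close> at points that
    return and is the identity elsewhere; the first \<open>B\<close> covers the latter.\<close>
  show "negligible (B \<union> (\<Union>n. {y \<in> {0..1}. (f ^^ n) y \<in> B}))"
    using B fpow_preimage_negligible[OF B] by (intro negligible_Un negligible_countable_Union) auto
  show "{y \<in> {0..1}. F y \<in> B} \<subseteq> B \<union> (\<Union>n. {y \<in> {0..1}. (f ^^ n) y \<in> B})"
    by (auto simp: induced_map_def split: enat.splits)
qed

lemma Fpow_preimage_negligible:
  assumes F: "\<And>y. y \<in> {e0..1} \<Longrightarrow> F y \<in> {e0..1}" and B: "negligible B" "B \<subseteq> {e0..1}"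
  shows "negligible {y \<in> {e0..1}. (F ^^ n) y \<in> B}"
proof (induction n)
  case 0
  then show ?case using B by (auto intro: negligible_subset)
next
  case (Suc n)
  have "{y \<in> {e0..1}. (F ^^ Suc n) y \<in> B} \<subseteq> {y \<in> {0..1}. F y \<in> {y \<in> {e0..1}. (F ^^ n) y \<in> B}}"
  proof
    fix y assume y: "y \<in> {y \<in> {e0..1}. (F ^^ Suc n) y \<in> B}"
    then have "(F ^^ n) (F y) \<in> B" by (simp only: funpow_Suc_right comp_apply mem_Collect_eq)
    moreover have "F y \<in> {e0..1}" using F y by blast
    ultimately show "y \<in> {y \<in> {0..1}. F y \<in> {y \<in> {e0..1}. (F ^^ n) y \<in> B}}"
      using y e0_pos by simp
  qed
  moreover have "negligible {y \<in> {0..1}. F y \<in> {y \<in> {e0..1}. (F ^^ n) y \<in> B}}"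
    by (rule F_preimage_negligible[OF Suc]) (use e0_pos in auto)
  ultimately show ?case by (rule negligible_subset[rotated])
qed

end

section \<open>Identification of \<open>\<mu>\<tau>\<close> with the tower over
  \<open>\<mu>0\<close>\<close>

locale intermittent_acip = intermittent +
  fixes \<mu>0 \<mu>\<tau> :: "real measure"
  assumes acip_0: "acip {e0..1} G \<mu>0" and acip_\<tau>: "acip {e0..1} F \<mu>\<tau>"
begin

sublocale B: concave_branches e0 "p 2" e0 idx br "\<lambda>(k, n). (k, Suc n)" G
  by (rule concave_branches_G[OF acipD(4)[OF acip_0]])

lemmas mu0 = acipD[OF acip_0]
lemmas mut = acipD[OF acip_\<tau>]

lemma sets_mu0: "sets \<mu>0 = sets B.LY" by (rule B.sets_mu[OF mu0(1,2,3,5)])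

lemma space_mu0: "space \<mu>0 = {e0..1}" by (rule B.space_mu[OF mu0(1,2,3,5)])

lemma F_range: "y \<in> {e0..1} \<Longrightarrow> F y \<in> {e0..1}"
  using measurable_space[OF mut(4), of y] by (simp add: space_restrict_space)

lemma Fpow_range: "y \<in> {e0..1} \<Longrightarrow> (F ^^ n) y \<in> {e0..1}"
  by (induction n) (use F_range in auto)

lemma borel_sets: "B \<in> sets borel \<Longrightarrow> B \<subseteq> {e0..1} \<Longrightarrow> B \<in> sets \<mu>0"
  unfolding sets_mu0 B.sets_LY by blast

text \<open>\<open>\<rho>\<close> and \<open>\<phi>\<close> have no specified value at 1, so sets
  are computed explicitly on \<open>[e0, 1)\<close> only; a single point does not affect
  measurability.\<close>

lemma borel_sets_mod_1:
  assumes "S \<inter> {e0..<1} \<in> sets borel" "S \<subseteq> {e0..1}" shows "S \<in> sets \<mu>0"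
proof -
  have "S = (S \<inter> {e0..<1}) \<union> (S \<inter> {1})" using assms(2) by fastforce
  moreover have "S \<inter> {1} \<in> sets borel" by (cases "1 \<in> S") auto
  ultimately have "S \<in> sets borel" using assms(1) by (metis sets.Un)
  then show ?thesis using assms(2) by (rule borel_sets)
qed

lemma null_mu0: assumes "countable C" "C \<subseteq> {e0..1}" shows "C \<in> null_sets \<mu>0"
proof -
  have c: "C \<in> null_sets lborel" using assms(1) by (rule countable_imp_null_set_lborel)
  have "C \<in> null_sets B.LY"
    using c assms(2) by (auto simp: null_sets_def B.sets_LY B.emeasure_LY)
  then show ?thesis using mu0(3) by (auto simp: absolutely_continuous_def)
qed

lemma AE_branch: "AE y in \<mu>0. \<exists>i\<in>idx. y \<in> br i ` {e0..<1}"
proof (rule AE_I'[OF null_mu0])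
  show "countable (({e0..<1} - (\<Union>i\<in>idx. br i ` {e0..<1})) \<union> {1})" using cover_countable by simp
  show "{y \<in> space \<mu>0. \<not> (\<exists>i\<in>idx. y \<in> br i ` {e0..<1})} \<subseteq> ({e0..<1} - (\<Union>i\<in>idx. br i ` {e0..<1})) \<union> {1}"
    by (auto simp: space_mu0)
qed (use e0_less in auto)

lemma AE_less_1: "AE y in \<mu>0. e0 \<le> y \<and> y < 1"
proof (rule AE_I'[OF null_mu0])
  show "countable {1::real}" by simp
  show "{y \<in> space \<mu>0. \<not> (e0 \<le> y \<and> y < 1)} \<subseteq> {1}" by (auto simp: space_mu0)
qed (use e0_less in auto)

lemma G_eq_Fpow: assumes "\<phi> y = enat n" shows "G y = (F ^^ \<rho> y) y"
proof -
  have "kth_return f {e0..1} (\<rho> y) y = enat n"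
    using assms by (simp add: pm_phi_def pm_tau_k_def pm_base_eq)
  moreover have "\<tau> = first_return f {e0..1}" by (rule ext) (simp add: pm_tau_def pm_base_eq)
  ultimately show ?thesis using kth_return_funpow[of f "{e0..1}" "\<rho> y" y n] assms
    by (simp add: induced_map_def)
qed

lemma AE_G: "AE y in \<mu>0. G y = (F ^^ \<rho> y) y"
  using AE_branch
proof eventually_elim
  case (elim y)
  then obtain k n x where "(k, n) \<in> idx" "e0 \<le> x" "x < 1" "y = h k (Q n x)" by (auto simp: br_def)
  then show ?case using br_orbit(1)[of k n x] by (intro G_eq_Fpow) simp
qed

text \<open>A set that is strictly invariant under \<open>F\<close> is so under \<open>G\<close>,
  because \<open>G y\<close> is \<open>(F ^^ \<rho> y) y\<close> where \<open>\<phi>\<close> is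
  finite and \<open>y\<close> itself elsewhere. Triviality of invariant sets is thus inherited from
  \<open>G\<close>.\<close>

lemma F_unique:
  assumes \<nu>: "prob_space \<nu>" "sets \<nu> = sets B.LY" "absolutely_continuous B.LY \<nu>" "distr \<nu> \<nu> F = \<nu>"
  shows "\<nu> = \<mu>\<tau>"
proof (rule invariant_measure_unique)
  have sp: "space B.LY = {e0..1}" by (simp add: space_restrict_space)
  have setsLY: "sets B.LY = sets (restrict_space borel {e0..1})" by (intro sets_restrict_space_cong) simp
  show "sigma_finite_measure B.LY"
    using sigma_finite_lborel by (rule sigma_finite_measure_restrict_space) simp
  show "F \<in> measurable B.LY B.LY" using mut(4) setsLY by (simp cong: measurable_cong_sets)
  show "sets \<mu>\<tau> = sets B.LY" using mut(2) setsLY by simp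
  fix S assume S: "S \<in> sets B.LY" and inv: "\<And>y. y \<in> space B.LY \<Longrightarrow> F y \<in> S \<longleftrightarrow> y \<in> S"
  have S': "S \<in> sets borel" "S \<subseteq> {e0..1}" using S by (simp_all add: B.sets_LY)
  have Fpow: "(F ^^ n) y \<in> S \<longleftrightarrow> y \<in> S" if "y \<in> {e0..1}" for n y
    using that by (induction n) (use inv Fpow_range sp in auto)
  have "G y \<in> S \<longleftrightarrow> y \<in> S" if y: "y \<in> {e0..1}" for y
  proof (cases "\<phi> y")
    case (enat n)
    then show ?thesis using G_eq_Fpow[OF enat] Fpow[OF y] by metis
  qed (simp add: induced_map_def)
  from B.invariant_set_trivial[OF S' this] show "S \<in> null_sets B.LY \<or> space B.LY - S \<in> null_sets B.LY"
    using S' S sp by (auto simp: null_sets_def B.sets_LY B.emeasure_LY)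
qed (use \<nu> mut in auto)

lemma F_meas_mu0: "F \<in> measurable \<mu>0 \<mu>0"
  using mut(4) mu0(2) by (simp cong: measurable_cong_sets)

lemma G_meas_mu0: "G \<in> measurable \<mu>0 \<mu>0"
  using mu0(2,4) by (simp cong: measurable_cong_sets)

lemma rho_meas: "\<rho> \<in> measurable \<mu>0 (count_space UNIV)"
proof (rule measurable_count_space_eq2_countable[THEN iffD2], intro conjI ballI)
  fix j :: nat
  have "\<rho> -` {j} \<inter> space \<mu>0 \<inter> {e0..<1} = (if j = 0 then {} else {e (j - 1)..<e j})" (is "?L = ?R")
  proof (rule set_eqI)
    fix y
    show "y \<in> ?L \<longleftrightarrow> y \<in> ?R"
    proof
      assume y: "y \<in> ?L"
      then obtain k where k: "e k \<le> y" "y < e (Suc k)" using block_exists[of y] by auto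
      then have "j = Suc k" using rho_eq[OF k] y by simp
      then show "y \<in> ?R" using k by simp
    next
      assume y: "y \<in> ?R"
      then obtain k where k: "j = Suc k" "e k \<le> y" "y < e (Suc k)"
        by (cases j) (auto split: if_splits)
      have "e0 \<le> y" using k(2) pm_e_mono[of 0 k] by (simp add: pm_disc_eq)
      moreover have "y < 1" using k(3) pm_e_le_1[of "Suc k"] by simp
      ultimately show "y \<in> ?L" using rho_eq[OF k(2,3)] k(1) by (simp add: space_mu0)
    qed
  qed
  then show "\<rho> -` {j} \<inter> space \<mu>0 \<in> sets \<mu>0"
    by (intro borel_sets_mod_1) (auto simp: space_mu0)
qed simp

text \<open>The hypothesis normalises the tower and, since \<open>c\<close> is real, also expresses
  that \<open>\<rho>\<close> is integrable.\<close>

lemma tower_eq: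
  assumes c: "ennreal c * (\<integral>\<^sup>+y. of_nat (\<rho> y) \<partial>\<mu>0) = 1"
  shows "tower \<mu>0 F \<rho> (ennreal c) = \<mu>\<tau>"
proof (rule F_unique)
  interpret prob_space \<mu>0 by (rule mu0)
  let ?T = "tower \<mu>0 F \<rho> (ennreal c)"
  note e = emeasure_tower[OF F_meas_mu0 rho_meas]
  have sp: "space ?T = space \<mu>0" by (rule sets_eq_imp_space_eq) simp
  have "(\<integral>\<^sup>+y. (\<Sum>j<\<rho> y. indicator (space \<mu>0) ((F ^^ j) y)) \<partial>\<mu>0) = (\<integral>\<^sup>+y. of_nat (\<rho> y) \<partial>\<mu>0)"
  proof (rule nn_integral_cong)
    fix y assume "y \<in> space \<mu>0"
    then have "(F ^^ j) y \<in> space \<mu>0" for j using Fpow_range by (simp add: space_mu0)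
    then show "(\<Sum>j<\<rho> y. indicator (space \<mu>0) ((F ^^ j) y)) = (of_nat (\<rho> y) :: ennreal)" by simp
  qed
  then show "prob_space ?T"
    using e[of "space \<mu>0" "ennreal c"] c by (intro prob_spaceI) (simp add: sp)
  show "sets ?T = sets B.LY" by (simp add: sets_mu0)
  show "distr ?T ?T F = ?T"
    by (rule tower_invariant[OF F_meas_mu0 rho_meas G_meas_mu0 mu0(5) AE_G]) unfold_locales
  show "absolutely_continuous B.LY ?T"
    unfolding absolutely_continuous_def
  proof
    fix S assume "S \<in> null_sets B.LY"
    then have S: "S \<in> sets borel" "S \<subseteq> {e0..1}" "emeasure lborel S = 0" "S \<in> sets \<mu>0"
      by (auto simp: null_sets_def B.sets_LY B.emeasure_LY sets_mu0)
    then have "S \<in> null_sets lborel" by auto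
    then have neg: "negligible S" by (simp add: negligible_iff_null_sets null_sets_completionI)
    have "AE y in \<mu>0. (F ^^ j) y \<notin> S" for j
    proof -
      let ?P = "{y \<in> {e0..1}. (F ^^ j) y \<in> S}"
      have "(F ^^ j) -` S \<inter> space \<mu>0 \<in> sets \<mu>0"
        by (rule measurable_sets[OF funpow_measurable[OF F_meas_mu0] S(4)])
      moreover have eq: "(F ^^ j) -` S \<inter> space \<mu>0 = ?P" by (auto simp: space_mu0)
      ultimately have P: "?P \<in> sets B.LY" by (simp add: sets_mu0)
      have "negligible ?P" by (rule Fpow_preimage_negligible[OF F_range neg S(2)])
      then have "?P \<in> null_sets lborel"
        using P[unfolded B.sets_LY] unfolding negligible_iff_null_sets
        by (subst (asm) null_sets_completion_iff) auto
      moreover have "emeasure B.LY ?P = emeasure lborel ?P" by (rule B.emeasure_LY) auto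
      ultimately have "?P \<in> null_sets B.LY" using P by (simp add: null_sets_def)
      then have "?P \<in> null_sets \<mu>0" using mu0(3) by (auto simp: absolutely_continuous_def)
      then show ?thesis by (rule AE_I') (auto simp: space_mu0)
    qed
    then have "AE y in \<mu>0. \<forall>j. (F ^^ j) y \<notin> S" by (simp add: AE_all_countable)
    then have "AE y in \<mu>0. (\<Sum>j<\<rho> y. indicator S ((F ^^ j) y)) = (0 :: ennreal)"
      by eventually_elim simp
    then have "(\<integral>\<^sup>+y. (\<Sum>j<\<rho> y. indicator S ((F ^^ j) y)) \<partial>\<mu>0) = 0"
      by (subst nn_integral_0_iff_AE[OF tower_sum_measurable[OF F_meas_mu0 rho_meas S(4)]]) simp
    then show "S \<in> null_sets ?T" using e[OF S(4)] S(4) by (simp add: null_sets_def)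
  qed
qed

end

section \<open>Tail estimates\<close>

lemma sum_le_card_mult_max:
  fixes N :: "nat \<Rightarrow> nat"
  assumes "0 < k" obtains i where "i < k" "(\<Sum>j<k. N j) \<le> k * N i"
proof -
  have "Max (N ` {..<k}) \<in> N ` {..<k}" using assms by (intro Max_in) auto
  then obtain i where i: "i < k" "Max (N ` {..<k}) = N i" by auto
  have "N j \<le> N i" if "j < k" for j unfolding i(2)[symmetric] using that by (intro Max_ge) auto
  then have "(\<Sum>j<k. N j) \<le> k * N i" using sum_bounded_above[of "{..<k}" N "N i"] by simp
  with i show thesis using that by blast
qed

lemma half_powr: fixes s :: real assumes "1 \<le> n" "2 * t \<le> n" "0 \<le> s"
  shows "real (n - t) powr (- s) \<le> 2 powr s * real n powr (- s)"
proof -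
  have "real (n - t) powr (- s) \<le> (real n / 2) powr (- s)"
    using assms by (intro powr_mono2') (auto simp: of_nat_diff)
  also have "\<dots> = 2 powr s * real n powr (- s)"
    using assms by (simp add: powr_divide powr_minus field_simps)
  finally show ?thesis .
qed

context intermittent begin

text \<open>Here e0^k is the contraction of k returns, and the polynomial factor is the price for
  replacing \<open>t k\<close> by k times its largest summand.\<close>

definition S :: "nat \<Rightarrow> real" where "S k = real (Suc k) powr (1 + \<beta>) * e0 ^ k"

lemma S_ge: "e0 ^ k \<le> S k"
proof -
  have "1 \<le> real (Suc k) powr (1 + \<beta>)" using beta_pos by (intro ge_one_powr_ge_zero) auto
  then show ?thesis using e0_pos mult_right_mono[of 1 "real (Suc k) powr (1 + \<beta>)" "e0 ^ k"] by (simp add: S_def)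
qed

lemma S_nonneg: "0 \<le> S k" using e0_pos by (simp add: S_def)

text \<open>The weight k + 1 is the value of \<open>\<rho>\<close> on the k-th block. The quotient
  of consecutive terms tends to \<open>e0 < 1\<close>.\<close>

lemma S_summable: "summable (\<lambda>k. real (Suc k) * S k)"
proof -
  let ?f = "\<lambda>k. real (Suc k) * S k"
  let ?r = "\<lambda>k. (1 + inverse (real (Suc k))) powr (2 + \<beta>) * e0"
  have f: "?f k = real (Suc k) powr (2 + \<beta>) * e0 ^ k" for k
  proof -
    have "2 + \<beta> = 1 + (1 + \<beta>)" by simp
    then have "real (Suc k) powr (2 + \<beta>) = real (Suc k) powr 1 * real (Suc k) powr (1 + \<beta>)"
      by (simp only: powr_add)
    then show ?thesis by (simp add: S_def)
  qed
  have "?r \<longlonglongrightarrow> 1 powr (2 + \<beta>) * e0"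
    using beta_pos by (intro tendsto_mult tendsto_powr LIMSEQ_inverse_real_of_nat_add tendsto_const) auto
  then have "\<forall>\<^sub>F k in sequentially. ?r k < (1 + e0) / 2"
    by (rule order_tendstoD) (use e0_less in simp)
  then obtain n0 where n0: "\<And>k. k \<ge> n0 \<Longrightarrow> ?r k < (1 + e0) / 2"
    unfolding eventually_sequentially by blast
  show ?thesis
  proof (rule summable_ratio_test[of "(1 + e0) / 2" n0])
    show "(1 + e0) / 2 < 1" using e0_less by simp
    fix k assume k: "n0 \<le> k"
    have "real (Suc (Suc k)) = (1 + inverse (real (Suc k))) * real (Suc k)" by (simp add: field_simps)
    then have "real (Suc (Suc k)) powr (2 + \<beta>) = (1 + inverse (real (Suc k))) powr (2 + \<beta>) * real (Suc k) powr (2 + \<beta>)"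
      by (simp only: powr_mult)
    then have "?f (Suc k) = ?r k * ?f k" unfolding f by simp
    also have "\<dots> \<le> (1 + e0) / 2 * ?f k"
      using n0[OF k] S_nonneg[of k] by (intro mult_right_mono) auto
    finally show "norm (?f (Suc k)) \<le> (1 + e0) / 2 * norm (?f k)"
      using S_nonneg by simp
  qed
qed

text \<open>A long excursion of the orbit of the right end point is paid for by the contraction of the
  corresponding inverse branch.\<close>

lemma h_contr_excursion:
  obtains C where "C > 0"
    "\<And>k x y. (\<And>j. j < k \<Longrightarrow> w j \<noteq> e0) \<Longrightarrow> e0 \<le> x \<Longrightarrow> x \<le> y \<Longrightarrow>
       (h k y - h k x) * real (t k) powr (1 + \<beta>) \<le> C * S k * (y - x)"
proof -
  obtain C where C: "C > 0" "\<And>m x y. m \<ge> 1 \<Longrightarrow> e0 \<le> x \<Longrightarrow> x \<le> y \<Longrightarrow>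
      Q m y - Q m x \<le> C * real m powr (- (1 + \<beta>)) * (y - x)"
    by (rule Q_contr_powr) blast
  \<comment> \<open>The better of the two contraction rates of a return of length m: the power is
    used for the longest return, \<open>e0\<close> for all others.\<close>
  define \<kappa> where "\<kappa> m = min e0 (C * real m powr (- (1 + \<beta>)))" for m
  have \<kappa>: "0 \<le> \<kappa> m" "\<kappa> m \<le> e0" "\<kappa> m \<le> C * real m powr (- (1 + \<beta>))" for m
    using C e0_pos by (auto simp: \<kappa>_def)
  have prod: "h k y - h k x \<le> (\<Prod>j<k. \<kappa> (N j)) * (y - x)"
    if "\<And>j. j < k \<Longrightarrow> w j \<noteq> e0" "e0 \<le> x" "x \<le> y" for k x y
    using that
  proof (induction k arbitrary: x y)
    case (Suc k)
    have nz: "w k \<noteq> e0" using Suc.prems by blast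
    have N1: "1 \<le> N k" using a_N_le[OF nz] by blast
    have x0: "0 < x" "0 \<le> x" using Suc.prems e0_pos by auto
    have le: "Q (N k) x \<le> Q (N k) y" using concave_incr_le[OF concave_Q x0(1)] Suc.prems by simp
    have q: "Q (N k) y - Q (N k) x \<le> \<kappa> (N k) * (y - x)"
      using C(2)[OF N1 Suc.prems(2,3)] Q_contr[OF x0(2) Suc.prems(3), of "N k"]
      by (cases "e0 \<le> C * real (N k) powr (- (1 + \<beta>))") (simp_all add: \<kappa>_def min_def)
    have "h (Suc k) y - h (Suc k) x = h k (Q (N k) y) - h k (Q (N k) x)" using nz by simp
    also have "\<dots> \<le> (\<Prod>j<k. \<kappa> (N j)) * (Q (N k) y - Q (N k) x)"
      by (rule Suc.IH) (use Suc.prems x0 le Q_nonneg in auto)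
    also have "\<dots> \<le> (\<Prod>j<k. \<kappa> (N j)) * (\<kappa> (N k) * (y - x))"
      using q \<kappa>(1) by (intro mult_left_mono prod_nonneg) auto
    finally show ?case by (simp add: mult_ac)
  qed simp
  have bound: "(\<Prod>j<k. \<kappa> (N j)) * real (t k) powr (1 + \<beta>) \<le> C / e0 * S k"
    if nz: "\<And>j. j < k \<Longrightarrow> w j \<noteq> e0" for k
  proof (cases "k = 0")
    case True then show ?thesis using C e0_pos S_nonneg[of 0] beta_pos by (simp add: t_def)
  next
    case False
    \<comment> \<open>The longest return \<open>N i\<close> satisfies
      \<open>t k \<le> k * N i\<close>, so its contraction cancels (t k)^(1+\<beta>) up to
      k^(1+\<beta>). It uses up one factor \<open>e0\<close>, whence the quotient by
      \<open>e0\<close> in the constant.\<close>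
    obtain i where i: "i < k" "t k \<le> k * N i"
      using sum_le_card_mult_max[of k N] False unfolding t_def by auto
    have N1: "1 \<le> N i" using a_N_le[OF nz[OF i(1)]] by blast
    have "(\<Prod>j<k. \<kappa> (N j)) = \<kappa> (N i) * (\<Prod>j\<in>{..<k} - {i}. \<kappa> (N j))"
      using i by (intro prod.remove) auto
    also have "\<dots> \<le> (C * real (N i) powr (- (1 + \<beta>))) * (\<Prod>j\<in>{..<k} - {i}. e0)"
      using \<kappa> C by (intro mult_mono prod_mono prod_nonneg) auto
    also have "(\<Prod>j\<in>{..<k} - {i}. e0) = e0 ^ (k - 1)" using i by simp
    finally have 1: "(\<Prod>j<k. \<kappa> (N j)) \<le> C * real (N i) powr (- (1 + \<beta>)) * e0 ^ (k - 1)" .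
    have "real (t k) powr (1 + \<beta>) \<le> (real k * real (N i)) powr (1 + \<beta>)"
      using i(2) beta_pos by (intro powr_mono2) (auto simp flip: of_nat_mult)
    also have "\<dots> = real k powr (1 + \<beta>) * real (N i) powr (1 + \<beta>)" by (simp add: powr_mult)
    finally have 2: "real (t k) powr (1 + \<beta>) \<le> real k powr (1 + \<beta>) * real (N i) powr (1 + \<beta>)" .
    have "(\<Prod>j<k. \<kappa> (N j)) * real (t k) powr (1 + \<beta>) \<le>
      (C * real (N i) powr (- (1 + \<beta>)) * e0 ^ (k - 1)) * (real k powr (1 + \<beta>) * real (N i) powr (1 + \<beta>))"
      using 1 2 C e0_pos by (intro mult_mono) auto
    also have "\<dots> = C * e0 ^ (k - 1) * real k powr (1 + \<beta>) * (real (N i) powr (- (1 + \<beta>)) * real (N i) powr (1 + \<beta>))"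
      by (simp add: mult_ac)
    also have "real (N i) powr (- (1 + \<beta>)) * real (N i) powr (1 + \<beta>) = 1"
      using N1 by (simp flip: powr_add)
    also have "C * e0 ^ (k - 1) * real k powr (1 + \<beta>) * 1 \<le> C * e0 ^ (k - 1) * real (Suc k) powr (1 + \<beta>)"
      using C e0_pos beta_pos by (simp add: powr_mono2)
    also have "\<dots> = C / e0 * S k"
      using False e0_pos by (cases k) (auto simp: S_def)
    finally show ?thesis .
  qed
  show thesis
  proof (rule that[of "C / e0"])
    show "0 < C / e0" using C e0_pos by simp
    fix k x y assume nz: "\<And>j. j < k \<Longrightarrow> w j \<noteq> e0" and xy: "e0 \<le> x" "x \<le> y"
    have "(h k y - h k x) * real (t k) powr (1 + \<beta>) \<le>
        ((\<Prod>j<k. \<kappa> (N j)) * (y - x)) * real (t k) powr (1 + \<beta>)"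
      using prod[OF nz xy] by (intro mult_right_mono) auto
    also have "\<dots> = ((\<Prod>j<k. \<kappa> (N j)) * real (t k) powr (1 + \<beta>)) * (y - x)" by (simp add: mult_ac)
    also have "\<dots> \<le> C / e0 * S k * (y - x)" using bound[OF nz] xy by (intro mult_right_mono) auto
    finally show "(h k y - h k x) * real (t k) powr (1 + \<beta>) \<le> C / e0 * S k * (y - x)" .
  qed
qed

lemma a_diff: "m \<le> n \<Longrightarrow> a m - a n \<le> p m - p n"
proof -
  assume mn: "m \<le> n"
  have "a m - a n \<le> e0 * (p m - p n)"
    unfolding a_def using p_le[OF mn] p_pos[of n] by (intro R_contr) auto
  also have "\<dots> \<le> 1 * (p m - p n)" using p_le[OF mn] e0_less by (intro mult_right_mono) auto
  finally show ?thesis by simp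
qed

lemma p_diff_sum:
  assumes C: "C > 0" "\<And>n. n \<ge> 1 \<Longrightarrow> p n - p (Suc n) \<le> C * real n powr (- (1 + \<beta>))"
    and m: "1 \<le> m"
  shows "p m - p (m + i) \<le> C * real i * real m powr (- (1 + \<beta>))"
proof (induction i)
  case (Suc i)
  have "p (m + i) - p (Suc (m + i)) \<le> C * real (m + i) powr (- (1 + \<beta>))" by (rule C(2)) (use m in simp)
  also have "\<dots> \<le> C * real m powr (- (1 + \<beta>))"
    using C(1) m beta_pos by (intro mult_left_mono powr_mono2') auto
  finally show ?case using Suc by (simp add: algebra_simps)
qed simp

text \<open>The window of last return times costs a factor \<open>t k\<close>, the contraction gains
  (t k)^(1+\<beta>); this inequality balances the two.\<close>

lemma nat_le_powr: "real n \<le> real n powr (1 + \<beta>)"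
proof (cases "n = 0")
  case False
  then have "real n powr 1 \<le> real n powr (1 + \<beta>)" using beta_pos by (intro powr_mono) auto
  then show ?thesis using False by simp
qed simp

end

context intermittent_acip begin

section \<open>Mass of the exceptional sets, block by block\<close>

definition K :: real where "K = 1 / (e0 - p 2)"

lemma K_pos: "K > 0" using p_less[of 1 2] p_1 by (simp add: K_def)

lemma mu0_interval:
  assumes "e0 \<le> c" "d \<le> 1" "d - c \<le> r" "0 \<le> r"
  shows "emeasure \<mu>0 {c..<d} \<le> ennreal (K * r)"
proof (cases "c \<le> d")
  case True
  have "emeasure \<mu>0 {c..<d} \<le> ennreal ((d - c) / (e0 - p 2))"
    by (rule B.invariant_measure_upper[OF mu0(1,2,3,5) assms(1) True assms(2)])
  also have "\<dots> \<le> ennreal (K * r)"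
    using assms K_pos mult_left_mono[of "d - c" r K] by (intro ennreal_leI) (simp add: K_def)
  finally show ?thesis .
qed simp

text \<open>
  \<open>near n k\<close> contains the points of the block \<open>[e\<^sub>k, e\<^sub>k\<^sub>+\<^sub>1)\<close> at which the two sides of the first
  claim may differ, and \<open>tail n k\<close> those with \<open>\<phi> > n\<close>.
\<close>

definition near :: "nat \<Rightarrow> nat \<Rightarrow> real set" where
  "near n k = (if w k = e0 then {} else if n < 2 * t k then {e k..<1}
     else {min 1 (h k (a n))..<min 1 (h k (a (n - t k)))})"

definition tail :: "nat \<Rightarrow> nat \<Rightarrow> real set" where
  "tail n k = (if w k = e0 then {} else if n < 2 * t k then {e k..<1}
     else {e k..<min 1 (h k (a (n - t k)))})"

lemma pm_e_range: "e0 \<le> e k"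
  using h_ge[of e0 k] by (simp add: pm_e_eq)

lemma h_a_ge: "e0 \<le> h k (a n)" by (rule h_ge) (use a_gt[of n] in simp)

lemma near_sets: "near n k \<in> sets \<mu>0" "tail n k \<in> sets \<mu>0"
proof -
  have "near n k \<in> sets borel" "tail n k \<in> sets borel" by (auto simp: near_def tail_def)
  moreover have "near n k \<subseteq> {e0..1}" "tail n k \<subseteq> {e0..1}"
    using pm_e_range[of k] h_a_ge[of k n] e0_less by (auto simp: near_def tail_def)
  ultimately show "near n k \<in> sets \<mu>0" "tail n k \<in> sets \<mu>0" using borel_sets by blast+
qed

text \<open>With \<open>t k > n / 2\<close> the excursion bound alone makes all of
  \<open>[e k, 1)\<close> short enough.\<close>

lemma long_block:
  obtains C where "C > 0" "\<And>n k. 1 \<le> n \<Longrightarrow> w k \<noteq> e0 \<Longrightarrow> n < 2 * t k \<Longrightarrow>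
      1 - e k \<le> C * S k * real n powr (- (1 + \<beta>))"
proof -
  obtain C where C: "C > 0" "\<And>k x y. (\<And>j. j < k \<Longrightarrow> w j \<noteq> e0) \<Longrightarrow> e0 \<le> x \<Longrightarrow> x \<le> y \<Longrightarrow>
       (h k y - h k x) * real (t k) powr (1 + \<beta>) \<le> C * S k * (y - x)"
    by (rule h_contr_excursion) blast
  have "1 - e k \<le> C * 2 powr (1 + \<beta>) * S k * real n powr (- (1 + \<beta>))"
    if n: "1 \<le> n" and nz: "w k \<noteq> e0" and tk: "n < 2 * t k" for n k
  proof -
    have e: "1 - e k = h k (w k) - h k e0" by (simp add: pm_e_eq h_w)
    have nn: "0 \<le> 1 - e k" using pm_e_le_1[of k] by simp
    have "(1 - e k) * real (t k) powr (1 + \<beta>) \<le> C * S k * (w k - e0)"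
      unfolding e by (rule C(2)) (use act_mono[OF nz] w_range in auto)
    also have "\<dots> \<le> C * S k * 1"
      using C S_nonneg[of k] w_range[of k] e0_pos by (intro mult_left_mono) auto
    finally have 1: "(1 - e k) * real (t k) powr (1 + \<beta>) \<le> C * S k" by simp
    have "(real n / 2) powr (1 + \<beta>) \<le> real (t k) powr (1 + \<beta>)"
      using tk beta_pos by (intro powr_mono2) auto
    then have "(1 - e k) * (real n / 2) powr (1 + \<beta>) \<le> C * S k"
      using mult_left_mono[OF _ nn] 1 by (blast intro: order_trans)
    moreover define X where "X = real n powr (1 + \<beta>)"
    moreover define P where "P = (2::real) powr (1 + \<beta>)"
    ultimately have "(1 - e k) * (X / P) \<le> C * S k" by (simp add: powr_divide)
    moreover have "0 < X" "0 < P" using n by (simp_all add: X_def P_def)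
    ultimately have "1 - e k \<le> C * P * S k * inverse X" by (simp add: field_simps)
    then show ?thesis unfolding X_def P_def powr_minus .
  qed
  then show thesis using that[of "C * 2 powr (1 + \<beta>)"] C by simp
qed

text \<open>For \<open>2 * t k \<le> n\<close> the window between \<open>a n\<close> and
  \<open>a (n - t k)\<close> consists of \<open>t k\<close> steps, each O(n^-(1+\<beta>)); the
  contraction of \<open>h k\<close> absorbs their number. For \<open>t k = 0\<close> the window is
  empty.\<close>

lemma near_bound:
  obtains C where "C > 0" "\<And>n k. 1 \<le> n \<Longrightarrow>
    emeasure \<mu>0 (near n k) \<le> ennreal (C * real n powr (- (1 + \<beta>)) * S k)"
proof -
  obtain C1 where C1: "C1 > 0" "\<And>n k. 1 \<le> n \<Longrightarrow> w k \<noteq> e0 \<Longrightarrow> n < 2 * t k \<Longrightarrow>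
      1 - e k \<le> C1 * S k * real n powr (- (1 + \<beta>))"
    by (rule long_block) blast
  obtain C2 where C2: "C2 > 0" "\<And>k x y. (\<And>j. j < k \<Longrightarrow> w j \<noteq> e0) \<Longrightarrow> e0 \<le> x \<Longrightarrow> x \<le> y \<Longrightarrow>
       (h k y - h k x) * real (t k) powr (1 + \<beta>) \<le> C2 * S k * (y - x)"
    by (rule h_contr_excursion) blast
  obtain C3 where C3: "C3 > 0" "\<And>n. n \<ge> 1 \<Longrightarrow> p n - p (Suc n) \<le> C3 * real n powr (- (1 + \<beta>))"
    by (rule p_diff_upper) blast
  define C4 where "C4 = C3 * 2 powr (1 + \<beta>) * C2"
  have C4: "C4 > 0" using C2 C3 by (simp add: C4_def)
  define C where "C = K * (C1 + C4)"
  have main: "emeasure \<mu>0 (near n k) \<le> ennreal (C * real n powr (- (1 + \<beta>)) * S k)" if n: "1 \<le> n" for n k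
  proof -
    let ?r = "(C1 + C4) * S k * real n powr (- (1 + \<beta>))"
    have r: "0 \<le> ?r" using C1 C4 S_nonneg by simp
    have "emeasure \<mu>0 (near n k) \<le> ennreal (K * ?r)"
    proof (cases "w k = e0")
      case True then show ?thesis by (simp add: near_def)
    next
      case nz: False
      show ?thesis
      proof (cases "n < 2 * t k")
        case True
        have "1 - e k \<le> C1 * S k * real n powr (- (1 + \<beta>))" by (rule C1(2)[OF n nz True])
        also have "\<dots> \<le> ?r" using C4 S_nonneg[of k] by (simp add: algebra_simps)
        finally have "emeasure \<mu>0 {e k..<1} \<le> ennreal (K * ?r)"
          using r pm_e_range by (intro mu0_interval) auto
        then show ?thesis using True nz by (simp add: near_def)
      next
        case False
        then have tn: "2 * t k \<le> n" by simp
        have tn': "t k \<le> n" "1 \<le> n - t k" "n - t k + t k = n" using tn n by auto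
        have ale: "a n \<le> a (n - t k)" by (rule a_le) simp
        have hle: "h k (a n) \<le> h k (a (n - t k))"
          using concave_incr_le[OF concave_h _ ale, of k] a_gt[of n] e0_pos by simp
        define D where "D = h k (a (n - t k)) - h k (a n)"
        define \<delta> where "\<delta> = a (n - t k) - a n"
        have D0: "0 \<le> D" "0 \<le> \<delta>" using hle ale by (auto simp: D_def \<delta>_def)
        have "\<delta> \<le> p (n - t k) - p n" unfolding \<delta>_def by (rule a_diff) simp
        also have "\<dots> \<le> C3 * real (t k) * real (n - t k) powr (- (1 + \<beta>))"
          using p_diff_sum[OF C3 tn'(2), of "t k"] tn'(3) by simp
        also have "\<dots> \<le> C3 * real (t k) * (2 powr (1 + \<beta>) * real n powr (- (1 + \<beta>)))"
          using C3 half_powr[OF n tn, of "1 + \<beta>"] beta_pos by (intro mult_left_mono) auto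
        finally have \<delta>: "\<delta> \<le> C3 * 2 powr (1 + \<beta>) * real n powr (- (1 + \<beta>)) * real (t k)" by (simp add: mult_ac)
        have "D \<le> ?r"
        proof (cases "t k = 0")
          case True
          then show ?thesis using r by (simp add: D_def)
        next
          case False
          define P where "P = real (t k) powr (1 + \<beta>)"
          have P: "0 < P" "real (t k) \<le> P" using False nat_le_powr[of "t k"] by (auto simp: P_def)
          have "D * P \<le> C2 * S k * \<delta>"
            unfolding D_def \<delta>_def P_def using a_gt[of n] ale act_mono[OF nz] by (intro C2(2)) auto
          also have "\<dots> \<le> C2 * S k * (C3 * 2 powr (1 + \<beta>) * real n powr (- (1 + \<beta>)) * real (t k))"
            using \<delta> C2 S_nonneg[of k] by (intro mult_left_mono) auto
          also have "\<dots> \<le> C2 * S k * (C3 * 2 powr (1 + \<beta>) * real n powr (- (1 + \<beta>)) * P)"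
            using P C2 C3 S_nonneg[of k] by (intro mult_left_mono) auto
          also have "\<dots> = (C4 * S k * real n powr (- (1 + \<beta>))) * P" by (simp add: C4_def mult_ac)
          finally have "D \<le> C4 * S k * real n powr (- (1 + \<beta>))" using P(1) by simp
          also have "\<dots> \<le> ?r" using C1 S_nonneg[of k] by (simp add: algebra_simps)
          finally show ?thesis .
        qed
        \<comment> \<open>\<open>h k\<close> is defined beyond \<open>w k\<close>, so its values may
          exceed 1. Clipping both ends at 1 does not lengthen the interval.\<close>
        then have "emeasure \<mu>0 {min 1 (h k (a n))..<min 1 (h k (a (n - t k)))} \<le> ennreal (K * ?r)"
          using r hle h_a_ge[of k n] e0_less by (intro mu0_interval) (auto simp: D_def min_def)
        then show ?thesis using False nz by (simp add: near_def)
      qed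
    qed
    then show ?thesis by (simp add: C_def mult_ac)
  qed
  show thesis by (rule that[of C]) (use main C1 C4 K_pos in \<open>auto simp: C_def\<close>)
qed

text \<open>For \<open>2 * t k \<le> n\<close> the plain contraction e0^k suffices, because
  \<open>[e0, a (n - t k))\<close> already has length O(n^-\<beta>). The longer blocks are smaller
  by another factor n.\<close>

lemma tail_bound:
  obtains C where "C > 0" "\<And>n k. 1 \<le> n \<Longrightarrow>
    emeasure \<mu>0 (tail n k) \<le> ennreal (C * real n powr (- \<beta>) * S k)"
proof -
  obtain C1 where C1: "C1 > 0" "\<And>n k. 1 \<le> n \<Longrightarrow> w k \<noteq> e0 \<Longrightarrow> n < 2 * t k \<Longrightarrow>
      1 - e k \<le> C1 * S k * real n powr (- (1 + \<beta>))"
    by (rule long_block) blast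
  obtain C3 where C3: "C3 > 0" "\<And>n. n \<ge> 1 \<Longrightarrow> p n \<le> C3 * real n powr (- \<beta>)"
    by (rule p_upper) blast
  define C4 where "C4 = C3 * 2 powr \<beta>"
  have C4: "C4 > 0" using C3 by (simp add: C4_def)
  define C where "C = K * (C1 + C4)"
  have main: "emeasure \<mu>0 (tail n k) \<le> ennreal (C * real n powr (- \<beta>) * S k)" if n: "1 \<le> n" for n k
  proof -
    let ?r = "(C1 + C4) * S k * real n powr (- \<beta>)"
    have r: "0 \<le> ?r" using C1 C4 S_nonneg by simp
    have "emeasure \<mu>0 (tail n k) \<le> ennreal (K * ?r)"
    proof (cases "w k = e0")
      case True then show ?thesis by (simp add: tail_def)
    next
      case nz: False
      show ?thesis
      proof (cases "n < 2 * t k")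
        case True
        have "1 - e k \<le> C1 * S k * real n powr (- (1 + \<beta>))" by (rule C1(2)[OF n nz True])
        also have "\<dots> \<le> C1 * S k * real n powr (- \<beta>)"
          using C1 S_nonneg[of k] n by (intro mult_left_mono powr_mono) auto
        also have "\<dots> \<le> ?r" using C4 S_nonneg[of k] by (simp add: algebra_simps)
        finally have "emeasure \<mu>0 {e k..<1} \<le> ennreal (K * ?r)"
          using r pm_e_range by (intro mu0_interval) auto
        then show ?thesis using True nz by (simp add: tail_def)
      next
        case False
        then have tn: "2 * t k \<le> n" by simp
        have tn': "1 \<le> n - t k" using tn n by auto
        have "h k (a (n - t k)) - e k \<le> e0 ^ k * (a (n - t k) - e0)"
          unfolding pm_e_eq using a_gt[of "n - t k"] act_mono[OF nz] by (intro h_contr) auto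
        also have "\<dots> \<le> S k * (a (n - t k) - e0)"
          using S_ge[of k] a_gt[of "n - t k"] by (intro mult_right_mono) auto
        also have "\<dots> \<le> S k * p (n - t k)"
        proof (rule mult_left_mono[OF _ S_nonneg])
          have "a (n - t k) - e0 \<le> e0 * p (n - t k)"
            using R_contr[of 0 "p (n - t k)"] p_pos[of "n - t k"] by (simp add: a_def R_0)
          also have "\<dots> \<le> 1 * p (n - t k)" using e0_less p_pos[of "n - t k"] by (intro mult_right_mono) auto
          finally show "a (n - t k) - e0 \<le> p (n - t k)" by simp
        qed
        also have "\<dots> \<le> S k * (C3 * real (n - t k) powr (- \<beta>))"
          using C3(2)[OF tn'] S_nonneg[of k] by (intro mult_left_mono) auto
        also have "\<dots> \<le> S k * (C3 * (2 powr \<beta> * real n powr (- \<beta>)))"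
          using half_powr[OF n tn, of \<beta>] beta_pos C3 S_nonneg[of k] by (intro mult_left_mono) auto
        also have "\<dots> = C4 * S k * real n powr (- \<beta>)" by (simp add: C4_def mult_ac)
        also have "\<dots> \<le> ?r" using C1 S_nonneg[of k] by (simp add: algebra_simps)
        finally have "emeasure \<mu>0 {e k..<min 1 (h k (a (n - t k)))} \<le> ennreal (K * ?r)"
          using r pm_e_range[of k] by (intro mu0_interval) auto
        then show ?thesis using False nz by (simp add: tail_def)
      qed
    qed
    then show ?thesis by (simp add: C_def mult_ac)
  qed
  show thesis by (rule that[of C]) (use main C1 C4 K_pos in \<open>auto simp: C_def\<close>)
qed

text \<open>On the k-th block the tower sum has \<open>\<rho> = k + 1\<close> terms, so k + 1 bounds
  every discrepancy there. Summing over all k makes it unnecessary to name the block of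
  \<open>y\<close> inside an integral.\<close>

definition weight :: "(nat \<Rightarrow> real set) \<Rightarrow> real \<Rightarrow> ennreal" where
  "weight E y = (\<Sum>k. of_nat (Suc k) * indicator (E k) y)"

lemma weight_ge: "y \<in> E k \<Longrightarrow> of_nat (Suc k) \<le> weight E y"
  unfolding weight_def using sum_le_suminf[of "\<lambda>k. of_nat (Suc k) * indicator (E k) y :: ennreal" "{k}"] by simp

lemma weight_meas:
  assumes [measurable]: "\<And>k. E k \<in> sets \<mu>0" shows "weight E \<in> borel_measurable \<mu>0"
  unfolding weight_def by measurable

lemma weight_integral:
  assumes E: "\<And>k. E k \<in> sets \<mu>0" and le: "\<And>k. emeasure \<mu>0 (E k) \<le> ennreal (c * S k)" and c: "0 \<le> c"
  shows "(\<integral>\<^sup>+y. weight E y \<partial>\<mu>0) \<le> ennreal (c * (\<Sum>k. real (Suc k) * S k))"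
proof -
  have "(\<integral>\<^sup>+y. weight E y \<partial>\<mu>0) = (\<Sum>k. of_nat (Suc k) * emeasure \<mu>0 (E k))"
    unfolding weight_def using E by (simp add: nn_integral_suminf nn_integral_cmult)
  also have "\<dots> \<le> (\<Sum>k. ennreal (c * (real (Suc k) * S k)))"
  proof (intro suminf_le summableI allI)
    fix k
    have "of_nat (Suc k) * emeasure \<mu>0 (E k) \<le> ennreal (real (Suc k)) * ennreal (c * S k)"
      using le[of k] by (intro mult_mono) (auto simp: ennreal_of_nat_eq_real_of_nat)
    also have "\<dots> = ennreal (c * (real (Suc k) * S k))"
      using c S_nonneg[of k] by (subst ennreal_mult[symmetric]) (auto simp: mult_ac)
    finally show "of_nat (Suc k) * emeasure \<mu>0 (E k) \<le> ennreal (c * (real (Suc k) * S k))" .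
  qed
  also have "\<dots> = ennreal (\<Sum>k. c * (real (Suc k) * S k))"
    using c S_nonneg S_summable by (intro suminf_ennreal2 summable_mult) auto
  also have "(\<Sum>k. c * (real (Suc k) * S k)) = c * (\<Sum>k. real (Suc k) * S k)"
    using S_summable by (rule suminf_mult)
  finally show ?thesis .
qed


declare pm_e.simps(2) [simp del]

section \<open>Comparison of the two tails\<close>

definition T :: "nat \<Rightarrow> real set" where "T n = {y \<in> {e0..1}. \<tau> y > enat n}"
definition Phi :: "nat \<Rightarrow> real set" where "Phi n = {y \<in> {e0..1}. \<phi> y > enat n}"

lemma block_cases:
  assumes "e0 \<le> y" "y < 1"
  obtains k z where "w k \<noteq> e0" "e0 \<le> z" "z < a (N k)" "z < 1" "y = h k z" "\<rho> y = Suc k"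
    "\<phi> y = enat (t k) + \<tau> z" "\<And>j. j < k \<Longrightarrow> \<tau> ((F ^^ j) y) = enat (N j)" "(F ^^ k) y = z"
    "e k \<le> y" "y < e (Suc k)"
proof -
  obtain k where k: "e k \<le> y" "y < e (Suc k)" using block_exists[OF assms] by blast
  obtain z where z: "w k \<noteq> e0" "e0 \<le> z" "z < a (N k)" "y = h k z" using block_param[OF k] by blast
  have "z < 1" using z a_N_le by force
  with block_orbit[OF z(1-3)] show thesis using that k z by blast
qed

lemma phi_gt_iff:
  assumes "e0 \<le> z" "z < 1" "j \<le> n" shows "enat n < enat j + \<tau> z \<longleftrightarrow> z < a (n - j)"
proof -
  have "enat n < enat j + \<tau> z \<longleftrightarrow> enat (n - j) < \<tau> z" using assms(3) by (cases "\<tau> z") auto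
  then show ?thesis using tau_gt_iff[OF assms(1,2)] by simp
qed

lemma T_sets: "T n \<in> sets \<mu>0"
proof (rule borel_sets_mod_1)
  have "T n \<inter> {e0..<1} = {e0..<min 1 (a n)}" using tau_gt_iff by (auto simp: T_def)
  then show "T n \<inter> {e0..<1} \<in> sets borel" by simp
qed (auto simp: T_def)

lemma Phi_sets: "Phi n \<in> sets \<mu>0"
proof (rule borel_sets_mod_1)
  let ?c = "\<lambda>k. if n < t k then 1 else h k (a (n - t k))"
  have "Phi n \<inter> {e0..<1} = (\<Union>k. {e k..<min (e (Suc k)) (?c k)})"
  proof (intro set_eqI iffI)
    fix y assume y: "y \<in> Phi n \<inter> {e0..<1}"
    then have y1: "e0 \<le> y" "y < 1" "enat n < \<phi> y" by (auto simp: Phi_def)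
    from block_cases[OF y1(1,2)] obtain k z where k: "e0 \<le> z" "z < 1" "y = h k z" "\<phi> y = enat (t k) + \<tau> z"
      "e k \<le> y" "y < e (Suc k)" by metis
    have "y < ?c k"
    proof (cases "n < t k")
      case False
      then have "z < a (n - t k)" using y1(3) k phi_gt_iff[of z "t k" n] by simp
      then show ?thesis using False k concave_incr_less[OF concave_h, of z "a (n - t k)" k] e0_pos by simp
    qed (use y1 in simp)
    then show "y \<in> (\<Union>k. {e k..<min (e (Suc k)) (?c k)})" using k by auto
  next
    fix y assume "y \<in> (\<Union>k. {e k..<min (e (Suc k)) (?c k)})"
    then obtain k where k: "e k \<le> y" "y < e (Suc k)" "y < ?c k" by auto
    obtain z where z: "w k \<noteq> e0" "e0 \<le> z" "z < a (N k)" "y = h k z" using block_param[OF k(1,2)] by blast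
    have y: "e0 \<le> y" "y < 1" using k pm_e_range[of k] pm_e_le_1[of "Suc k"] by auto
    have z1: "z < 1" using z a_N_le by force
    have "enat n < \<phi> y"
    proof (cases "n < t k")
      case True
      then show ?thesis using block_orbit(2)[OF z(1-3)] z(4) by (cases "\<tau> z") auto
    next
      case False
      then have "h k z < h k (a (n - t k))" using k(3) z by simp
      then have "z < a (n - t k)"
        using concave_incr_less_iff[OF concave_h, of z "a (n - t k)" k] z a_gt[of "n - t k"] e0_pos by simp
      then show ?thesis using phi_gt_iff[OF z(2) z1, of "t k" n] False block_orbit(2)[OF z(1-3)] z(4) by simp
    qed
    then show "y \<in> Phi n \<inter> {e0..<1}" using y by (simp add: Phi_def)
  qed
  then show "Phi n \<inter> {e0..<1} \<in> sets borel" by simp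
qed (auto simp: Phi_def)

lemma sum_indicator_le: "(\<Sum>j<m. indicator B (x j)) \<le> (of_nat m :: ennreal)"
proof -
  have "(\<Sum>j<m. indicator B (x j)) \<le> (\<Sum>j<m. 1 :: ennreal)"
    by (intro sum_mono) (auto split: split_indicator)
  then show ?thesis by simp
qed

text \<open>Two inequalities replace an absolute difference, which \<open>ennreal\<close> does not
  offer. If \<open>n < 2 * t k\<close>, both quantities are at most k + 1. Otherwise the first k
  return times are at most \<open>t k \<le> n\<close> and do not count; what is left is to compare
  \<open>z < a n\<close> with \<open>z < a (n - t k)\<close>, where \<open>z\<close> is the k-th
  return of \<open>y\<close>.\<close>

lemma tower_sum_near:
  assumes y: "e0 \<le> y" "y < 1"
  shows "(\<Sum>j<\<rho> y. indicator (T n) ((F ^^ j) y)) \<le> (indicator (Phi n) y :: ennreal) + weight (near n) y"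
    and "(indicator (Phi n) y :: ennreal) \<le> (\<Sum>j<\<rho> y. indicator (T n) ((F ^^ j) y)) + weight (near n) y"
proof -
  let ?u = "\<Sum>j<\<rho> y. indicator (T n) ((F ^^ j) y) :: ennreal"
  let ?v = "indicator (Phi n) y :: ennreal"
  obtain k z where k: "w k \<noteq> e0" "e0 \<le> z" "z < a (N k)" "z < 1" "y = h k z" "\<rho> y = Suc k"
    "\<phi> y = enat (t k) + \<tau> z" "\<And>j. j < k \<Longrightarrow> \<tau> ((F ^^ j) y) = enat (N j)" "(F ^^ k) y = z"
    "e k \<le> y" "y < e (Suc k)"
    by (rule block_cases[OF y]) blast
  have "?u \<le> ?v + weight (near n) y \<and> ?v \<le> ?u + weight (near n) y"
  proof (cases "n < 2 * t k")
    case True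
    then have "y \<in> near n k" using k y by (simp add: near_def)
    then have W: "of_nat (Suc k) \<le> weight (near n) y" by (rule weight_ge)
    have "?u \<le> of_nat (Suc k)" using sum_indicator_le[of "T n" _ "\<rho> y"] k(6) by simp
    moreover have "?v \<le> of_nat (Suc k)" by (auto split: split_indicator)
    ultimately show ?thesis using W by (meson order_trans le_add_same_cancel2 zero_le add_increasing)
  next
    case False
    then have tn: "2 * t k \<le> n" by simp
    have Nt: "N j \<le> t k" if "j < k" for j
      unfolding t_def using that by (intro member_le_sum) auto
    have "(F ^^ j) y \<notin> T n" if "j < k" for j
    proof
      assume "(F ^^ j) y \<in> T n"
      then have "enat n < enat (N j)" unfolding T_def k(8)[OF that, symmetric] by blast
      then show False using Nt[OF that] tn by simp
    qed
    then have u: "?u = indicator (T n) z" using k(6,9) by simp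
    have zT: "z \<in> T n \<longleftrightarrow> z < a n" using tau_gt_iff[OF k(2,4)] k(2,4) by (simp add: T_def)
    have yP: "y \<in> Phi n \<longleftrightarrow> z < a (n - t k)"
      using phi_gt_iff[OF k(2,4), of "t k" n] tn k(7) y by (simp add: Phi_def)
    have ale: "a n \<le> a (n - t k)" by (rule a_le) simp
    have 1: "?u \<le> ?v" unfolding u using zT yP ale by (auto split: split_indicator)
    have 2: "?v \<le> ?u + weight (near n) y"
    proof (cases "y \<in> Phi n \<and> z \<notin> T n")
      case True
      then have z: "a n \<le> z" "z < a (n - t k)" using zT yP by auto
      have "h k (a n) \<le> y" "y < h k (a (n - t k))"
        using concave_incr_le[OF concave_h _ z(1), of k] concave_incr_less[OF concave_h _ z(2), of k]
          a_gt[of n] k(2,5) e0_pos by auto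
      then have "y \<in> near n k" using k(1) False y by (simp add: near_def min_le_iff_disj)
      from weight_ge[of y "near n", OF this] have "1 \<le> weight (near n) y"
        by (rule order_trans[rotated]) simp
      then show ?thesis by (auto split: split_indicator intro: add_increasing)
    qed (auto simp: u split: split_indicator)
    show ?thesis using 1 2 by (auto intro: add_increasing2)
  qed
  then show "?u \<le> ?v + weight (near n) y" "?v \<le> ?u + weight (near n) y" by auto
qed

lemma rho_tail:
  assumes y: "e0 \<le> y" "y < 1"
  shows "of_nat (\<rho> y) * (indicator (Phi n) y :: ennreal) \<le> weight (tail n) y"
proof (cases "y \<in> Phi n")
  case True
  obtain k z where k: "w k \<noteq> e0" "e0 \<le> z" "z < a (N k)" "z < 1" "y = h k z" "\<rho> y = Suc k"
    "\<phi> y = enat (t k) + \<tau> z" "e k \<le> y"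
    by (rule block_cases[OF y]) blast
  have "y \<in> tail n k"
  proof (cases "n < 2 * t k")
    case True then show ?thesis using k y by (simp add: tail_def)
  next
    case False
    then have "z < a (n - t k)"
      using phi_gt_iff[OF k(2,4), of "t k" n] k(7) \<open>y \<in> Phi n\<close> by (simp add: Phi_def)
    then have "y < h k (a (n - t k))"
      using concave_incr_less[OF concave_h, of z "a (n - t k)" k] k(2,5) e0_pos by simp
    then show ?thesis using False k y by (simp add: tail_def)
  qed
  from weight_ge[of y "tail n", OF this] show ?thesis using k(6) True by simp
qed simp

text \<open>\<open>\<rho>\<close> is integrable because the mass of \<open>[e k, 1)\<close> decays
  like e0^k; this makes the normalisation of the tower possible.\<close>

lemma nn_rho: obtains r where "r > 0" "(\<integral>\<^sup>+y. of_nat (\<rho> y) \<partial>\<mu>0) = ennreal r"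
    "(LINT y|\<mu>0. real (\<rho> y)) = r"
proof -
  interpret prob_space \<mu>0 by (rule mu0)
  let ?E = "\<lambda>k. {e k..<1}"
  have "AE y in \<mu>0. of_nat (\<rho> y) \<le> weight ?E y"
    using AE_less_1
  proof eventually_elim
    case (elim y)
    then obtain k where "e k \<le> y" "\<rho> y = Suc k" using block_cases by metis
    then show ?case using weight_ge[of y ?E k] elim by simp
  qed
  then have "(\<integral>\<^sup>+y. of_nat (\<rho> y) \<partial>\<mu>0) \<le> (\<integral>\<^sup>+y. weight ?E y \<partial>\<mu>0)" by (rule nn_integral_mono_AE)
  also have "\<dots> \<le> ennreal (K * (\<Sum>k. real (Suc k) * S k))"
  proof (rule weight_integral)
    fix k
    show "?E k \<in> sets \<mu>0" by (rule borel_sets) (use pm_e_range[of k] in auto)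
    show "emeasure \<mu>0 (?E k) \<le> ennreal (K * S k)"
      by (rule mu0_interval) (use pm_e_range pm_e_ge[of k] S_ge[of k] S_nonneg in auto)
  qed (use K_pos in simp)
  finally have fin: "(\<integral>\<^sup>+y. of_nat (\<rho> y) \<partial>\<mu>0) < \<infinity>" by (simp add: le_less_trans)
  define r where "r = (LINT y|\<mu>0. real (\<rho> y))"
  have int: "integrable \<mu>0 (\<lambda>y. real (\<rho> y))"
    using rho_meas fin by (intro integrableI_nonneg) (auto simp: ennreal_of_nat_eq_real_of_nat)
  have eq: "(\<integral>\<^sup>+y. of_nat (\<rho> y) \<partial>\<mu>0) = ennreal r"
    using nn_integral_eq_integral[OF int] by (simp add: r_def ennreal_of_nat_eq_real_of_nat)
  have "(\<integral>\<^sup>+y. 1 \<partial>\<mu>0) \<le> (\<integral>\<^sup>+y. of_nat (\<rho> y) \<partial>\<mu>0)"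
    \<comment> \<open>The summand 1 in \<open>pm_rho\<close> gives \<open>\<rho> \<ge> 1\<close>
      everywhere, including the point 1 where the index is unspecified.\<close>
    by (intro nn_integral_mono) (simp add: pm_rho_def)
  then have "1 \<le> ennreal r" using eq emeasure_space_1 by simp
  then have "r > 0" by (metis ennreal_neg not_less not_one_le_zero)
  then show thesis using that eq r_def by blast
qed

theorem tail_comparison:
  "(\<lambda>n. \<bar>1 / (LINT y|\<mu>0. real (\<rho> y)) * measure \<mu>0 (Phi n) - measure \<mu>\<tau> (T n)\<bar>)
     \<in> O(\<lambda>n. real n powr (- (1 + \<beta>)))"
proof -
  interpret prob_space \<mu>0 by (rule mu0)
  interpret M\<tau>: prob_space \<mu>\<tau> by (rule mut)
  obtain r where r: "r > 0" "(\<integral>\<^sup>+y. of_nat (\<rho> y) \<partial>\<mu>0) = ennreal r" "(LINT y|\<mu>0. real (\<rho> y)) = r"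
    by (rule nn_rho) blast
  obtain C where C: "C > 0" "\<And>n k. 1 \<le> n \<Longrightarrow>
      emeasure \<mu>0 (near n k) \<le> ennreal (C * real n powr (- (1 + \<beta>)) * S k)"
    by (rule near_bound) blast
  define D where "D = C * (\<Sum>k. real (Suc k) * S k)"
  have tower: "tower \<mu>0 F \<rho> (ennreal (1 / r)) = \<mu>\<tau>"
    by (rule tower_eq) (use r in \<open>simp flip: ennreal_mult\<close>)
  have main: "norm \<bar>1 / r * measure \<mu>0 (Phi n) - measure \<mu>\<tau> (T n)\<bar> \<le> D / r * norm (real n powr (- (1 + \<beta>)))"
    if n: "1 \<le> n" for n
  proof -
    let ?u = "\<lambda>y. \<Sum>j<\<rho> y. indicator (T n) ((F ^^ j) y) :: ennreal"
    let ?W = "weight (near n)"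
    have um: "?u \<in> borel_measurable \<mu>0" by (rule tower_sum_measurable[OF F_meas_mu0 rho_meas T_sets])
    have Wm: "?W \<in> borel_measurable \<mu>0" by (rule weight_meas) (rule near_sets)
    have vm: "(indicator (Phi n) :: real \<Rightarrow> ennreal) \<in> borel_measurable \<mu>0" using Phi_sets by simp
    have Wi: "(\<integral>\<^sup>+y. ?W y \<partial>\<mu>0) \<le> ennreal (D * real n powr (- (1 + \<beta>)))"
      using weight_integral[of "near n" "C * real n powr (- (1 + \<beta>))"] near_sets C n
      by (simp add: D_def mult_ac)
    have D0: "0 \<le> D * real n powr (- (1 + \<beta>))"
      using C S_nonneg S_summable by (auto simp: D_def intro!: mult_nonneg_nonneg suminf_nonneg)
    have e\<tau>: "emeasure \<mu>\<tau> (T n) = ennreal (1 / r) * (\<integral>\<^sup>+y. ?u y \<partial>\<mu>0)"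
      using emeasure_tower[OF F_meas_mu0 rho_meas T_sets[of n], where c = "ennreal (1 / r)"] tower by simp
    then have "(\<integral>\<^sup>+y. ?u y \<partial>\<mu>0) \<noteq> \<infinity>"
      using M\<tau>.emeasure_finite[of "T n"] r by (auto simp: ennreal_mult_top)
    then obtain U where U: "(\<integral>\<^sup>+y. ?u y \<partial>\<mu>0) = ennreal U" "U \<ge> 0"
      by (cases "\<integral>\<^sup>+y. ?u y \<partial>\<mu>0") auto
    have mt: "measure \<mu>\<tau> (T n) = 1 / r * U"
      using e\<tau> U r by (simp add: M\<tau>.emeasure_eq_measure flip: ennreal_mult)
    have V: "(\<integral>\<^sup>+y. indicator (Phi n) y \<partial>\<mu>0) = ennreal (measure \<mu>0 (Phi n))"
      using Phi_sets by (simp add: emeasure_eq_measure)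
    have "(\<integral>\<^sup>+y. ?u y \<partial>\<mu>0) \<le> (\<integral>\<^sup>+y. indicator (Phi n) y + ?W y \<partial>\<mu>0)"
      by (rule nn_integral_mono_AE) (use AE_less_1 in \<open>eventually_elim, auto intro: tower_sum_near\<close>)
    also have "\<dots> = (\<integral>\<^sup>+y. indicator (Phi n) y \<partial>\<mu>0) + (\<integral>\<^sup>+y. ?W y \<partial>\<mu>0)"
      by (rule nn_integral_add[OF vm Wm])
    also have "\<dots> \<le> ennreal (measure \<mu>0 (Phi n)) + ennreal (D * real n powr (- (1 + \<beta>)))"
      using Wi V by (intro add_mono) auto
    finally have 1: "U \<le> measure \<mu>0 (Phi n) + D * real n powr (- (1 + \<beta>))"
      using U D0 by (simp flip: ennreal_plus)
    have "(\<integral>\<^sup>+y. indicator (Phi n) y \<partial>\<mu>0) \<le> (\<integral>\<^sup>+y. ?u y + ?W y \<partial>\<mu>0)"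
      by (rule nn_integral_mono_AE) (use AE_less_1 in \<open>eventually_elim, auto intro: tower_sum_near\<close>)
    also have "\<dots> = (\<integral>\<^sup>+y. ?u y \<partial>\<mu>0) + (\<integral>\<^sup>+y. ?W y \<partial>\<mu>0)"
      by (rule nn_integral_add[OF um Wm])
    also have "\<dots> \<le> ennreal U + ennreal (D * real n powr (- (1 + \<beta>)))"
      using Wi U by (intro add_mono) auto
    finally have 2: "measure \<mu>0 (Phi n) \<le> U + D * real n powr (- (1 + \<beta>))"
      unfolding V using U D0 by (simp flip: ennreal_plus)
    have "1 / r * measure \<mu>0 (Phi n) - measure \<mu>\<tau> (T n) = (measure \<mu>0 (Phi n) - U) / r"
      unfolding mt by (simp add: diff_divide_distrib)
    then have "\<bar>1 / r * measure \<mu>0 (Phi n) - measure \<mu>\<tau> (T n)\<bar> = \<bar>measure \<mu>0 (Phi n) - U\<bar> / r"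
      using r by simp
    also have "\<dots> \<le> (D * real n powr (- (1 + \<beta>))) / r"
      using 1 2 r by (intro divide_right_mono) auto
    finally show ?thesis by simp
  qed
  show ?thesis
    unfolding r(3) by (rule bigoI[of _ "D / r"]) (rule eventually_mono[OF eventually_ge_at_top[of 1] main])
qed

text \<open>Block 0 alone suffices: there \<open>\<phi>\<close> equals \<open>\<tau>\<close>, so
  {\<phi> > n} contains an interval \<open>[e0, a m)\<close>, whose mass is at least proportional to
  its length. The Lipschitz bound for \<open>A\<close> gives
  \<open>a m - e0 \<ge> p m / (2 + \<alpha>)\<close>, and \<open>p m\<close> is bounded below by a
  multiple of m^-\<beta>.\<close>

lemma Phi_lower:
  obtains c where "c > 0" "\<And>n. 1 \<le> n \<Longrightarrow> ennreal (c * real n powr (- \<beta>)) \<le> emeasure \<mu>0 (Phi n)"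
proof -
  obtain C where C: "C > 0" "\<And>n. n \<ge> 1 \<Longrightarrow> C * real n powr (- \<beta>) \<le> p n"
    by (rule p_lower) blast
  have w0: "w 0 \<noteq> e0" using e0_less by simp
  note N0 = a_N_le[OF w0]
  define c where "c = C * real (N 0) powr (- \<beta>) / (2 + \<alpha>) / (1 - e0)"
  have c: "c > 0" using C N0 alpha_pos e0_less by (simp add: c_def)
  have "ennreal (c * real n powr (- \<beta>)) \<le> emeasure \<mu>0 (Phi n)" if n: "1 \<le> n" for n
  proof -
    \<comment> \<open>The maximum with \<open>N 0\<close> keeps \<open>[e0, a m)\<close> inside
      block 0; since \<open>m \<le> n * N 0\<close>, it costs only a constant factor.\<close>
    define m where "m = max n (N 0)"
    have m1: "1 \<le> m" using n by (simp add: m_def)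
    have am: "e0 \<le> a m" "a m \<le> 1" "a m \<le> a n" "a m \<le> a (N 0)"
      using a_gt[of m] a_le[of n m] a_le[of "N 0" m] N0 by (auto simp: m_def)
    have "real m \<le> real n * real (N 0)"
      using n N0 mult_le_mono[of 1 n "N 0" "N 0"] mult_le_mono[of n n 1 "N 0"]
      by (auto simp: m_def simp flip: of_nat_mult)
    then have "(real n * real (N 0)) powr (- \<beta>) \<le> real m powr (- \<beta>)"
      using m1 beta_pos by (intro powr_mono2') auto
    then have "C * (real n powr (- \<beta>) * real (N 0) powr (- \<beta>)) \<le> C * real m powr (- \<beta>)"
      using C by (intro mult_left_mono) (auto simp: powr_mult)
    also have "\<dots> \<le> p m" by (rule C(2)[OF m1])
    also have "p m = A (a m) - A e0" using p_pos[of m] by (simp add: a_def A_R A_e0)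
    also have "\<dots> \<le> (2 + \<alpha>) * (a m - e0)" by (rule A_lipschitz) (use e0_pos am in auto)
    finally have "C * (real n powr (- \<beta>) * real (N 0) powr (- \<beta>)) / (2 + \<alpha>) \<le> a m - e0"
      using alpha_pos by (simp add: field_simps)
    then have "C * (real n powr (- \<beta>) * real (N 0) powr (- \<beta>)) / (2 + \<alpha>) / (1 - e0) \<le> (a m - e0) / (1 - e0)"
      using e0_less by (intro divide_right_mono) auto
    then have "c * real n powr (- \<beta>) \<le> (a m - e0) / (1 - e0)" by (simp add: c_def mult_ac)
    then have "ennreal (c * real n powr (- \<beta>)) \<le> ennreal ((a m - e0) / (1 - e0))" by (rule ennreal_leI)
    also have "\<dots> \<le> emeasure \<mu>0 {e0..<a m}"
      by (rule B.invariant_measure_lower_left[OF mu0(1,2,3,5) am(1,2)])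
    also have "\<dots> \<le> emeasure \<mu>0 (Phi n)"
    proof (rule emeasure_mono[OF _ Phi_sets])
      show "{e0..<a m} \<subseteq> Phi n"
      proof
        fix y assume y: "y \<in> {e0..<a m}"
        then have y1: "e0 \<le> y" "y < a (N 0)" "y < 1" "y < a n" using am by auto
        have "\<phi> y = enat (t 0) + \<tau> y" using block_orbit(2)[OF w0 y1(1,2)] by simp
        then have "enat n < \<phi> y" using phi_gt_iff[OF y1(1,3), of "t 0" n] y1(4) by (simp add: t_def)
        then show "y \<in> Phi n" using y1 by (simp add: Phi_def)
      qed
    qed
    finally show ?thesis .
  qed
  then show thesis using that c by blast
qed

theorem rho_tail_integral:
  "\<exists>C>0. \<forall>n. (\<integral>\<^sup>+ y \<in> Phi n. ennreal (real (\<rho> y)) \<partial>\<mu>0) \<le> ennreal C * emeasure \<mu>0 (Phi n)"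
proof -
  obtain r where r: "r > 0" "(\<integral>\<^sup>+y. of_nat (\<rho> y) \<partial>\<mu>0) = ennreal r"
    by (rule nn_rho) blast
  obtain C where C: "C > 0" "\<And>n k. 1 \<le> n \<Longrightarrow>
      emeasure \<mu>0 (tail n k) \<le> ennreal (C * real n powr (- \<beta>) * S k)"
    by (rule tail_bound) blast
  obtain c where c: "c > 0" "\<And>n. 1 \<le> n \<Longrightarrow> ennreal (c * real n powr (- \<beta>)) \<le> emeasure \<mu>0 (Phi n)"
    by (rule Phi_lower) blast
  define D where "D = C * (\<Sum>k. real (Suc k) * S k)"
  have D0: "0 \<le> D" using C S_nonneg S_summable by (auto simp: D_def intro!: mult_nonneg_nonneg suminf_nonneg)
  \<comment> \<open>\<open>D\<close> serves for \<open>n \<ge> 1\<close>, and \<open>r\<close>, the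
    integral of \<open>\<rho>\<close>, for \<open>n = 0\<close>; \<open>c\<close> is the constant of
    the lower bound for the mass.\<close>
  define C' where "C' = (D + r) / c"
  have C': "C' > 0" using D0 r c by (simp add: C'_def)
  have "(\<integral>\<^sup>+ y \<in> Phi n. ennreal (real (\<rho> y)) \<partial>\<mu>0) \<le> ennreal C' * emeasure \<mu>0 (Phi n)" for n
  \<comment> \<open>The power bounds start at 1. For \<open>n = 0\<close> the whole integral of
    \<open>\<rho>\<close> is compared with the mass of \<open>Phi 1\<close>, a subset of
    \<open>Phi 0\<close>.\<close>
  proof (cases "n = 0")
    case True
    have "(\<integral>\<^sup>+ y \<in> Phi n. ennreal (real (\<rho> y)) \<partial>\<mu>0) \<le> (\<integral>\<^sup>+y. of_nat (\<rho> y) \<partial>\<mu>0)"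
      by (intro nn_integral_mono) (auto simp: ennreal_of_nat_eq_real_of_nat split: split_indicator)
    also have "\<dots> = ennreal r" by (rule r)
    also have "\<dots> \<le> ennreal (C' * (c * real 1 powr (- \<beta>)))"
      using c D0 by (intro ennreal_leI) (simp add: C'_def)
    also have "\<dots> = ennreal C' * ennreal (c * real 1 powr (- \<beta>))"
      using C' c by (intro ennreal_mult) auto
    also have "\<dots> \<le> ennreal C' * emeasure \<mu>0 (Phi 1)"
      using c(2)[of 1] by (intro mult_left_mono) auto
    also have "\<dots> \<le> ennreal C' * emeasure \<mu>0 (Phi n)"
    proof (intro mult_left_mono emeasure_mono Phi_sets)
      have "enat n < x" if "enat 1 < x" for x using that True by (cases x) auto
      then show "Phi 1 \<subseteq> Phi n" by (auto simp: Phi_def)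
    qed simp
    finally show ?thesis .
  next
    case False
    then have n: "1 \<le> n" by simp
    have "(\<integral>\<^sup>+ y \<in> Phi n. ennreal (real (\<rho> y)) \<partial>\<mu>0) \<le> (\<integral>\<^sup>+y. weight (tail n) y \<partial>\<mu>0)"
    proof (rule nn_integral_mono_AE)
      show "AE y in \<mu>0. ennreal (real (\<rho> y)) * indicator (Phi n) y \<le> weight (tail n) y"
        using AE_less_1
      proof eventually_elim
        case (elim y) then show ?case using rho_tail[of y n] by (simp add: ennreal_of_nat_eq_real_of_nat)
      qed
    qed
    also have "\<dots> \<le> ennreal (C * real n powr (- \<beta>) * (\<Sum>k. real (Suc k) * S k))"
      by (rule weight_integral) (use near_sets C n in auto)
    also have "\<dots> \<le> ennreal (C' * (c * real n powr (- \<beta>)))"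
    proof (rule ennreal_leI)
      have "C * real n powr (- \<beta>) * (\<Sum>k. real (Suc k) * S k) = D * real n powr (- \<beta>)"
        by (simp add: D_def mult_ac)
      also have "\<dots> \<le> (D + r) * real n powr (- \<beta>)" using r by (intro mult_right_mono) auto
      also have "\<dots> = C' * (c * real n powr (- \<beta>))" using c by (simp add: C'_def)
      finally show "C * real n powr (- \<beta>) * (\<Sum>k. real (Suc k) * S k) \<le> C' * (c * real n powr (- \<beta>))" .
    qed
    also have "\<dots> = ennreal C' * ennreal (c * real n powr (- \<beta>))"
      using C' c by (intro ennreal_mult) auto
    also have "\<dots> \<le> ennreal C' * emeasure \<mu>0 (Phi n)"
      using c(2)[OF n] by (intro mult_left_mono) auto
    finally show ?thesis .
  qed
  then show ?thesis using C' by blast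
qed

end

theorem lemma9p2:
  fixes \<alpha> b \<beta> \<rho>bar :: real and Y :: "real set"
    and f :: "real \<Rightarrow> real" and \<tau> \<phi> :: "real \<Rightarrow> enat" and \<rho> :: "real \<Rightarrow> nat"
    and \<mu>\<^sub>0 \<mu>\<^sub>\<tau> :: "real measure"
  assumes "\<alpha> > 0" and "0 < b" and "b \<le> 1"
  defines "\<beta> \<equiv> 1 / \<alpha>"
    and "f \<equiv> pm_map \<alpha> b"
    and "Y \<equiv> pm_base \<alpha> b"
    and "\<tau> \<equiv> pm_tau \<alpha> b"
    and "\<phi> \<equiv> pm_phi \<alpha> b"
    and "\<rho> \<equiv> pm_rho \<alpha> b"
    and "\<rho>bar \<equiv> (LINT y|\<mu>\<^sub>0. real (\<rho> y))"
  assumes "acip Y (induced_map f \<phi>) \<mu>\<^sub>0"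
    and "acip Y (induced_map f \<tau>) \<mu>\<^sub>\<tau>"
  shows "(\<lambda>n. \<bar>1 / \<rho>bar * measure \<mu>\<^sub>0 {y \<in> Y. \<phi> y > enat n}
               - measure \<mu>\<^sub>\<tau> {y \<in> Y. \<tau> y > enat n}\<bar>)
           \<in> O(\<lambda>n. real n powr (- (1 + \<beta>)))
       \<and> (\<exists>C>0. \<forall>n. (\<integral>\<^sup>+ y \<in> {y \<in> Y. \<phi> y > enat n}. ennreal (real (\<rho> y)) \<partial>\<mu>\<^sub>0)
                 \<le> ennreal C * emeasure \<mu>\<^sub>0 {y \<in> Y. \<phi> y > enat n})"
proof -
  interpret P: intermittent \<alpha> b by unfold_locales fact+
  interpret P: intermittent_acip \<alpha> b \<mu>\<^sub>0 \<mu>\<^sub>\<tau>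
  proof
    show "acip {P.e0..1} (induced_map (pm_map \<alpha> b) (pm_phi \<alpha> b)) \<mu>\<^sub>0"
      "acip {P.e0..1} (induced_map (pm_map \<alpha> b) (pm_tau \<alpha> b)) \<mu>\<^sub>\<tau>"
      using assms(11,12) unfolding f_def Y_def \<phi>_def \<tau>_def P.pm_base_eq .
  qed
  show ?thesis
    using P.tail_comparison P.rho_tail_integral
    unfolding \<beta>_def f_def Y_def \<tau>_def \<phi>_def \<rho>_def \<rho>bar_def P.pm_base_eq P.Phi_def P.T_def P.\<beta>_def
    by blast
qed

end
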